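(* Let $\sigma,\theta\in(0,1)$ and let $x>0$. Then for every non-negative integer $k$, $$\frac{\partial^{2k}}{\partial\sigma^{k}\partial\theta^{k}}\Bigg\{{\sum_{mn\leq x}}^{\prime}\cos(2\pi m\sigma)\sin(2\pi n\theta)+\frac{\cot(\pi\theta)}{4}\Bigg\}$$ $$=\frac{\sqrt{x}}{4}\sum_{m=0}^{\infty}\sum_{n=0}^{\infty}\frac{\partial^{2k}}{\partial\sigma^{k}\partial\theta^{k}}\Bigg\{\frac{J_1(4\pi\sqrt{(m+\sigma)(n+\theta)x})}{\sqrt{(m+\sigma)(n+\theta)}}+\frac{J_1(4\pi\sqrt{(m+1-\sigma)(n+\theta)x})}{\sqrt{(m+1-\sigma)(n+\theta)}}$$ $$-\frac{J_1(4\pi\sqrt{(m+\sigma)(n+1-\theta)x})}{\sqrt{(m+\sigma)(n+1-\theta)}}-\frac{J_1(4\pi\sqrt{(m+1-\sigma)(n+1-\theta)x})}{\sqrt{(m+1-\sigma)(n+1-\theta)}}\Bigg\}.$$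
   Context: $J_\nu$ is the ordinary Bessel function (of the first kind) of order $\nu$. The sum ${\sum}^{\prime}_{mn\le x}$ runs over pairs of positive integers $m,n$ with $mn\le x$; the prime means that if $x$ is an integer, the terms with $mn=x$ are multiplied by $\tfrac12$ (if $x$ is not an integer the prime has no effect). The double series on the right is an iterated series, with inner sum over $n$ and outer sum over $m$; for each $(m,n)$ the four-term bracket is taken as a single summand. *)

theory Defs
  imports "HOL-Analysis.Analysis"
begin

text \<open>
  The power series of \<open>J\<^sub>\<nu>(z)\<close> for real order and \<open>z > 0\<close>; \<open>rGamma\<close> is the reciprocal Gamma
  function, which vanishes at the poles of Gamma.  Not meant for \<open>z \<le> 0\<close> (for instance,
  \<open>0 powr 0 = 0\<close> would give the wrong value of \<open>J\<^sub>0(0)\<close>).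
\<close>
definition bessel_J :: "real \<Rightarrow> real \<Rightarrow> real" where
  "bessel_J \<nu> z =
     (\<Sum>k. (-1) ^ k * rGamma (\<nu> + real k + 1) / fact k * (z / 2) powr (\<nu> + 2 * real k))"

definition primed_sum :: "real \<Rightarrow> (nat \<Rightarrow> nat \<Rightarrow> real) \<Rightarrow> real" where
  "primed_sum x f =
     (\<Sum>(m, n) \<in> {(m, n). 1 \<le> m \<and> 1 \<le> n \<and> real (m * n) \<le> x}.
        (if real (m * n) = x then 1 / 2 else 1) * f m n)"

text \<open>
  The operator \<open>\<partial>\<^sup>2\<^sup>k / \<partial>\<sigma>\<^sup>k\<partial>\<theta>\<^sup>k\<close>, applied to a function of \<open>(\<sigma>, \<theta>)\<close>; first \<open>k\<close> derivatives
  in \<open>\<theta>\<close>, then \<open>k\<close> in \<open>\<sigma>\<close>.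
\<close>
definition mixed_deriv :: "nat \<Rightarrow> (real \<Rightarrow> real \<Rightarrow> real) \<Rightarrow> real \<Rightarrow> real \<Rightarrow> real" where
  "mixed_deriv k F \<sigma> \<theta> = (deriv ^^ k) (\<lambda>s. (deriv ^^ k) (\<lambda>t. F s t) \<theta>) \<sigma>"

definition bessel_term :: "real \<Rightarrow> real \<Rightarrow> real \<Rightarrow> real" where
  "bessel_term x u v = bessel_J 1 (4 * pi * sqrt (u * v * x)) / sqrt (u * v)"

definition bessel_bracket :: "real \<Rightarrow> nat \<Rightarrow> nat \<Rightarrow> real \<Rightarrow> real \<Rightarrow> real" where
  "bessel_bracket x m n \<sigma> \<theta> =
     bessel_term x (real m + \<sigma>) (real n + \<theta>)
     + bessel_term x (real m + 1 - \<sigma>) (real n + \<theta>)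
     - bessel_term x (real m + \<sigma>) (real n + 1 - \<theta>)
     - bessel_term x (real m + 1 - \<sigma>) (real n + 1 - \<theta>)"

end

theory Submission
  imports Defs "HOL-Probability.Sinc_Integral"
begin

text \<open>
  Put \<open>\<lambda> = 4\<pi>\<^sup>2x\<close>.  Because \<open>J\<^sub>1(2\<surd>y)/\<surd>y = \<Sum>\<^sub>j (-y)\<^sup>j / (j!(j+1)!)\<close> is an entire function \<open>G\<^sub>0\<close>,
  every Bessel term is \<open>2\<pi>\<surd>x G\<^sub>0(\<lambda>uv)\<close> with \<open>u\<close>, \<open>v\<close> affine in \<open>\<sigma>\<close>, \<open>\<theta>\<close>, and comparing
  coefficients shows that differentiating \<open>k\<close> times in both variables turns \<open>G\<^sub>0(\<lambda>uv)\<close> into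
  \<open>(-\<lambda>)\<^sup>k G\<^sub>k(\<lambda>uv)\<close>, where \<open>G\<^sub>k(y) = \<integral>\<^sub>0\<^sup>1 t\<^sup>k J\<^sub>0(2\<surd>(ty)) dt\<close>.  So each
  summand is explicit, and one has to sum the functions \<open>G\<^sub>k\<close> (\<open>clifford_moment\<close> below).

  The inner sum is evaluated by Poisson summation in \<open>n\<close>.  The derivative of \<open>G\<^sub>k\<close> decays like
  \<open>y\<^bsup>-5/4\<^esup>\<close>, which is enough for a Poisson formula on the half-line
  (\<open>Poisson_summation_half_line\<close>), and the Fourier transform of \<open>G\<^sub>k\<close> is an elementary integral
  (\<open>clifford_moment_cos_transform\<close>), since the Laplace transform of \<open>J\<^sub>0(2\<surd>(cb))\<close> is
  \<open>exp(-c/s)/s\<close>.  The four terms of a bracket combine by addition theorems, and the inner sum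
  becomes, up to a constant, a series over \<open>j \<ge> 1\<close> of
  \<open>\<integral>\<^sub>0\<^bsup>x/j\<^esup> (jw)\<^sup>k sin(2\<pi>j\<theta> + k\<pi>/2) cos(2\<pi>(\<sigma> - 1/2)w + k\<pi>/2) cos((2m+1)\<pi>w) dw\<close>
  (\<open>bessel_bracket_series\<close>).

  The index \<open>m\<close> now occurs only in the last cosine, so the sum over \<open>m < M\<close> produces the
  Dirichlet-type kernel \<open>sin(2\<pi>Mw)/sin(\<pi>w)\<close>, integrated over \<open>[0, x]\<close> against the cosine and
  \<open>H(w) = \<Sum>\<^bsub>j \<le> x/w\<^esub> (jw)\<^sup>k sin(2\<pi>j\<theta> + k\<pi>/2)\<close> (\<open>partial_sum_eq_dirichlet_integral\<close>).  As \<open>M\<close>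
  grows, the kernel picks out the positive integers \<open>w = l\<close>.  This gives the terms of the finite
  sum over \<open>jl \<le> x\<close>; for \<open>jl = x\<close> the integrand is cut off exactly at \<open>w = l\<close> and only half
  of the mass counts, which is the meaning of the prime.

  The delicate point is \<open>w = 0\<close>, also an integer, where \<open>H\<close> has infinitely many jumps.  Summation
  by parts gives \<open>H(w) = x\<^sup>k b(\<lfloor>x/w\<rfloor>) - 0\<^sup>k b(0) + O(w)\<close> with \<open>b\<close> a cosine of frequency \<open>2\<pi>\<theta>\<close>
  (\<open>hyperbola_sum_near_0\<close>).  The constant exists for \<open>k = 0\<close> only and accounts for the term
  \<open>cot(\<pi>\<theta>)/4\<close>, and the error \<open>O(w)\<close> is harmless by the Riemann-Lebesgue lemma.  The
  oscillating part is treated by scaling: in the variable \<open>v\<close> given by \<open>w = x/(Tv)\<close>,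
  \<open>T\<^sup>2 = 2\<pi>Mx\<close>, one meets \<open>\<integral> cos(2\<pi>\<theta>\<lfloor>Tv\<rfloor> + \<psi>) sin(T/v) dv/v\<close>.  Shifting \<open>v\<close> by \<open>i/T\<close>
  multiplies the exponentials in the integrand by the \<open>i\<close>-th power of \<open>cis(2\<pi>\<theta> \<mp> v\<^bsup>-2\<^esup>)\<close> up to
  \<open>O(1/T)\<close>, and the means of these powers tend to 0 for almost all \<open>v\<close>
  (\<open>floor_oscillation_tendsto_0\<close>).
\<close>

section \<open>Riemann-Lebesgue and Dirichlet's integral\<close>

lemma bounded_measurable_absolutely_integrable:
  fixes f :: "real \<Rightarrow> 'a::euclidean_space"
  assumes "f \<in> borel_measurable (lebesgue_on {a..b})" "\<And>t. t \<in> {a..b} \<Longrightarrow> norm (f t) \<le> B"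
  shows "f absolutely_integrable_on {a..b}"
  by (rule measurable_bounded_by_integrable_imp_absolutely_integrable[of f "{a..b}" "\<lambda>_. B"])
     (use assms in auto)

lemma bounded_measurable_integrable:
  fixes f :: "real \<Rightarrow> 'a::euclidean_space"
  assumes "f \<in> borel_measurable (lebesgue_on {a..b})" "\<And>t. t \<in> {a..b} \<Longrightarrow> norm (f t) \<le> B"
  shows "f integrable_on {a..b}"
  using bounded_measurable_absolutely_integrable[OF assms] set_lebesgue_integral_eq_integral(1) by blast

lemma borel_measurable_imp_lebesgue_on:
  assumes "f \<in> borel_measurable borel"
  shows "f \<in> borel_measurable (lebesgue_on S)"
  using assms by (simp add: measurable_completion measurable_restrict_space1)

text \<open>
  Over whole periods the common phase \<open>\<psi>\<close> does not affect orthogonality: the product-to-sum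
  formula leaves \<open>\<psi>\<close> only in the term of frequency \<open>i + j\<close>, which integrates to 0.
\<close>
lemma sin_product_has_integral:
  fixes N i j :: nat and \<psi> :: real
  assumes "1 \<le> i" "1 \<le> j"
  shows "((\<lambda>w. sin (2*pi*real i*w + \<psi>) * sin (2*pi*real j*w + \<psi>)) has_integral
           (if i = j then real N else 0)) {-real N..real N}"
proof -
  have s: "((\<lambda>w. cos (2*pi*real_of_int m*w + c)) has_integral 0) {-real N..real N}" if "m \<noteq> 0" for m c
  proof -
    have "((\<lambda>w. cos (2*pi*real_of_int m*w + c)) has_integral
        (sin (2*pi*real_of_int m*real N + c) / (2*pi*m) - sin (2*pi*real_of_int m*(-real N) + c) / (2*pi*m)))
        {-real N..real N}"
      by (rule fundamental_theorem_of_calculus)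
         (use that in \<open>auto intro!: derivative_eq_intros simp flip: has_real_derivative_iff_has_vector_derivative\<close>)
    moreover have "sin (2*pi*real_of_int m*real N + c) = sin (2*pi*real_of_int m*(-real N) + c)"
    proof -
      have "2*pi*real_of_int m*real N + c = (2*pi*real_of_int m*(-real N) + c) + 2*pi*real_of_int (2*m*int N)"
        by (simp add: algebra_simps)
      thus ?thesis using sin.plus_of_int[of "2*pi*real_of_int m*(-real N) + c" "2*m*int N"]
        by (simp add: algebra_simps)
    qed
    ultimately show ?thesis by simp
  qed
  have eq: "sin (2*pi*real i*w + \<psi>) * sin (2*pi*real j*w + \<psi>) =
     (1/2) * cos (2*pi*real_of_int (int i - int j)*w + 0) - (1/2) * cos (2*pi*real_of_int (int i + int j)*w + 2*\<psi>)" for w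
    unfolding sin_times_sin by (simp add: algebra_simps diff_divide_distrib)
  have b: "((\<lambda>w. (1/2) * cos (2*pi*real_of_int (int i + int j)*w + 2*\<psi>)) has_integral (1/2)*0) {-real N..real N}"
    by (intro has_integral_mult_right s) (use assms in auto)
  have a: "((\<lambda>w. (1/2) * cos (2*pi*real_of_int (int i - int j)*w + 0)) has_integral (if i = j then real N else 0)) {-real N..real N}"
  proof (cases "i = j")
    case True
    have "((\<lambda>w::real. 1/2::real) has_integral (real N - - real N) *\<^sub>R (1/2)) {-real N..real N}"
      using has_integral_const_real[of "1/2::real" "-real N" "real N"] by (simp add: algebra_simps)
    then show ?thesis using True by simp
  next
    case False
    then show ?thesis using has_integral_mult_right[OF s[of "int i - int j" 0], of "1/2"] by simp
  qed
  show ?thesis unfolding eq using has_integral_diff[OF a b] by simp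
qed

text \<open>
  Bessel's inequality: the square of \<open>g\<close> minus its orthogonal projections has a nonnegative
  integral, so the squares of the coefficients are summable.
\<close>
lemma sin_coefficients_tendsto_0:
  fixes g :: "real \<Rightarrow> real" and N :: nat
  assumes g: "g \<in> borel_measurable (lebesgue_on {-real N..real N})"
    and B: "\<And>w. w \<in> {-real N..real N} \<Longrightarrow> \<bar>g w\<bar> \<le> B" and N: "0 < N"
  shows "(\<lambda>M. integral {-real N..real N} (\<lambda>w. g w * sin (2*pi*real M*w + \<psi>))) \<longlonglongrightarrow> 0"
proof -
  let ?I = "{-real N..real N}"
  define \<phi> where "\<phi> j = (\<lambda>w. sin (2*pi*real (Suc j)*w + \<psi>))" for j
  define c where "c j = integral ?I (\<lambda>w. g w * \<phi> j w)" for j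
  \<comment> \<open>The remainder after projecting out the first \<open>J\<close> harmonics.\<close>
  define r where "r J = (\<lambda>w. g w - (\<Sum>j<J. c j / N * \<phi> j w))" for J
  have \<phi>m: "\<phi> j \<in> borel_measurable (lebesgue_on ?I)" for j
    unfolding \<phi>_def by (intro continuous_imp_measurable_on_sets_lebesgue continuous_intros) auto
  have \<phi>1: "\<bar>\<phi> j w\<bar> \<le> 1" for j w unfolding \<phi>_def by simp
  have rm: "r J \<in> borel_measurable (lebesgue_on ?I)" for J
    unfolding r_def using g \<phi>m by auto
  have rb: "\<bar>r J w\<bar> \<le> B + (\<Sum>j<J. \<bar>c j / N\<bar>)" if "w \<in> ?I" for J w
  proof -
    have "\<bar>\<Sum>j<J. c j / N * \<phi> j w\<bar> \<le> (\<Sum>j<J. \<bar>c j / N\<bar>)"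
      by (intro order_trans[OF sum_abs] sum_mono) (use \<phi>1 in \<open>auto simp: abs_mult intro!: divide_right_mono mult_left_le\<close>)
    with B[OF that] show ?thesis unfolding r_def by linarith
  qed
  have int: "(\<lambda>w. u w * v w) integrable_on ?I"
    if "u \<in> borel_measurable (lebesgue_on ?I)" "v \<in> borel_measurable (lebesgue_on ?I)"
       "\<And>w. w \<in> ?I \<Longrightarrow> \<bar>u w\<bar> \<le> Bu" "\<And>w. w \<in> ?I \<Longrightarrow> \<bar>v w\<bar> \<le> Bv" for u v :: "real \<Rightarrow> real" and Bu Bv
  proof (rule bounded_measurable_integrable[where B = "Bu * Bv"])
    show "(\<lambda>w. u w * v w) \<in> borel_measurable (lebesgue_on ?I)" using that(1,2) by measurable
    show "norm (u t * v t) \<le> Bu * Bv" if "t \<in> ?I" for t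
      unfolding real_norm_def abs_mult
      by (intro mult_mono \<open>\<And>w. w \<in> ?I \<Longrightarrow> \<bar>u w\<bar> \<le> Bu\<close> \<open>\<And>w. w \<in> ?I \<Longrightarrow> \<bar>v w\<bar> \<le> Bv\<close> that abs_ge_zero
            order_trans[OF abs_ge_zero[of "u t"]])
  qed
  have hc: "((\<lambda>w. g w * \<phi> j w) has_integral c j) ?I" for j
    unfolding c_def by (intro integrable_integral int[OF g \<phi>m B \<phi>1])
  have orth: "((\<lambda>w. \<phi> i w * \<phi> j w) has_integral (if i = j then real N else 0)) ?I" for i j
    using sin_product_has_integral[of "Suc i" "Suc j" \<psi> N] unfolding \<phi>_def by simp
  have rphi: "((\<lambda>w. r J w * \<phi> J w) has_integral c J) ?I" for J
  proof -
    have "((\<lambda>w. g w * \<phi> J w - (\<Sum>j<J. c j / N * (\<phi> j w * \<phi> J w))) has_integral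
             c J - (\<Sum>j<J. c j / N * (if j = J then real N else 0))) ?I"
      by (intro has_integral_diff hc has_integral_sum has_integral_mult_right orth) auto
    moreover have "(\<Sum>j<J. c j / N * (if j = J then real N else 0)) = 0" by (intro sum.neutral) auto
    ultimately show ?thesis unfolding r_def by (simp add: left_diff_distrib sum_distrib_right mult.assoc)
  qed
  have step: "((\<lambda>w. (r J w)\<^sup>2) has_integral (integral ?I (\<lambda>w. (g w)\<^sup>2) - (\<Sum>j<J. (c j)\<^sup>2 / N))) ?I" for J
  proof (induction J)
    case 0
    show ?case unfolding r_def by (simp add: power2_eq_square, intro integrable_integral int[OF g g B B])
  next
    case (Suc J)
    have "((\<lambda>w. (r J w)\<^sup>2 - (2 * (c J / N)) * (r J w * \<phi> J w) + (c J / N)\<^sup>2 * (\<phi> J w * \<phi> J w)) has_integral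
      (integral ?I (\<lambda>w. (g w)\<^sup>2) - (\<Sum>j<J. (c j)\<^sup>2 / N)) - (2 * (c J / N)) * c J + (c J / N)\<^sup>2 * (if J = J then real N else 0)) ?I"
      by (intro has_integral_add has_integral_diff Suc.IH has_integral_mult_right rphi orth)
    moreover have "(r (Suc J) w)\<^sup>2 = (r J w)\<^sup>2 - (2 * (c J / N)) * (r J w * \<phi> J w) + (c J / N)\<^sup>2 * (\<phi> J w * \<phi> J w)" for w
      unfolding r_def by (simp add: algebra_simps power2_eq_square)
    moreover have "(integral ?I (\<lambda>w. (g w)\<^sup>2) - (\<Sum>j<J. (c j)\<^sup>2 / N)) - (2 * (c J / N)) * c J + (c J / N)\<^sup>2 * (if J = J then real N else 0)
        = integral ?I (\<lambda>w. (g w)\<^sup>2) - (\<Sum>j<Suc J. (c j)\<^sup>2 / N)"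
      using N by (simp add: power2_eq_square)
    ultimately show ?case by (simp only:)
  qed
  have "(\<Sum>j<J. (c j)\<^sup>2 / N) \<le> integral ?I (\<lambda>w. (g w)\<^sup>2)" for J
    using has_integral_nonneg[OF step[of J]] by simp
  hence "summable (\<lambda>j. (c j)\<^sup>2 / N)" by (intro summableI_nonneg_bounded) auto
  hence "(\<lambda>j. N * ((c j)\<^sup>2 / N)) \<longlonglongrightarrow> real N * 0" by (intro tendsto_intros summable_LIMSEQ_zero)
  hence "(\<lambda>j. (c j)\<^sup>2) \<longlonglongrightarrow> 0" using N by simp
  hence "c \<longlonglongrightarrow> 0" using tendsto_real_sqrt[of "\<lambda>j. (c j)\<^sup>2" 0] by (simp add: tendsto_rabs_zero_iff)
  thus ?thesis
    apply (subst filterlim_sequentially_Suc[symmetric])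
    unfolding c_def \<phi>_def .
qed

text \<open>
  The Riemann-Lebesgue lemma for bounded functions along integer frequencies.  Extending \<open>g\<close> by 0
  to an interval \<open>[-N, N]\<close>, which consists of whole periods, reduces it to the decay of Fourier
  coefficients.
\<close>
lemma Riemann_Lebesgue_bounded:
  fixes g :: "real \<Rightarrow> real"
  assumes g: "g \<in> borel_measurable (lebesgue_on {a..b})"
    and B: "\<And>w. w \<in> {a..b} \<Longrightarrow> \<bar>g w\<bar> \<le> B"
  shows "(\<lambda>M. integral {a..b} (\<lambda>w. g w * sin (2*pi*real M*w + \<psi>))) \<longlonglongrightarrow> 0"
proof -
  \<comment> \<open>A positive integer is needed, so that the enlarged interval is made of whole periods.\<close>
  define N where "N = Suc (nat \<lceil>max \<bar>a\<bar> \<bar>b\<bar>\<rceil>)"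
  have N: "0 < N" "\<bar>a\<bar> \<le> real N" "\<bar>b\<bar> \<le> real N" unfolding N_def by linarith+
  let ?g = "\<lambda>w. if w \<in> {a..b} then g w else 0"
  have sub: "{a..b} \<subseteq> {-real N..real N}" using N by auto
  have "?g \<in> borel_measurable lebesgue" using g by (subst borel_measurable_if) auto
  hence m: "?g \<in> borel_measurable (lebesgue_on {-real N..real N})" by (rule measurable_restrict_space1)
  have "(\<lambda>M. integral {-real N..real N} (\<lambda>w. ?g w * sin (2*pi*real M*w + \<psi>))) \<longlonglongrightarrow> 0"
  proof (rule sin_coefficients_tendsto_0[OF m _ N(1)])
    fix w show "\<bar>?g w\<bar> \<le> \<bar>B\<bar>"
      using B[of w] by (cases "w \<in> {a..b}") (auto intro: order_trans[OF _ abs_ge_self])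
  qed
  moreover have "integral {-real N..real N} (\<lambda>w. ?g w * sin (2*pi*real M*w + \<psi>))
      = integral {a..b} (\<lambda>w. g w * sin (2*pi*real M*w + \<psi>))" for M
  proof -
    have "(\<lambda>w. ?g w * sin (2*pi*real M*w + \<psi>)) = (\<lambda>w. if w \<in> {a..b} then g w * sin (2*pi*real M*w + \<psi>) else 0)"
      by auto
    thus ?thesis by (simp only: Henstock_Kurzweil_Integration.integral_restrict_Int Int_absorb2[OF sub] cong: if_cong)
  qed
  ultimately show ?thesis by simp
qed

lemma sin_ge_half:
  fixes t :: real assumes "0 \<le> t" "t \<le> pi/2" shows "t / 2 \<le> sin t"
proof -
  have "\<bar>sin t - (\<Sum>m<3. sin_coeff m * t ^ m)\<bar> \<le> inverse (fact 3) * \<bar>t\<bar> ^ 3" by (rule Maclaurin_sin_bound)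
  hence "t - t^3/6 \<le> sin t" using assms by (simp add: numeral_3_eq_3 sin_coeff_def fact_reduce abs_if split: if_splits)
  moreover have "t^2 \<le> 3"
  proof -
    have "t \<le> 1.7" using assms pi_less_4 pi_approx by simp
    hence "t^2 \<le> 1.7^2" using assms by (intro power_mono) auto
    thus ?thesis by (simp add: power2_eq_square)
  qed
  hence "t * t^2 \<le> t * 3" using assms by (intro mult_left_mono) auto
  ultimately show ?thesis by (simp add: power3_eq_cube power2_eq_square)
qed

text \<open>
  The difference is \<open>O(t)\<close> at 0, so \<open>1/sin t\<close> may be traded for \<open>1/t\<close> at the price of a
  bounded function, to which the Riemann-Lebesgue lemma applies.
\<close>
lemma inverse_sin_minus_inverse:
  fixes t :: real assumes "0 < t" "t \<le> pi/2" shows "\<bar>1 / sin t - 1 / t\<bar> \<le> 1"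
proof -
  have "\<bar>sin t - (\<Sum>m<3. sin_coeff m * t ^ m)\<bar> \<le> inverse (fact 3) * \<bar>t\<bar> ^ 3" by (rule Maclaurin_sin_bound)
  hence 1: "\<bar>sin t - t\<bar> \<le> t^3/6" using assms by (simp add: numeral_3_eq_3 sin_coeff_def fact_reduce)
  have 2: "t/2 \<le> sin t" using sin_ge_half assms by simp
  hence s: "0 < sin t" using assms by linarith
  have "\<bar>1 / sin t - 1 / t\<bar> = \<bar>sin t - t\<bar> / (sin t * t)"
    using s assms by (simp add: divide_simps abs_minus_commute abs_mult)
  also have "\<dots> \<le> (t^3/6) / (t/2 * t)" using 1 2 s assms by (intro frac_le mult_right_mono) auto
  also have "\<dots> = t / 3" using assms by (simp add: power3_eq_cube)
  also have "\<dots> \<le> 1" using assms pi_less_4 by simp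
  finally show ?thesis .
qed

text \<open>
  The integral is \<open>Si(2\<pi>Mh)/\<pi>\<close>, and the sine integral tends to \<open>\<pi>/2\<close>.
\<close>
lemma sinc_integral_tendsto:
  fixes h :: real assumes "0 < h"
  shows "(\<lambda>v. sin (2*pi*real M * v) / (pi * v)) integrable_on {0..h}"
    and "(\<lambda>M. integral {0..h} (\<lambda>v. sin (2*pi*real M * v) / (pi * v))) \<longlonglongrightarrow> 1/2"
proof -
  have I: "((\<lambda>v. sin (2*pi*real M * v) / (pi * v)) has_integral (Si (2*pi*real M*h) / pi - Si (2*pi*real M*0) / pi)) {0..h}" for M
  proof (rule fundamental_theorem_of_calculus_interior)
    have D: "((\<lambda>v. Si (2*pi*real M * v) / pi) has_real_derivative sinc (2*pi*real M * v) * (2*pi*real M) / pi) (at v)" for v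
      by (intro DERIV_cdivide DERIV_chain2[OF DERIV_Si] DERIV_cmult_Id)
    show "continuous_on {0..h} (\<lambda>v. Si (2*pi*real M * v) / pi)"
      by (rule DERIV_continuous_on, rule has_field_derivative_at_within[OF D])
    fix v assume v: "v \<in> {0<..<h}"
    note D[of v]
    moreover have "sinc (2*pi*real M * v) * (2*pi*real M) / pi = sin (2*pi*real M * v) / (pi * v)"
      using v by (cases "M = 0") (auto simp: field_simps)
    ultimately show "((\<lambda>v. Si (2*pi*real M * v) / pi) has_vector_derivative sin (2*pi*real M * v) / (pi * v)) (at v)"
      by (simp add: has_real_derivative_iff_has_vector_derivative)
  qed (use assms in auto)
  show "(\<lambda>v. sin (2*pi*real M * v) / (pi * v)) integrable_on {0..h}" using I by (rule has_integral_integrable)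
  have "filterlim (\<lambda>M. (2*pi*h) * real M) at_top sequentially"
    using assms by (intro filterlim_tendsto_pos_mult_at_top[OF tendsto_const _ filterlim_real_sequentially]) auto
  hence "(\<lambda>M. Si ((2*pi*h) * real M)) \<longlonglongrightarrow> pi/2" by (rule filterlim_compose[OF Si_at_top])
  hence "(\<lambda>M. Si (2*pi*real M*h) / pi - Si 0 / pi) \<longlonglongrightarrow> (pi/2) / pi - Si 0 / pi"
    by (intro tendsto_intros) (auto simp: mult_ac)
  moreover have "Si 0 = 0" using Si_neg[of 0] by simp
  ultimately show "(\<lambda>M. integral {0..h} (\<lambda>v. sin (2*pi*real M * v) / (pi * v))) \<longlonglongrightarrow> 1/2"
    using integral_unique[OF I] by simp
qed

text \<open>
  Dirichlet's theorem at one end of an interval.  The quotient \<open>p(v)/sin(\<pi>v)\<close> differs from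
  \<open>p0/(\<pi>v)\<close> by a bounded function, and the latter is integrated by the sine integral.  The
  hypothesis on \<open>p\<close> is a bound at 0 rather than continuity, because it will be applied to functions
  with jumps arbitrarily close to 0.
\<close>
lemma Dirichlet_quotient_tendsto:
  fixes p :: "real \<Rightarrow> real"
  assumes p: "p \<in> borel_measurable (lebesgue_on {0..h})" and h: "0 < h" "h \<le> 1/2"
    and L: "\<And>v. v \<in> {0<..h} \<Longrightarrow> \<bar>p v - p0\<bar> \<le> L * v"
  shows "(\<lambda>M. integral {0..h} (\<lambda>v. p v * (sin (2*pi*real M * v) / sin (pi * v)))) \<longlonglongrightarrow> p0 / 2"
proof -
  define g where "g v = p v / sin (pi * v) - p0 / (pi * v)" for v
  have L0: "0 \<le> L" using order_trans[OF abs_ge_zero L[of h]] h by (simp add: zero_le_mult_iff)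
  have gm: "g \<in> borel_measurable (lebesgue_on {0..h})"
  proof -
    have "(\<lambda>v. sin (pi * v)) \<in> borel_measurable (lebesgue_on {0..h})" "(\<lambda>v. p0 / (pi * v)) \<in> borel_measurable (lebesgue_on {0..h})"
      by (rule borel_measurable_imp_lebesgue_on, measurable)+
    thus ?thesis unfolding g_def using p by simp
  qed
  have gb: "\<bar>g v\<bar> \<le> L + \<bar>p0\<bar>" if "v \<in> {0..h}" for v
  proof (cases "v = 0")
    case True then show ?thesis using L0 by (simp add: g_def)
  next
    case False
    hence v: "0 < v" "v \<le> 1/2" using that h by auto
    have s: "pi * v/2 \<le> sin (pi * v)" using sin_ge_half[of "pi * v"] v by simp
    have v2: "v \<le> pi * v/2" using v pi_gt3 by simp
    have sp: "0 < sin (pi * v)" using s v2 v by linarith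
    have "g v = (p v - p0) / sin (pi * v) + p0 * (1 / sin (pi * v) - 1/(pi * v))"
      unfolding g_def by (simp add: algebra_simps diff_divide_distrib)
    moreover have "\<bar>(p v - p0) / sin (pi * v)\<bar> \<le> L"
    proof -
      have "\<bar>p v - p0\<bar> \<le> L * sin (pi * v)"
      proof -
        have "\<bar>p v - p0\<bar> \<le> L * v" using L[of v] v that by simp
        also have "\<dots> \<le> L * sin (pi * v)" using L0 v2 s by (intro mult_left_mono) auto
        finally show ?thesis .
      qed
      thus ?thesis using sp by (simp add: divide_simps)
    qed
    moreover have "\<bar>p0 * (1 / sin (pi * v) - 1/(pi * v))\<bar> \<le> \<bar>p0\<bar>"
      using inverse_sin_minus_inverse[of "pi * v"] v by (simp add: abs_mult mult_left_le)
    ultimately show ?thesis by linarith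
  qed
  have gint: "(\<lambda>v. g v * sin (2*pi*real M * v + 0)) integrable_on {0..h}" for M
  proof (rule bounded_measurable_integrable[where B = "L + \<bar>p0\<bar>"])
    show "(\<lambda>v. g v * sin (2*pi*real M * v + 0)) \<in> borel_measurable (lebesgue_on {0..h})"
      by (intro borel_measurable_times gm borel_measurable_imp_lebesgue_on) measurable
    show "norm (g v * sin (2*pi*real M * v + 0)) \<le> L + \<bar>p0\<bar>" if "v \<in> {0..h}" for v
      using gb[OF that] mult_left_le[of "\<bar>sin (2*pi*real M * v + 0)\<bar>" "\<bar>g v\<bar>"] by (simp add: abs_mult)
  qed
  have "(\<lambda>M. integral {0..h} (\<lambda>v. g v * sin (2*pi*real M * v + 0)) + p0 * integral {0..h} (\<lambda>v. sin (2*pi*real M * v) / (pi * v))) \<longlonglongrightarrow> 0 + p0 * (1/2)"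
    by (intro tendsto_intros Riemann_Lebesgue_bounded[OF gm gb] sinc_integral_tendsto h)
  moreover have "integral {0..h} (\<lambda>v. p v * (sin (2*pi*real M * v) / sin (pi * v))) =
     integral {0..h} (\<lambda>v. g v * sin (2*pi*real M * v + 0)) + p0 * integral {0..h} (\<lambda>v. sin (2*pi*real M * v) / (pi * v))" for M
  proof -
    have "integral {0..h} (\<lambda>v. p v * (sin (2*pi*real M * v) / sin (pi * v))) =
      integral {0..h} (\<lambda>v. g v * sin (2*pi*real M * v + 0) + p0 * (sin (2*pi*real M * v) / (pi * v)))"
      by (rule arg_cong[where f = "integral {0..h}"]) (auto simp: g_def fun_eq_iff algebra_simps)
    also have "\<dots> = integral {0..h} (\<lambda>v. g v * sin (2*pi*real M * v + 0)) + integral {0..h} (\<lambda>v. p0 * (sin (2*pi*real M * v) / (pi * v)))"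
      by (intro integral_add gint integrable_on_mult_right sinc_integral_tendsto h)
    finally show ?thesis by (simp only: integral_mult_right)
  qed
  ultimately show ?thesis by simp
qed

text \<open>
  Half-odd frequencies, rather than integer ones, arise from adding the phases of \<open>m + \<sigma>\<close> and
  \<open>m + 1 - \<sigma>\<close>.
\<close>
definition dirichlet_kernel :: "nat \<Rightarrow> real \<Rightarrow> real" where
  "dirichlet_kernel M w = 2 * (\<Sum>m<M. cos ((2 * real m + 1) * pi * w))"

lemma sin_times_dirichlet_kernel: "sin (pi * w) * dirichlet_kernel M w = sin (2*pi*real M*w)"
proof (induction M)
  case 0 show ?case by (simp add: dirichlet_kernel_def)
next
  case (Suc M)
  have "sin (pi * w) * dirichlet_kernel (Suc M) w = sin (pi * w) * dirichlet_kernel M w + 2 * (sin (pi*w) * cos ((2 * real M + 1) * pi * w))"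
    by (simp add: dirichlet_kernel_def distrib_left)
  also have "2 * (sin (pi*w) * cos ((2 * real M + 1) * pi * w)) = sin (2*pi*real (Suc M)*w) - sin (2*pi*real M*w)"
  proof -
    have a: "pi*w + (2 * real M + 1) * pi * w = 2*pi*real (Suc M)*w" "pi*w - (2 * real M + 1) * pi * w = - (2*pi*real M*w)"
      by (simp_all add: algebra_simps)
    show ?thesis unfolding sin_times_cos a by simp
  qed
  finally show ?case using Suc by simp
qed

lemma continuous_dirichlet_kernel [continuous_intros]: "continuous_on S (dirichlet_kernel M)"
  unfolding dirichlet_kernel_def by (intro continuous_intros)

text \<open>
  The kernel is antiperiodic with period 1: near an integer \<open>l\<close> it looks as it does near 0, up
  to the sign \<open>(-1)\<^sup>l\<close>.
\<close>
lemma dirichlet_kernel_near_nat: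
  assumes "0 < v" "v < 1" "s = 1 \<or> s = -1"
  shows "dirichlet_kernel M (real l + s * v) = (-1)^l * (sin (2*pi*real M * v) / sin (pi * v))"
proof -
  have e: "sin (pi * (real l + s * v)) = (-1)^l * s * sin (pi * v)"
    using assms(3) by (auto simp: algebra_simps sin_add sin_diff)
  have f: "sin (2*pi*real M*(real l + s * v)) = s * sin (2*pi*real M * v)"
  proof -
    have "2*pi*real M*(real l + s * v) = s*(2*pi*real M * v) + 2*pi*real (M*l)" by (simp add: algebra_simps)
    hence "sin (2*pi*real M*(real l + s * v)) = sin (s*(2*pi*real M * v))"
      using sin.plus_of_nat[of "s*(2*pi*real M * v)" "M*l"] by (simp add: mult_ac)
    thus ?thesis using assms(3) by auto
  qed
  have sp: "sin (pi * v) \<noteq> 0" using sin_gt_zero[of "pi * v"] assms by simp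
  have "(-1)^l * s * sin (pi * v) * dirichlet_kernel M (real l + s * v) = s * sin (2*pi*real M * v)"
    using sin_times_dirichlet_kernel[of "real l + s * v" M] unfolding e f .
  moreover have "(-1)^l * (-1)^l = (1::real)" by (simp flip: power_mult_distrib)
  moreover have "s * s = 1" using assms(3) by auto
  ultimately have "sin (pi * v) * dirichlet_kernel M (real l + s * v) = (-1)^l * sin (2*pi*real M * v)"
    using assms(3) by (cases "even l") auto
  thus ?thesis using sp by (simp add: field_simps)
qed

text \<open>
  Each side of an integer contributes half of the value there.  The two sides are kept apart since
  the interval of integration may end at the integer.
\<close>
lemma dirichlet_kernel_half_interval:
  fixes p :: "real \<Rightarrow> real"
  assumes p: "L-lipschitz_on T p" and h: "0 < h" "h \<le> 1/2"
  shows "{real l..real l + h} \<subseteq> T \<Longrightarrow> (\<lambda>M. integral {real l..real l + h} (\<lambda>w. p w * dirichlet_kernel M w)) \<longlonglongrightarrow> (-1)^l * p (real l) / 2"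
    and "{real l - h..real l} \<subseteq> T \<Longrightarrow> (\<lambda>M. integral {real l - h..real l} (\<lambda>w. p w * dirichlet_kernel M w)) \<longlonglongrightarrow> (-1)^l * p (real l) / 2"
proof -
  have main: "(\<lambda>M. integral {0..h} (\<lambda>v. p (real l + s * v) * dirichlet_kernel M (real l + s * v))) \<longlonglongrightarrow> (-1)^l * p (real l) / 2"
    if s: "s = 1 \<or> s = -1" and sub: "\<And>v. v \<in> {0..h} \<Longrightarrow> real l + s * v \<in> T" for s
  proof -
    let ?q = "\<lambda>v. (-1)^l * p (real l + s * v)"
    have "(\<lambda>M. integral {0..h} (\<lambda>v. ?q v * (sin (2*pi*real M * v) / sin (pi * v)))) \<longlonglongrightarrow> ((-1)^l * p (real l)) / 2"
    proof (rule Dirichlet_quotient_tendsto[OF _ h, where L = L])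
      have "continuous_on T p" using p by (rule lipschitz_on_continuous_on)
      hence "continuous_on {0..h} (\<lambda>v. p (real l + s * v))"
        by (rule continuous_on_compose2) (auto intro!: continuous_intros sub)
      hence "continuous_on {0..h} ?q" by (intro continuous_on_mult continuous_on_const)
      thus "?q \<in> borel_measurable (lebesgue_on {0..h})" by (intro continuous_imp_measurable_on_sets_lebesgue) auto
      fix v assume v': "v \<in> {0<..h}"
      hence v: "v \<in> {0..h}" by simp
      have "\<bar>p (real l + s * v) - p (real l)\<bar> \<le> L * \<bar>(real l + s * v) - real l\<bar>"
        using lipschitz_onD[OF p, of "real l + s * v" "real l"] sub[OF v] sub[of 0] h by (auto simp: dist_real_def)
      also have "\<bar>(real l + s * v) - real l\<bar> = v" using s v by auto
      finally show "\<bar>?q v - (-1)^l * p (real l)\<bar> \<le> L * v"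
        by (simp flip: right_diff_distrib add: abs_mult)
    qed
    moreover have "integral {0..h} (\<lambda>v. ?q v * (sin (2*pi*real M * v) / sin (pi * v))) =
       integral {0..h} (\<lambda>v. p (real l + s * v) * dirichlet_kernel M (real l + s * v))" for M
    proof (rule integral_spike[of "{0}"])
      fix v assume "v \<in> {0..h} - {0}"
      hence "0 < v" "v < 1" using h by auto
      from dirichlet_kernel_near_nat[OF this s, of M l]
      show "p (real l + s * v) * dirichlet_kernel M (real l + s * v) = ?q v * (sin (2*pi*real M * v) / sin (pi * v))" by simp
    qed auto
    ultimately show ?thesis by simp
  qed
  have cT: "continuous_on T p" using p by (rule lipschitz_on_continuous_on)
  show "(\<lambda>M. integral {real l..real l + h} (\<lambda>w. p w * dirichlet_kernel M w)) \<longlonglongrightarrow> (-1)^l * p (real l) / 2"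
    if sub: "{real l..real l + h} \<subseteq> T"
  proof -
    have "integral {real l..real l + h} (\<lambda>w. p w * dirichlet_kernel M w) =
      integral {0..h} (\<lambda>v. p (real l + 1 * v) * dirichlet_kernel M (real l + 1 * v))" for M
      using integral_shift_Icc_real[of 0 h "\<lambda>w. p w * dirichlet_kernel M w" "real l"] by (simp add: o_def add_ac)
    moreover have "real l + 1 * v \<in> T" if "v \<in> {0..h}" for v using sub that by (auto simp: subset_iff)
    ultimately show ?thesis using main[of 1] by simp
  qed
  show "(\<lambda>M. integral {real l - h..real l} (\<lambda>w. p w * dirichlet_kernel M w)) \<longlonglongrightarrow> (-1)^l * p (real l) / 2"
    if sub: "{real l - h..real l} \<subseteq> T"
  proof -
    have "integral {real l - h..real l} (\<lambda>w. p w * dirichlet_kernel M w) =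
      integral {0..h} (\<lambda>v. p (real l + (-1) * v) * dirichlet_kernel M (real l + (-1) * v))" for M
    proof -
      have "integral {real l - h..real l} (\<lambda>w. p w * dirichlet_kernel M w) =
        integral {-h..-0} (\<lambda>w. p (w + real l) * dirichlet_kernel M (w + real l))"
        using integral_shift_Icc_real[of "-h" 0 "\<lambda>w. p w * dirichlet_kernel M w" "real l"] by (simp add: o_def add_ac)
      also have "\<dots> = integral {0..h} (\<lambda>w. p (real l + (-1) * w) * dirichlet_kernel M (real l + (-1) * w))"
        using Henstock_Kurzweil_Integration.integral_reflect_real[of h 0 "\<lambda>w. p (real l + (-1) * w) * dirichlet_kernel M (real l + (-1) * w)"] by (simp add: add_ac)
      finally show ?thesis .
    qed
    moreover have "real l + (-1) * v \<in> T" if "v \<in> {0..h}" for v using sub that by (auto simp: subset_iff)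
    ultimately show ?thesis using main[of "-1"] by simp
  qed
qed

lemma dirichlet_kernel_away:
  fixes p :: "real \<Rightarrow> real"
  assumes p: "continuous_on {a..b} p" and "real l < a" "b < real l + 1"
  shows "(\<lambda>M. integral {a..b} (\<lambda>w. p w * dirichlet_kernel M w)) \<longlonglongrightarrow> 0"
proof -
  have nz: "sin (pi*w) \<noteq> 0" if "w \<in> {a..b}" for w
  proof -
    have "sin (pi * (w - real l)) > 0" using that assms by (intro sin_gt_zero) auto
    moreover have "sin (pi * (w - real l)) = (-1)^l * sin (pi*w)" by (simp add: right_diff_distrib sin_diff)
    ultimately show ?thesis by auto
  qed
  define g where "g w = p w / sin (pi*w)" for w
  have c: "continuous_on {a..b} g" unfolding g_def using nz p by (intro continuous_intros) auto
  then obtain B where "\<forall>w\<in>{a..b}. \<bar>g w\<bar> \<le> B"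
    using compact_imp_bounded[OF compact_continuous_image[OF c]] by (auto simp: bounded_iff)
  hence B: "\<bar>g w\<bar> \<le> B" if "w \<in> {a..b}" for w using that by blast
  have "(\<lambda>M. integral {a..b} (\<lambda>w. g w * sin (2*pi*real M*w + 0))) \<longlonglongrightarrow> 0"
    by (rule Riemann_Lebesgue_bounded[OF _ B]) (use c in \<open>auto intro!: continuous_imp_measurable_on_sets_lebesgue\<close>)
  moreover have "integral {a..b} (\<lambda>w. g w * sin (2*pi*real M*w + 0)) = integral {a..b} (\<lambda>w. p w * dirichlet_kernel M w)" for M
  proof (rule integral_cong)
    fix w assume "w \<in> {a..b}"
    with nz[OF this] show "g w * sin (2*pi*real M*w + 0) = p w * dirichlet_kernel M w"
      unfolding g_def by (simp flip: sin_times_dirichlet_kernel)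
  qed
  ultimately show ?thesis by simp
qed

text \<open>
  Cutting at integers and half-odd integers leaves pieces which touch one integer from one side or
  avoid the integers.  An integer in the interior is touched by two pieces, an integer at the right
  end by one; this is the origin of the weight \<open>1/2\<close>.
\<close>
lemma dirichlet_kernel_integral_tendsto:
  fixes p :: "real \<Rightarrow> real"
  assumes p: "L-lipschitz_on {0..Y} p" and y0: "0 < y0" "y0 \<le> 1/2" "y0 \<le> y" and Y: "y \<le> Y"
  shows "(\<lambda>M. integral {y0..y} (\<lambda>w. p w * dirichlet_kernel M w))
           \<longlonglongrightarrow> (\<Sum>l = 1..nat \<lfloor>y\<rfloor>. (if real l = y then 1/2 else 1) * ((-1)^l * p (real l)))"
proof -
  define conv where "conv a b c \<longleftrightarrow> (\<lambda>M. integral {a..b} (\<lambda>w. p w * dirichlet_kernel M w)) \<longlonglongrightarrow> c" for a b c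
  have pc: "continuous_on {0..Y} p" using p by (rule lipschitz_on_continuous_on)
  have comb: "conv a c (u + v)" if "conv a b u" "conv b c v" "0 \<le> a" "a \<le> b" "b \<le> c" "c \<le> Y" for a b c u v
  proof -
    have "(\<lambda>w. p w * dirichlet_kernel M w) integrable_on {a..c}" for M
      using that by (intro integrable_continuous_real continuous_intros continuous_on_subset[OF pc]) auto
    hence "integral {a..c} (\<lambda>w. p w * dirichlet_kernel M w) = integral {a..b} (\<lambda>w. p w * dirichlet_kernel M w) + integral {b..c} (\<lambda>w. p w * dirichlet_kernel M w)" for M
      using that by (intro Henstock_Kurzweil_Integration.integral_combine[symmetric]) auto
    thus ?thesis using that(1,2) unfolding conv_def by (auto intro: tendsto_add)
  qed
  have away: "conv a b 0" if "real l < a" "b < real l + 1" "b \<le> Y" for a b l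
    unfolding conv_def using that
    by (intro dirichlet_kernel_away[of _ _ _ l] continuous_on_subset[OF pc]) auto
  have right: "conv (real l) (real l + h) ((-1)^l * p (real l) / 2)" if "0 < h" "h \<le> 1/2" "real l + h \<le> Y" for l h
    unfolding conv_def using that by (intro dirichlet_kernel_half_interval[OF p]) auto
  have left: "conv (real l - 1/2) (real l) ((-1)^l * p (real l) / 2)" if "1 \<le> l" "real l \<le> Y" for l
    unfolding conv_def using that by (intro dirichlet_kernel_half_interval[OF p]) auto
  have half: "conv y0 (real n + 1/2) (\<Sum>l=1..n. (-1)^l * p (real l))" if "real n + 1/2 \<le> Y" for n
    using that
  proof (induction n)
    case 0
    then show ?case using away[of 0 y0 "1/2"] y0 by simp
  next
    case (Suc n)
    have "conv (real (Suc n) - 1/2) (real (Suc n) + 1/2) ((-1)^Suc n * p (real (Suc n)) / 2 + (-1)^Suc n * p (real (Suc n)) / 2)"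
      using Suc.prems by (intro comb[OF left right]) auto
    hence "conv (real n + 1/2) (real (Suc n) + 1/2) ((-1)^Suc n * p (real (Suc n)))" by (simp add: field_simps)
    hence "conv y0 (real (Suc n) + 1/2) ((\<Sum>l=1..n. (-1)^l * p (real l)) + (-1)^Suc n * p (real (Suc n)))"
      using Suc.prems y0 by (intro comb[OF Suc.IH]) auto
    thus ?case by simp
  qed
  define n where "n = nat \<lfloor>y\<rfloor>"
  have n: "real n \<le> y" "y < real n + 1" using y0 unfolding n_def by linarith+
  let ?W = "\<Sum>l = 1..n. (if real l = y then 1/2 else 1) * ((-1)^l * p (real l))"
  have "conv y0 y ?W"
  proof (cases "real n = y")
    case True
    then obtain m where m: "n = Suc m" using y0 by (cases n) auto
    have "conv y0 y ((\<Sum>l=1..m. (-1)^l * p (real l)) + (-1)^n * p (real n) / 2)"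
    proof (rule comb[OF half])
      show "conv (real m + 1/2) y ((-1)^n * p (real n) / 2)"
      proof -
        have e: "real m + 1/2 = real n - 1/2" using m by simp
        have "conv (real n - 1/2) (real n) ((-1)^n * p (real n) / 2)" by (rule left) (use m True Y in auto)
        thus ?thesis unfolding e by (simp only: True)
      qed
    qed (use True m Y y0 in auto)
    moreover have "(\<Sum>l = 1..m. (if real l = y then 1/2 else 1) * ((-1)^l * p (real l))) = (\<Sum>l=1..m. (-1)^l * p (real l))"
      using True m by (intro sum.cong) auto
    ultimately show ?thesis using True m by simp
  next
    case False
    hence W: "?W = (\<Sum>l=1..n. (-1)^l * p (real l))" using n by (intro sum.cong) auto
    show ?thesis
    proof (cases "real n + 1/2 \<le> y")
      case True
      have "conv y0 y ((\<Sum>l=1..n. (-1)^l * p (real l)) + 0)"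
        using True n y0 Y by (intro comb[OF half away[of n]]) auto
      thus ?thesis unfolding W by simp
    next
      case F2: False
      show ?thesis
      proof (cases n)
        case 0
        thus ?thesis using away[of 0 y0 y] y0 Y n by simp
      next
        case (Suc m)
        have "conv y0 (real m + 1/2 + 1/2) ((\<Sum>l=1..m. (-1)^l * p (real l)) + (-1)^n * p (real n) / 2)"
        proof (rule comb[OF half])
          show "conv (real m + 1/2) (real m + 1/2 + 1/2) ((-1)^n * p (real n) / 2)"
            using left[of n] Suc n Y by (simp add: add_ac)
        qed (use Suc n Y y0 in auto)
        hence *: "conv y0 (real n) ((\<Sum>l=1..m. (-1)^l * p (real l)) + (-1)^n * p (real n) / 2)"
          using Suc by (simp add: add_ac)
        have "conv (real n) (real n + (y - real n)) ((-1)^n * p (real n) / 2)"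
          using False F2 n Y by (intro right) auto
        hence "conv y0 y ((\<Sum>l=1..m. (-1)^l * p (real l)) + (-1)^n * p (real n) / 2 + (-1)^n * p (real n) / 2)"
          using Suc n Y y0 by (intro comb[OF *]) auto
        hence "conv y0 y ((\<Sum>l=1..m. (-1)^l * p (real l)) + (-1)^n * p (real n))"
          by (simp only: add.assoc field_sum_of_halves)
        hence "conv y0 y (\<Sum>l=1..n. (-1)^l * p (real l))" using Suc by simp
        thus ?thesis unfolding W .
      qed
    qed
  qed
  thus ?thesis unfolding conv_def n_def .
qed

section \<open>Poisson summation on a half-line\<close>

lemma cos_sum_kernel:
  "sin (pi * v) * (1 + 2 * (\<Sum>j=1..J. cos (2*pi*real j * v))) = sin (2*pi*real J * v + pi * v)"
proof (induction J)
  case 0 show ?case by simp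
next
  case (Suc J)
  have "2 * (sin (pi * v) * cos (2*pi*real (Suc J) * v)) = sin (2*pi*real (Suc J) * v + pi * v) - sin (2*pi*real J * v + pi * v)"
  proof -
    have a: "pi * v + 2*pi*real (Suc J) * v = 2*pi*real (Suc J) * v + pi * v"
        "pi * v - 2*pi*real (Suc J) * v = - (2*pi*real J * v + pi * v)"
      by (simp_all add: algebra_simps)
    show ?thesis unfolding sin_times_cos a by (simp only: sin_minus) simp
  qed
  thus ?case using Suc by (simp add: distrib_left)
qed

text \<open>
  Dini's test: after subtraction of \<open>q 0\<close>, the partial sum is the integral of
  \<open>(q v - q 0)/sin(\<pi>v)\<close>, a bounded function, against \<open>sin((2J+1)\<pi>v)\<close>.
\<close>
lemma Fourier_series_at_0:
  fixes q :: "real \<Rightarrow> real"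
  assumes q: "continuous_on {a..b} q" and L: "\<And>v. v \<in> {a..b} \<Longrightarrow> \<bar>q v - q 0\<bar> \<le> L * \<bar>v\<bar>"
    and ab: "-1 < a" "a < 0" "0 < b" "b < 1" "b - a = 1"
  shows "(\<lambda>J. integral {a..b} q + (\<Sum>j=1..J. 2 * integral {a..b} (\<lambda>v. q v * cos (2*pi*real j * v)))) \<longlonglongrightarrow> q 0"
proof -
  let ?K = "\<lambda>J v. 1 + 2 * (\<Sum>j=1..J. cos (2*pi*real j * v))"
  define g where "g v = (q v - q 0) / sin (pi * v)" for v
  have L0: "0 \<le> L" using order_trans[OF abs_ge_zero L[of b]] ab by (simp add: zero_le_mult_iff)
  \<comment> \<open>The distance of the interval from the other zeros \<open>\<plusminus>1\<close> of \<open>sin(\<pi>v)\<close>.\<close>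
  define d where "d = 1 - max (-a) b"
  have d: "0 < d" "d \<le> 1/2" using ab unfolding d_def by auto
  have sd: "0 < sin (pi * d)" using d by (intro sin_gt_zero) auto
  have lb: "sin (pi * d) * \<bar>v\<bar> \<le> \<bar>sin (pi * v)\<bar>" if v: "v \<in> {a..b}" for v
  proof -
    have v1: "\<bar>v\<bar> \<le> 1 - d" using v ab unfolding d_def by auto
    have e: "\<bar>sin (pi * v)\<bar> = sin (pi * \<bar>v\<bar>)"
      using sin_ge_zero[of "pi * \<bar>v\<bar>"] v1 d by (auto simp: abs_if mult_le_0_iff zero_le_mult_iff)
    show ?thesis
    proof (cases "\<bar>v\<bar> \<le> 1/2")
      case True
      have "sin (pi * d) * \<bar>v\<bar> \<le> 1 * \<bar>v\<bar>" by (intro mult_right_mono) auto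
      also have "\<dots> \<le> pi * \<bar>v\<bar> / 2" using pi_gt3 mult_right_mono[of 2 pi "\<bar>v\<bar>"] by simp
      also have "\<dots> \<le> sin (pi * \<bar>v\<bar>)" using sin_ge_half[of "pi * \<bar>v\<bar>"] True by simp
      finally show ?thesis unfolding e .
    next
      case False
      have "sin (pi * d) * \<bar>v\<bar> \<le> sin (pi * d) * 1" using sd v1 d by (intro mult_left_mono) auto
      also have "sin (pi * d) \<le> sin (pi * (1 - \<bar>v\<bar>))"
        using False v1 d by (intro sin_monotone_2pi_le mult_left_mono) (auto intro: order_trans[of _ 0])
      also have "\<dots> = sin (pi * \<bar>v\<bar>)" by (simp add: right_diff_distrib sin_diff)
      finally show ?thesis unfolding e by simp
    qed
  qed
  have gb: "\<bar>g v\<bar> \<le> L / sin (pi * d)" if v: "v \<in> {a..b}" for v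
  proof (cases "v = 0")
    case True then show ?thesis using L0 sd by (simp add: g_def)
  next
    case False
    hence p: "0 < sin (pi * d) * \<bar>v\<bar>" using sd by simp
    have "\<bar>g v\<bar> \<le> (L * \<bar>v\<bar>) / (sin (pi * d) * \<bar>v\<bar>)"
      unfolding g_def abs_divide using L[OF v] lb[OF v] p L0 by (intro frac_le) auto
    thus ?thesis using False by simp
  qed
  have qm: "q \<in> borel_measurable (lebesgue_on {a..b})" using q by (intro continuous_imp_measurable_on_sets_lebesgue) auto
  have sm: "(\<lambda>v. sin (pi * v)) \<in> borel_measurable (lebesgue_on {a..b})" "(\<lambda>v. cos (pi * v)) \<in> borel_measurable (lebesgue_on {a..b})"
    by (rule borel_measurable_imp_lebesgue_on, measurable)+
  have gm: "(\<lambda>v. g v * cos (pi * v)) \<in> borel_measurable (lebesgue_on {a..b})"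
    unfolding g_def using qm sm by simp
  have gb2: "\<bar>g v * cos (pi * v)\<bar> \<le> L / sin (pi * d)" if v: "v \<in> {a..b}" for v
    using gb[OF v] mult_left_le[of "\<bar>cos (pi * v)\<bar>" "\<bar>g v\<bar>"] by (simp add: abs_mult)
  have gsm: "(\<lambda>v. q v - q 0) \<in> borel_measurable (lebesgue_on {a..b})" using qm by simp
  have gsb: "\<bar>q v - q 0\<bar> \<le> L" if v: "v \<in> {a..b}" for v
  proof -
    have "L * \<bar>v\<bar> \<le> L * 1" using L0 v ab by (intro mult_left_mono) auto
    thus ?thesis using L[OF v] by simp
  qed
  have R1: "(\<lambda>J. integral {a..b} (\<lambda>v. g v * cos (pi * v) * sin (2*pi*real J * v + 0))) \<longlonglongrightarrow> 0"
    by (rule Riemann_Lebesgue_bounded[OF gm gb2])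
  have R2: "(\<lambda>J. integral {a..b} (\<lambda>v. (q v - q 0) * sin (2*pi*real J * v + pi/2))) \<longlonglongrightarrow> 0"
    by (rule Riemann_Lebesgue_bounded[OF gsm gsb])
  have I1: "(\<lambda>v. g v * cos (pi * v) * sin (2*pi*real J * v + 0)) integrable_on {a..b}" for J
  proof (rule bounded_measurable_integrable[where B = "L / sin (pi * d)"])
    show "(\<lambda>v. g v * cos (pi * v) * sin (2*pi*real J * v + 0)) \<in> borel_measurable (lebesgue_on {a..b})"
      by (rule borel_measurable_times[OF gm], rule borel_measurable_imp_lebesgue_on) measurable
    show "norm (g v * cos (pi * v) * sin (2*pi*real J * v + 0)) \<le> L / sin (pi * d)" if v: "v \<in> {a..b}" for v
      using gb2[OF v] mult_left_le[of "\<bar>sin (2*pi*real J * v + 0)\<bar>" "\<bar>g v * cos (pi * v)\<bar>"] by (simp add: abs_mult)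
  qed
  have I2: "(\<lambda>v. (q v - q 0) * sin (2*pi*real J * v + pi/2)) integrable_on {a..b}" for J
    by (intro integrable_continuous_real continuous_intros q)
  have key: "integral {a..b} q + (\<Sum>j=1..J. 2 * integral {a..b} (\<lambda>v. q v * cos (2*pi*real j * v))) - q 0 =
     integral {a..b} (\<lambda>v. g v * cos (pi * v) * sin (2*pi*real J * v + 0)) + integral {a..b} (\<lambda>v. (q v - q 0) * sin (2*pi*real J * v + pi/2))" for J
  proof -
    have c0: "((\<lambda>v. cos (2*pi*real j * v)) has_integral 0) {a..b}" if "1 \<le> j" for j
    proof -
      have "((\<lambda>v. cos (2*pi*real j * v)) has_integral (sin (2*pi*real j * b) / (2*pi*j) - sin (2*pi*real j * a) / (2*pi*j))) {a..b}"
        by (rule fundamental_theorem_of_calculus)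
           (use that ab in \<open>auto intro!: derivative_eq_intros simp flip: has_real_derivative_iff_has_vector_derivative\<close>)
      moreover have "sin (2*pi*real j * b) = sin (2*pi*real j * a)"
      proof -
        have "2*pi*real j * b = 2*pi*real j * a + 2*pi*real j"
        proof -
          have "b = a + 1" using ab by simp
          thus ?thesis by (simp add: distrib_left)
        qed
        thus ?thesis using sin.plus_of_nat[of "2*pi*real j * a" j] by (simp add: mult_ac)
      qed
      ultimately show ?thesis by simp
    qed
    have q1: "((\<lambda>v. q v * cos (2*pi*real j * v)) has_integral integral {a..b} (\<lambda>v. q v * cos (2*pi*real j * v))) {a..b}" for j
      by (intro integrable_integral integrable_continuous_real continuous_intros q)
    have q2: "(q has_integral integral {a..b} q) {a..b}"
      by (intro integrable_integral integrable_continuous_real q)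
    have q3: "((\<lambda>v. q 0) has_integral q 0) {a..b}"
      using has_integral_const_real[of "q 0" a b] ab by simp
    have "((\<lambda>v. q v - q 0 + (\<Sum>j=1..J. 2 * (q v * cos (2*pi*real j * v) - q 0 * cos (2*pi*real j * v)))) has_integral
       (integral {a..b} q - q 0 + (\<Sum>j=1..J. 2 * (integral {a..b} (\<lambda>v. q v * cos (2*pi*real j * v)) - q 0 * 0)))) {a..b}"
      by (intro has_integral_add has_integral_diff has_integral_sum has_integral_mult_right q1 q2 q3 c0) auto
    moreover have "q v - q 0 + (\<Sum>j=1..J. 2 * (q v * cos (2*pi*real j * v) - q 0 * cos (2*pi*real j * v))) =
       g v * cos (pi * v) * sin (2*pi*real J * v + 0) + (q v - q 0) * sin (2*pi*real J * v + pi/2)" if v: "v \<in> {a..b}" for v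
    proof -
      have "q v - q 0 + (\<Sum>j=1..J. 2 * (q v * cos (2*pi*real j * v) - q 0 * cos (2*pi*real j * v))) = (q v - q 0) * ?K J v"
        by (simp add: distrib_left sum_distrib_left left_diff_distrib right_diff_distrib sum_subtractf mult_ac)
      also have "\<dots> = g v * sin (2*pi*real J * v + pi * v) "
      proof (cases "v = 0")
        case False
        hence "sin (pi * v) \<noteq> 0" using lb[OF v] sd by (smt (verit) mult_pos_pos zero_less_abs_iff)
        thus ?thesis unfolding g_def cos_sum_kernel[symmetric] by simp
      qed (simp add: g_def)
      also have "\<dots> = g v * cos (pi * v) * sin (2*pi*real J * v + 0) + g v * sin (pi * v) * sin (2*pi*real J * v + pi/2)"
        by (simp add: sin_add algebra_simps)
      also have "g v * sin (pi * v) = q v - q 0"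
      proof (cases "v = 0")
        case False
        hence "sin (pi * v) \<noteq> 0" using lb[OF v] sd by (smt (verit) mult_pos_pos zero_less_abs_iff)
        thus ?thesis unfolding g_def by simp
      qed (simp add: g_def)
      finally show ?thesis .
    qed
    ultimately have A1: "((\<lambda>v. g v * cos (pi * v) * sin (2*pi*real J * v + 0) + (q v - q 0) * sin (2*pi*real J * v + pi/2)) has_integral
       (integral {a..b} q - q 0 + (\<Sum>j=1..J. 2 * (integral {a..b} (\<lambda>v. q v * cos (2*pi*real j * v)) - q 0 * 0)))) {a..b}"
      by (rule has_integral_eq[rotated]) simp
    have A2: "((\<lambda>v. g v * cos (pi * v) * sin (2*pi*real J * v + 0) + (q v - q 0) * sin (2*pi*real J * v + pi/2)) has_integral
       (integral {a..b} (\<lambda>v. g v * cos (pi * v) * sin (2*pi*real J * v + 0)) + integral {a..b} (\<lambda>v. (q v - q 0) * sin (2*pi*real J * v + pi/2)))) {a..b}"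
      by (intro has_integral_add integrable_integral I1 I2)
    show ?thesis using has_integral_unique[OF A1 A2] by (simp only: mult_zero_right diff_zero diff_add_eq)
  qed
  have eq: "A = z + B" if "A - z = B" for A B z :: real using that by simp
  have "(\<lambda>J. q 0 + (integral {a..b} (\<lambda>v. g v * cos (pi * v) * sin (2*pi*real J * v + 0)) + integral {a..b} (\<lambda>v. (q v - q 0) * sin (2*pi*real J * v + pi/2)))) \<longlonglongrightarrow> q 0 + (0 + 0)"
    by (intro tendsto_intros R1 R2)
  moreover have "integral {a..b} q + (\<Sum>j=1..J. 2 * integral {a..b} (\<lambda>v. q v * cos (2*pi*real j * v))) =
      q 0 + (integral {a..b} (\<lambda>v. g v * cos (pi * v) * sin (2*pi*real J * v + 0)) + integral {a..b} (\<lambda>v. (q v - q 0) * sin (2*pi*real J * v + pi/2)))" for J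
    by (rule eq[OF key])
  ultimately show ?thesis by (simp only: add_0_right)
qed

text \<open>
  The classical argument periodises \<open>f\<close>.  Here the series of translates need not converge
  absolutely, so the mean \<open>m n\<close> of \<open>f\<close> over \<open>[n, n+1]\<close> is
  subtracted first; the integrable bound on \<open>f'\<close> makes the resulting series \<open>U\<close> absolutely
  convergent and Lipschitz on \<open>[0, 1]\<close>.  Its Fourier coefficients are the half-line transforms
  \<open>c j\<close>, and the subtracted means add up to \<open>Z\<close>.  All improper integrals are limits along
  integers, which is the only sense in which they are computed later.
\<close>
lemma Poisson_summation_half_line:
  fixes f f' :: "real \<Rightarrow> real"
  assumes D: "\<And>b. (f has_real_derivative f' b) (at b)"
    and f': "\<And>b. 0 \<le> b \<Longrightarrow> \<bar>f' b\<bar> \<le> K * (1 + b) powr (-5/4)"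
    and Z: "(\<lambda>N. integral {0..real N} f) \<longlonglongrightarrow> Z"
    and c: "\<And>j. 1 \<le> j \<Longrightarrow> (\<lambda>N. integral {0..real N} (\<lambda>b. f b * cos (2*pi*real j * (b - \<theta>)))) \<longlonglongrightarrow> c j"
    and \<theta>: "0 < \<theta>" "\<theta> < 1"
  shows "\<exists>S. (\<lambda>j. 2 * c (Suc j)) sums S \<and> (\<lambda>n. f (real n + \<theta>)) sums (Z + S)"
proof -
  have fc: "continuous_on S f" for S using D by (meson DERIV_isCont continuous_at_imp_continuous_on)
  have K0: "0 \<le> K" using f'[of 0] by simp
  define d where "d n = K * real (Suc n) powr (-5/4)" for n
  have dsum: "summable d"
  proof -
    have "summable (\<lambda>n. real (Suc n) powr (-5/4))"
      by (subst summable_Suc_iff) (simp add: summable_real_powr_iff)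
    thus ?thesis unfolding d_def by (rule summable_mult)
  qed
  have d0: "0 \<le> d n" for n unfolding d_def using K0 by simp
  have lip: "\<bar>f p - f q\<bar> \<le> d n * \<bar>p - q\<bar>" if "p \<in> {real n..real n + 1}" "q \<in> {real n..real n + 1}" for p q n
  proof -
    have "norm (f p - f q) \<le> d n * norm (p - q)"
    proof (rule field_differentiable_bound[of "{real n..real n + 1}"])
      fix b assume b: "b \<in> {real n..real n + 1}"
      show "(f has_field_derivative f' b) (at b within {real n..real n + 1})" using D by (rule has_field_derivative_at_within)
      have "(1 + b) powr (-5/4) \<le> real (Suc n) powr (-5/4)" using b by (intro powr_mono2') auto
      hence "K * (1 + b) powr (-5/4) \<le> d n" unfolding d_def using K0 by (intro mult_left_mono)
      thus "norm (f' b) \<le> d n" using f'[of b] b by simp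
    qed (use that in auto)
    thus ?thesis by simp
  qed
  define m where "m n = integral {real n..real n + 1} f" for n
  define u where "u n s = f (real n + s) - m n" for n s
  define U where "U s = (\<Sum>n. u n s)" for s
  have mi: "(f has_integral m n) {real n..real n + 1}" for n
    unfolding m_def by (intro integrable_integral integrable_continuous_real fc)
  have ub: "\<bar>u n s\<bar> \<le> d n" if "s \<in> {0..1}" for n s
  proof -
    have A: "((\<lambda>b. f (real n + s) - f b) has_integral (f (real n + s) - m n)) {real n..real n + 1}"
      using has_integral_diff[OF has_integral_const_real[of "f (real n + s)" "real n" "real n + 1"] mi[of n]] by simp
    have B: "norm (f (real n + s) - f b) \<le> d n" if b: "b \<in> {real n..real n + 1}" for b
    proof -
      have "\<bar>f (real n + s) - f b\<bar> \<le> d n * \<bar>(real n + s) - b\<bar>" using \<open>s \<in> {0..1}\<close> b by (intro lip) auto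
      also have "\<dots> \<le> d n * 1" using \<open>s \<in> {0..1}\<close> b d0 by (intro mult_left_mono) auto
      finally show ?thesis by simp
    qed
    show ?thesis using has_integral_bound_real[OF d0[of n] finite.emptyI A] B unfolding u_def by simp
  qed
  have usum: "summable (\<lambda>n. u n s)" if "s \<in> {0..1}" for s
    by (rule summable_comparison_test'[OF dsum]) (use ub[OF that] in auto)
  \<comment> \<open>Termwise Lipschitz constants \<open>d n\<close> add up, since \<open>m n\<close> drops out of differences.\<close>
  have Ulip: "\<bar>U s - U t\<bar> \<le> suminf d * \<bar>s - t\<bar>" if "s \<in> {0..1}" "t \<in> {0..1}" for s t
  proof -
    have l: "\<bar>u n s - u n t\<bar> \<le> d n * \<bar>s - t\<bar>" for n
      using lip[of "real n + s" n "real n + t"] that unfolding u_def by simp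
    have "U s - U t = (\<Sum>n. u n s - u n t)" unfolding U_def by (intro suminf_diff usum that)
    also have "\<bar>\<dots>\<bar> \<le> (\<Sum>n. d n * \<bar>s - t\<bar>)"
    proof -
      have "summable (\<lambda>n. \<bar>u n s - u n t\<bar>)"
        by (rule summable_comparison_test'[OF summable_mult2[OF dsum, of "\<bar>s - t\<bar>"]]) (use l in auto)
      thus ?thesis by (intro order_trans[OF summable_rabs] suminf_le l summable_mult2 dsum)
    qed
    also have "\<dots> = suminf d * \<bar>s - t\<bar>" using dsum by (rule suminf_mult2[symmetric])
    finally show ?thesis .
  qed
  have Uc: "continuous_on {0..1} U"
  proof (rule lipschitz_on_continuous_on, rule lipschitz_onI)
    show "0 \<le> suminf d" by (intro suminf_nonneg dsum d0)
    fix s t :: real assume "s \<in> {0..1}" "t \<in> {0..1}"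
    thus "dist (U s) (U t) \<le> suminf d * dist s t" unfolding dist_real_def by (rule Ulip)
  qed
  have coef: "(\<lambda>N. \<Sum>n<N. integral {0..1} (\<lambda>s. u n s * w s)) \<longlonglongrightarrow> integral {0..1} (\<lambda>s. U s * w s)"
    if w: "continuous_on {0..1} w" "\<And>s. \<bar>w s\<bar> \<le> 1" for w :: "real \<Rightarrow> real"
  proof -
    have ui: "(\<lambda>s. u n s * w s) integrable_on {0..1}" for n
      unfolding u_def by (intro integrable_continuous_real continuous_intros w continuous_on_compose2[OF fc[of UNIV]]) auto
    have "(\<lambda>N. integral {0..1} (\<lambda>s. \<Sum>n<N. u n s * w s)) \<longlonglongrightarrow> integral {0..1} (\<lambda>s. U s * w s)"
    proof (rule dominated_convergence(2)[where h = "\<lambda>_. suminf d"])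
      show "(\<lambda>s. \<Sum>n<N. u n s * w s) integrable_on {0..1}" for N by (intro integrable_sum ui) auto
      fix s :: real assume s: "s \<in> {0..1}"
      show "norm (\<Sum>n<N. u n s * w s) \<le> suminf d" for N
      proof -
        have "norm (\<Sum>n<N. u n s * w s) \<le> (\<Sum>n<N. d n)"
        proof (rule order_trans[OF norm_sum], rule sum_mono)
          fix n show "norm (u n s * w s) \<le> d n"
            using ub[OF s, of n] mult_left_le[of "\<bar>w s\<bar>" "\<bar>u n s\<bar>"] w(2)[of s] by (simp add: abs_mult)
        qed
        also have "\<dots> \<le> suminf d" by (intro sum_le_suminf dsum) (use d0 in auto)
        finally show ?thesis .
      qed
      show "(\<lambda>N. \<Sum>n<N. u n s * w s) \<longlonglongrightarrow> U s * w s"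
        unfolding U_def sum_distrib_right[symmetric] by (intro tendsto_mult tendsto_const summable_LIMSEQ usum s)
    qed auto
    thus ?thesis by (subst (asm) integral_sum) (use ui in auto)
  qed
  have tel: "(\<Sum>n<N. integral {real n..real n + 1} F) = integral {0..real N} F" if "continuous_on UNIV F" for N and F :: "real \<Rightarrow> real"
  proof (induction N)
    case 0 show ?case by simp
  next
    case (Suc N)
    have "integral {0..real N} F + integral {real N..real N + 1} F = integral {0..real N + 1} F"
      by (intro Henstock_Kurzweil_Integration.integral_combine integrable_continuous_real continuous_on_subset[OF that]) auto
    thus ?case using Suc by (simp add: add.commute)
  qed
  \<comment> \<open>The mean \<open>m n\<close> does not contribute, as the cosine has integral 0 over a period; the pieces
    of \<open>f\<close> then fit together to the half-line integral.\<close>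
  have cj: "integral {0..1} (\<lambda>s. U s * cos (2*pi*real j * (s - \<theta>))) = c j" if j: "1 \<le> j" for j
  proof -
    let ?w = "\<lambda>s. cos (2*pi*real j * (s - \<theta>))"
    have w0: "(?w has_integral 0) {0..1}"
    proof -
      have "(?w has_integral (sin (2*pi*real j * (1 - \<theta>)) / (2*pi*j) - sin (2*pi*real j * (0 - \<theta>)) / (2*pi*j))) {0..1}"
        by (rule fundamental_theorem_of_calculus)
           (use j in \<open>auto intro!: derivative_eq_intros simp flip: has_real_derivative_iff_has_vector_derivative\<close>)
      moreover have "sin (2*pi*real j * (1 - \<theta>)) = sin (2*pi*real j * (0 - \<theta>))"
        using sin.plus_of_nat[of "2*pi*real j * (0 - \<theta>)" j] by (simp add: algebra_simps)
      ultimately show ?thesis by simp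
    qed
    have "integral {0..1} (\<lambda>s. u n s * ?w s) = integral {real n..real n + 1} (\<lambda>b. f b * ?w b)" for n
    proof -
      have per: "?w (s + real n) = ?w s" for s
      proof -
        have "2*pi*real j * (s + real n - \<theta>) = 2*pi*real j * (s - \<theta>) + 2*pi*real (j * n)" by (simp add: algebra_simps)
        thus ?thesis using cos.plus_of_nat[of "2*pi*real j * (s - \<theta>)" "j * n"] by (simp add: mult_ac)
      qed
      have "integral {real n..real n + 1} (\<lambda>b. f b * ?w b) = integral {0..1} (\<lambda>s. f (s + real n) * ?w (s + real n))"
        using integral_shift_real_ivl[of "real n" "real n" "real n + 1" "\<lambda>b. f b * ?w b"] by simp
      also have "\<dots> = integral {0..1} (\<lambda>s. u n s * ?w s + m n * ?w s)"
        unfolding per u_def by (intro integral_cong) (simp add: algebra_simps)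
      also have "\<dots> = integral {0..1} (\<lambda>s. u n s * ?w s) + integral {0..1} (\<lambda>s. m n * ?w s)"
        unfolding u_def by (intro integral_add integrable_continuous_real continuous_intros continuous_on_compose2[OF fc[of UNIV]]) auto
      also have "integral {0..1} (\<lambda>s. m n * ?w s) = 0" using integral_unique[OF w0] by simp
      finally show ?thesis by simp
    qed
    hence "(\<lambda>N. integral {0..real N} (\<lambda>b. f b * ?w b)) \<longlonglongrightarrow> integral {0..1} (\<lambda>s. U s * ?w s)"
      using coef[of ?w] tel[of "\<lambda>b. f b * ?w b"] by (simp add: continuous_intros fc)
    from LIMSEQ_unique[OF this c[OF j]] show ?thesis .
  qed
  have U0: "integral {0..1} U = 0"
  proof -
    have "integral {0..1} (\<lambda>s. u n s) = 0" for n
    proof -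
      have "integral {0..1} (\<lambda>s. f (s + real n)) = m n"
        unfolding m_def using integral_shift_real_ivl[of "real n" "real n" "real n + 1" f] by simp
      moreover have "integral {0..1} (\<lambda>s. f (s + real n) - m n) = integral {0..1} (\<lambda>s. f (s + real n)) - integral {0..1} (\<lambda>s::real. m n)"
        by (intro Henstock_Kurzweil_Integration.integral_diff integrable_continuous_real continuous_intros continuous_on_compose2[OF fc[of UNIV]]) auto
      ultimately show ?thesis unfolding u_def by (simp add: add.commute)
    qed
    hence "(\<lambda>N::nat. 0) \<longlonglongrightarrow> integral {0..1} (\<lambda>s. U s)" using coef[of "\<lambda>_. 1"] by simp
    thus ?thesis by (simp add: LIMSEQ_const_iff)
  qed
  \<comment> \<open>Translated so that the point of evaluation \<open>\<theta>\<close> becomes 0.\<close>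
  let ?q = "\<lambda>v. U (v + \<theta>)"
  have sh: "integral {-\<theta>..1-\<theta>} (\<lambda>v. F (v + \<theta>)) = integral {0..1} F" for F :: "real \<Rightarrow> real"
    using integral_shift_real_ivl[of 0 \<theta> 1 F] by simp
  have "(\<lambda>J. integral {-\<theta>..1-\<theta>} ?q + (\<Sum>j=1..J. 2 * integral {-\<theta>..1-\<theta>} (\<lambda>v. ?q v * cos (2*pi*real j * v)))) \<longlonglongrightarrow> ?q 0"
  proof (rule Fourier_series_at_0[where L = "suminf d"])
    show "continuous_on {-\<theta>..1-\<theta>} ?q" by (rule continuous_on_compose2[OF Uc]) (auto intro!: continuous_intros)
    show "\<bar>?q v - ?q 0\<bar> \<le> suminf d * \<bar>v\<bar>" if "v \<in> {-\<theta>..1-\<theta>}" for v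
      using Ulip[of "v + \<theta>" "0 + \<theta>"] that \<theta> by simp
  qed (use \<theta> in auto)
  moreover have "integral {-\<theta>..1-\<theta>} (\<lambda>v. ?q v * cos (2*pi*real j * v)) = c j" if "1 \<le> j" for j
    using sh[of "\<lambda>s. U s * cos (2*pi*real j * (s - \<theta>))"] cj[OF that] by simp
  ultimately have "(\<lambda>J. \<Sum>j=1..J. 2 * c j) \<longlonglongrightarrow> U \<theta>" using sh[of U] U0 by simp
  moreover have "(\<Sum>j=1..J. 2 * c j) = (\<Sum>j<J. 2 * c (Suc j))" for J
    by (simp add: sum.atLeast1_atMost_eq)
  ultimately have S: "(\<lambda>j. 2 * c (Suc j)) sums U \<theta>" unfolding sums_def by simp
  have "(\<lambda>N. (\<Sum>n<N. u n \<theta>) + integral {0..real N} f) \<longlonglongrightarrow> U \<theta> + Z"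
    unfolding U_def using \<theta> by (intro tendsto_add summable_LIMSEQ usum Z) auto
  moreover have "(\<Sum>n<N. u n \<theta>) + integral {0..real N} f = (\<Sum>n<N. f (real n + \<theta>))" for N
    unfolding u_def sum_subtractf tel[OF fc, symmetric] m_def by simp
  ultimately have "(\<lambda>n. f (real n + \<theta>)) sums (U \<theta> + Z)" unfolding sums_def by simp
  with S show ?thesis by (metis add.commute)
qed

section \<open>The Bessel-Clifford function and its moments\<close>

definition clifford_coeff :: "nat \<Rightarrow> real" where
  "clifford_coeff j = (-1)^j / (fact j)\<^sup>2"

text \<open>
  The Bessel-Clifford function \<open>J\<^sub>0(2\<surd>y)\<close>; it is entire and satisfies \<open>yP'' + P' + P = 0\<close>.
\<close>
definition clifford :: "real \<Rightarrow> real" where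
  "clifford y = (\<Sum>j. clifford_coeff j * y ^ j)"

text \<open>
  The moment \<open>\<integral>\<^sub>0\<^sup>1 t\<^sup>k P(ty) dt\<close> of \<open>P = clifford\<close>, integrated term by term; for \<open>k = 0\<close> this
  is \<open>J\<^sub>1(2\<surd>y)/\<surd>y\<close>.
\<close>
definition clifford_moment :: "nat \<Rightarrow> real \<Rightarrow> real" where
  "clifford_moment k y = (\<Sum>j. clifford_coeff j / (real j + real k + 1) * y ^ j)"

text \<open>
  The same moment of \<open>J\<^sub>1(2\<surd>y)/\<surd>y\<close>.  It is, up to a shift of \<open>k\<close> and a sign, the derivative
  of \<open>clifford_moment\<close>.
\<close>
definition clifford_moment1 :: "nat \<Rightarrow> real \<Rightarrow> real" where
  "clifford_moment1 k y = (\<Sum>j. clifford_coeff j / ((real j + 1) * (real j + real k + 1)) * y ^ j)"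

lemma summable_if_coeff_le_inverse_fact:
  fixes c :: "nat \<Rightarrow> real"
  assumes "\<And>j. \<bar>c j\<bar> \<le> 1 / fact j"
  shows "summable (\<lambda>j. c j * y ^ j)"
proof (rule summable_comparison_test')
  show "summable (\<lambda>j. inverse (fact j) * \<bar>y\<bar> ^ j)" by (rule summable_exp)
  fix j :: nat
  show "norm (c j * y ^ j) \<le> inverse (fact j) * \<bar>y\<bar> ^ j"
    using mult_right_mono[OF assms[of j], of "\<bar>y\<bar> ^ j"] by (simp add: abs_mult power_abs inverse_eq_divide)
qed

lemma abs_clifford_coeff_le: "\<bar>clifford_coeff j\<bar> \<le> 1 / fact j"
proof -
  have "(fact j :: real) * 1 \<le> fact j * fact j" by (intro mult_left_mono) (auto simp: fact_ge_1)
  thus ?thesis by (simp add: clifford_coeff_def power2_eq_square divide_simps)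
qed

lemma clifford_coeff_Suc: "clifford_coeff (Suc j) = - clifford_coeff j / (real j + 1)\<^sup>2"
  by (simp add: clifford_coeff_def power2_eq_square divide_simps) (simp add: algebra_simps)

lemma clifford_coeff_div_le:
  assumes "1 \<le> d" shows "\<bar>clifford_coeff j / d\<bar> \<le> 1 / fact j"
proof -
  have "\<bar>clifford_coeff j / d\<bar> \<le> \<bar>clifford_coeff j\<bar> / 1"
    unfolding abs_divide using assms by (intro divide_left_mono) auto
  thus ?thesis using abs_clifford_coeff_le[of j] by simp
qed

lemma summable_clifford: "summable (\<lambda>j. clifford_coeff j * y ^ j)"
  by (intro summable_if_coeff_le_inverse_fact abs_clifford_coeff_le)

lemma summable_clifford_moment: "summable (\<lambda>j. clifford_coeff j / (real j + real k + 1) * y ^ j)"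
  by (intro summable_if_coeff_le_inverse_fact clifford_coeff_div_le) simp

lemma one_le_prod: "1 \<le> (real j + 1) * (real j + real k + 1)"
  using mult_mono[of 1 "real j + 1" 1 "real j + real k + 1"] by simp

lemma summable_clifford_moment1:
  "summable (\<lambda>j. clifford_coeff j / ((real j + 1) * (real j + real k + 1)) * y ^ j)"
  by (intro summable_if_coeff_le_inverse_fact clifford_coeff_div_le one_le_prod)

lemma DERIV_clifford [derivative_intros]:
  "(clifford has_real_derivative - clifford_moment 0 y) (at y)"
proof -
  have "diffs clifford_coeff = (\<lambda>j. - (clifford_coeff j / (real j + real 0 + 1)))"
    by (auto simp: diffs_def clifford_coeff_Suc fun_eq_iff power2_eq_square divide_simps; simp add: algebra_simps)
  with termdiffs_strong_converges_everywhere[OF summable_clifford, of y]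
  show ?thesis unfolding clifford_def[abs_def] clifford_moment_def
    using suminf_minus[OF summable_clifford_moment[of 0 y]] by (simp del: of_nat_0)
qed

lemma DERIV_clifford_moment:
  "(clifford_moment k has_real_derivative - clifford_moment1 (Suc k) y) (at y)"
proof -
  have "diffs (\<lambda>j. clifford_coeff j / (real j + real k + 1)) =
     (\<lambda>j. - (clifford_coeff j / ((real j + 1) * (real j + real (Suc k) + 1))))"
    by (auto simp: diffs_def clifford_coeff_Suc fun_eq_iff power2_eq_square divide_simps)
  with termdiffs_strong_converges_everywhere[OF summable_clifford_moment[of k], of y]
  show ?thesis unfolding clifford_moment_def[abs_def] clifford_moment1_def
    using suminf_minus[OF summable_clifford_moment1[of "Suc k" y]] by simp
qed

text \<open>
  Integration by parts in the moment integral, read off from the coefficients.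
\<close>
lemma mult_clifford_moment1:
  "y * clifford_moment1 (Suc k) y = (real k + 1) * clifford_moment k y - clifford y"
proof -
  let ?d = "\<lambda>j. ((real k + 1) * (clifford_coeff j / (real j + real k + 1) * y ^ j) - clifford_coeff j * y ^ j)"
  have d: "?d sums ((real k + 1) * clifford_moment k y - clifford y)"
    unfolding clifford_moment_def clifford_def
    by (intro sums_diff sums_mult summable_sums summable_clifford summable_clifford_moment)
  note s = sums_summable[OF d]
  have "(real k + 1) * clifford_moment k y - clifford y = suminf ?d" using d by (rule sums_unique)
  also have "\<dots> = (\<Sum>j. ?d (Suc j))" using suminf_split_head[OF s] by simp
  also have "(\<lambda>j. ?d (Suc j)) = (\<lambda>j. y * (clifford_coeff j / ((real j + 1) * (real j + real (Suc k) + 1)) * y ^ j))"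
    by (auto simp: clifford_coeff_Suc fun_eq_iff power2_eq_square divide_simps) (simp add: algebra_simps)
  also have "(\<Sum>j. y * (clifford_coeff j / ((real j + 1) * (real j + real (Suc k) + 1)) * y ^ j)) = y * clifford_moment1 (Suc k) y"
    unfolding clifford_moment1_def by (intro suminf_mult summable_clifford_moment1)
  finally show ?thesis by simp
qed

text \<open>
  Partial fractions of \<open>1/((j+1)(j+k+1))\<close>; this transfers the decay of moment \<open>0\<close> to all moments.
\<close>
lemma clifford_moment_eq: "clifford_moment k y = clifford_moment 0 y - real k * clifford_moment1 k y"
proof -
  have "clifford_moment 0 y - real k * clifford_moment1 k y =
     (\<Sum>j. clifford_coeff j / (real j + real 0 + 1) * y ^ j - real k * (clifford_coeff j / ((real j + 1) * (real j + real k + 1)) * y ^ j))"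
    unfolding clifford_moment_def clifford_moment1_def
    by (intro sums_unique sums_diff sums_mult summable_sums summable_clifford_moment1 summable_clifford_moment)
  also have "\<dots> = clifford_moment k y" unfolding clifford_moment_def
    by (intro suminf_cong) (simp add: divide_simps add_eq_0_iff, simp add: algebra_simps)
  finally show ?thesis by simp
qed

lemma clifford_0: "clifford 0 = 1"
  unfolding clifford_def using powser_zero[of clifford_coeff] by (simp add: clifford_coeff_def)

text \<open>
  With \<open>P = clifford\<close> and \<open>Q = -P'\<close> the differential equation gives \<open>yQ' = P - Q\<close>, hence
  \<open>(P\<^sup>2 + yQ\<^sup>2)' = -Q\<^sup>2\<close>.  The amplitude \<open>y\<^bsup>-1/4\<^esup>\<close> known from asymptotics suggests that
  \<open>\<surd>y (P\<^sup>2 + yQ\<^sup>2)\<close> stays bounded.  The correction terms in \<open>W\<close> cancel the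
  part of the derivative without a definite sign: what is left is \<open>W' = -P\<^sup>2/(16 y\<surd>y) \<le> 0\<close>, so
  that \<open>W\<close> is a decreasing energy which controls \<open>\<surd>y (P\<^sup>2 + yQ\<^sup>2)\<close>.
\<close>
lemma clifford_decay:
  obtains C where "0 \<le> C" "\<And>y. 1 \<le> y \<Longrightarrow> \<bar>clifford y\<bar> \<le> C * y powr (-1/4)"
    "\<And>y. 1 \<le> y \<Longrightarrow> \<bar>clifford_moment 0 y\<bar> \<le> C * y powr (-3/4)"
proof -
  let ?P = clifford and ?Q = "clifford_moment 0"
  define W where "W y = sqrt y * ((?P y)\<^sup>2 + y * (?Q y)\<^sup>2 - ?P y * ?Q y / 2) + (?P y)\<^sup>2 / (8 * sqrt y)" for y
  have D: "(W has_real_derivative - (?P y)\<^sup>2 / (16 * y * sqrt y)) (at y)" if "1 \<le> y" for y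
  proof -
    define s where "s = sqrt y"
    have s: "s > 0" "y = s * s" "sqrt (s * s) = s" using that by (auto simp: s_def)
    define P Q R where "P = ?P y" and "Q = ?Q y" and "R = clifford_moment1 (Suc 0) y"
    have R: "R = (Q - P) / (s* s)" using mult_clifford_moment1[of y 0] s by (simp add: P_def Q_def R_def field_simps)
    have dQ: "(?Q has_real_derivative - R) (at y)" unfolding R_def using DERIV_clifford_moment[of 0 y] by simp
    have dP: "(?P has_real_derivative - Q) (at y)" unfolding Q_def by (rule DERIV_clifford)
    have dS: "(sqrt has_real_derivative 1 / (2 * s)) (at y)"
      using DERIV_real_sqrt[of y] that by (simp add: s_def divide_simps mult.commute)
    have nz: "8 * sqrt y \<noteq> 0" using that by simp
    note P2 = DERIV_power[OF dP, of 2] and Q2 = DERIV_power[OF dQ, of 2]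
    note inner = DERIV_diff[OF DERIV_add[OF P2 DERIV_mult[OF DERIV_ident Q2]] DERIV_cdivide[OF DERIV_mult[OF dP dQ], of 2]]
    note whole = DERIV_add[OF DERIV_mult[OF dS inner] DERIV_divide[OF P2 DERIV_cmult[OF dS, of 8] nz]]
    show ?thesis unfolding W_def[abs_def]
    proof (rule DERIV_cong[OF whole], unfold P_def[symmetric] Q_def[symmetric] R, unfold s(2) s(3))
      \<comment> \<open>With \<open>u\<close> for \<open>1/s\<close> the identity becomes polynomial.\<close>
      define u where "u = inverse s"
      have su: "s * u = 1" using s(1) by (simp add: u_def)
      have su': "s * (u * t) = t" for t using su by (simp flip: mult.assoc)
      have d: "t / s = t * u" "t / (s * s) = t * (u * u)" "t / (2 * s) = t * u / 2" "t / (16 * (s * s) * s) = t * (u * u * u) / 16"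
         "t / (8 * s * (8 * s)) = t * (u * u) / 64" for t
        using s(1) by (simp_all add: u_def field_simps)
      show "1 / (2 * s) * (P\<^sup>2 + s * s * Q\<^sup>2 - P * Q / 2) +
         (real 2 * (- Q * P ^ (2 - Suc 0)) + (1 * Q\<^sup>2 + real 2 * (- ((Q - P) / (s * s)) * Q ^ (2 - Suc 0)) * (s * s)) -
           (- Q * Q + - ((Q - P) / (s * s)) * P) / 2) * s +
         ((real 2 * (- Q * P ^ (2 - Suc 0))) * (8 * s) - P\<^sup>2 * (8 * (1 / (2 * s)))) / (8 * s * (8 * s)) =
         - P\<^sup>2 / (16 * (s * s) * s)"
        unfolding d by (simp add: su su' algebra_simps power2_eq_square) (simp add: field_simps)
    qed
  qed
  have W1: "W y \<le> W 1" if "1 \<le> y" for y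
  proof (rule DERIV_nonpos_imp_nonincreasing[OF that])
    fix t :: real assume "1 \<le> t" "t \<le> y"
    thus "\<exists>d. (W has_real_derivative d) (at t) \<and> d \<le> 0"
      by (intro exI[of _ "- (?P t)\<^sup>2 / (16 * t * sqrt t)"] conjI D) (auto simp: divide_nonpos_nonneg)
  qed
  \<comment> \<open>For \<open>y \<ge> 1\<close> the cross term \<open>PQ/2\<close> is at most a quarter of \<open>P\<^sup>2 + yQ\<^sup>2\<close>, whence \<open>4/3\<close>.\<close>
  define C where "C = sqrt (4/3 * W 1)"
  have low: "3/4 * (sqrt y * ((?P y)\<^sup>2 + y * (?Q y)\<^sup>2)) \<le> W 1" if y: "1 \<le> y" for y
  proof -
    have "?P y * ?Q y \<le> ((?P y)\<^sup>2 + (?Q y)\<^sup>2) / 2"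
      using sum_squares_ge_zero[of "?P y - ?Q y" 0] by (simp add: power2_eq_square algebra_simps)
    moreover have "(?Q y)\<^sup>2 \<le> y * (?Q y)\<^sup>2" using mult_right_mono[OF y, of "(?Q y)\<^sup>2"] by simp
    ultimately have "3/4 * ((?P y)\<^sup>2 + y * (?Q y)\<^sup>2) \<le> (?P y)\<^sup>2 + y * (?Q y)\<^sup>2 - ?P y * ?Q y / 2" by simp
    hence "sqrt y * (3/4 * ((?P y)\<^sup>2 + y * (?Q y)\<^sup>2)) \<le> sqrt y * ((?P y)\<^sup>2 + y * (?Q y)\<^sup>2 - ?P y * ?Q y / 2)"
      using y by (intro mult_left_mono) auto
    also have "\<dots> \<le> W y" unfolding W_def using y by simp
    also have "\<dots> \<le> W 1" using W1 y by simp
    finally show ?thesis by (simp add: mult_ac)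
  qed
  have C2: "C\<^sup>2 = 4/3 * W 1" unfolding C_def
  proof (intro real_sqrt_pow2)
    have "0 \<le> 3/4 * (sqrt 1 * ((?P 1)\<^sup>2 + 1 * (?Q 1)\<^sup>2))" by simp
    also have "\<dots> \<le> W 1" by (rule low) simp
    finally show "0 \<le> 4/3 * W 1" by simp
  qed
  show ?thesis
  proof (rule that[of C])
    show "0 \<le> C" using C2 unfolding C_def by (metis real_sqrt_ge_0_iff zero_le_power2)
    fix y :: real assume y: "1 \<le> y"
    have sq: "y powr (1/2) = sqrt y" using y by (simp add: powr_half_sqrt)
    have *: "sqrt y * ((?P y)\<^sup>2 + y * (?Q y)\<^sup>2) \<le> C\<^sup>2" using low[OF y] C2 by simp
    have "sqrt y * (?P y)\<^sup>2 \<le> sqrt y * ((?P y)\<^sup>2 + y * (?Q y)\<^sup>2)" using y by (intro mult_left_mono) auto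
    with * have "(?P y)\<^sup>2 * y powr (1/2) \<le> C\<^sup>2" unfolding sq by (simp add: mult.commute)
    hence "(?P y)\<^sup>2 \<le> C\<^sup>2 * y powr (-1/2)" using y by (simp add: powr_minus field_simps)
    also have "\<dots> = (C * y powr (-1/4))\<^sup>2" using y by (simp add: power_mult_distrib power2_eq_square flip: powr_add)
    finally show "\<bar>?P y\<bar> \<le> C * y powr (-1/4)"
      using \<open>0 \<le> C\<close> by (simp add: abs_le_square_iff[symmetric])
    have "sqrt y * (y * (?Q y)\<^sup>2) \<le> sqrt y * ((?P y)\<^sup>2 + y * (?Q y)\<^sup>2)" using y by (intro mult_left_mono) auto
    with * have "(?Q y)\<^sup>2 * (y powr (1/2) * y) \<le> C\<^sup>2" unfolding sq by (simp add: mult_ac)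
    also have "y powr (1/2) * y = y powr (3/2)" using y powr_add[of y "1/2" 1] by simp
    finally have "(?Q y)\<^sup>2 \<le> C\<^sup>2 * y powr (-3/2)" using y by (simp add: powr_minus field_simps)
    also have "\<dots> = (C * y powr (-3/4))\<^sup>2" using y by (simp add: power_mult_distrib power2_eq_square flip: powr_add)
    finally show "\<bar>?Q y\<bar> \<le> C * y powr (-3/4)"
      using \<open>0 \<le> C\<close> by (simp add: abs_le_square_iff[symmetric])
  qed
qed

text \<open>
  Induction on \<open>k\<close>: \<open>mult_clifford_moment1\<close> gains a factor \<open>1/y\<close>, and \<open>clifford_moment_eq\<close>
  passes to the next moment.
\<close>
lemma clifford_moment_decay:
  obtains C where "0 \<le> C" "\<And>y. 1 \<le> y \<Longrightarrow> \<bar>clifford_moment k y\<bar> \<le> C * y powr (-3/4)"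
    "\<And>y. 1 \<le> y \<Longrightarrow> \<bar>clifford_moment1 (Suc k) y\<bar> \<le> C * y powr (-5/4)"
proof -
  obtain C where C: "0 \<le> C" "\<And>y. 1 \<le> y \<Longrightarrow> \<bar>clifford y\<bar> \<le> C * y powr (-1/4)"
    "\<And>y. 1 \<le> y \<Longrightarrow> \<bar>clifford_moment 0 y\<bar> \<le> C * y powr (-3/4)" using clifford_decay by blast
  have h: "\<bar>clifford_moment1 (Suc k) y\<bar> \<le> ((real k + 1) * D + C) * y powr (-5/4)"
    if D: "\<bar>clifford_moment k y\<bar> \<le> D * y powr (-3/4)" "0 \<le> D" and y: "1 \<le> y" for D k y
  proof -
    have "y * \<bar>clifford_moment1 (Suc k) y\<bar> = \<bar>(real k + 1) * clifford_moment k y - clifford y\<bar>"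
      using y by (simp add: abs_mult flip: mult_clifford_moment1)
    also have "\<dots> \<le> (real k + 1) * \<bar>clifford_moment k y\<bar> + \<bar>clifford y\<bar>"
      using abs_triangle_ineq4[of "(real k + 1) * clifford_moment k y" "clifford y"] by (simp add: abs_mult)
    also have "\<dots> \<le> (real k + 1) * (D * y powr (-3/4)) + C * y powr (-1/4)"
      by (intro add_mono mult_left_mono D C y) auto
    also have "\<dots> \<le> (real k + 1) * (D * y powr (-1/4)) + C * y powr (-1/4)"
      using y D C(1) by (intro add_mono mult_left_mono powr_mono) auto
    also have "y powr (-1/4) = y * y powr (-5/4)" using y powr_add[of y 1 "-5/4"] by simp
    finally have "y * \<bar>clifford_moment1 (Suc k) y\<bar> \<le> y * (((real k + 1) * D + C) * y powr (-5/4))"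
      by (simp add: algebra_simps)
    thus ?thesis using y by (subst (asm) mult_le_cancel_left_pos) auto
  qed
  have g: "\<exists>D\<ge>0. \<forall>y\<ge>1. \<bar>clifford_moment k y\<bar> \<le> D * y powr (-3/4)"
  proof (induction k)
    case 0 show ?case using C by auto
  next
    case (Suc k)
    then obtain D where D: "0 \<le> D" "\<And>y. 1 \<le> y \<Longrightarrow> \<bar>clifford_moment k y\<bar> \<le> D * y powr (-3/4)" by blast
    let ?E = "C + real (Suc k) * ((real k + 1) * D + C)"
    have "\<bar>clifford_moment (Suc k) y\<bar> \<le> ?E * y powr (-3/4)" if y: "1 \<le> y" for y
    proof -
      have "\<bar>clifford_moment (Suc k) y\<bar> \<le> \<bar>clifford_moment 0 y\<bar> + real (Suc k) * \<bar>clifford_moment1 (Suc k) y\<bar>"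
        unfolding clifford_moment_eq[of "Suc k" y]
        using abs_triangle_ineq4[of "clifford_moment 0 y" "real (Suc k) * clifford_moment1 (Suc k) y"] by (simp add: abs_mult)
      also have "\<dots> \<le> C * y powr (-3/4) + real (Suc k) * (((real k + 1) * D + C) * y powr (-5/4))"
        by (intro add_mono mult_left_mono C y h D) auto
      also have "\<dots> \<le> C * y powr (-3/4) + real (Suc k) * (((real k + 1) * D + C) * y powr (-3/4))"
        using y D C by (intro add_mono mult_left_mono powr_mono) auto
      finally show ?thesis by (simp add: algebra_simps)
    qed
    thus ?case using C D by (intro exI[of _ ?E]) auto
  qed
  then obtain D where D: "0 \<le> D" "\<And>y. 1 \<le> y \<Longrightarrow> \<bar>clifford_moment k y\<bar> \<le> D * y powr (-3/4)" by blast
  show ?thesis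
  proof (rule that[of "(real k + 1) * D + C"])
    show "0 \<le> (real k + 1) * D + C" using C D by simp
    fix y :: real assume y: "1 \<le> y"
    show "\<bar>clifford_moment1 (Suc k) y\<bar> \<le> ((real k + 1) * D + C) * y powr (-5/4)" by (intro h D y)
    have "D * 1 \<le> (real k + 1) * D + C" using C D by (simp add: algebra_simps)
    thus "\<bar>clifford_moment k y\<bar> \<le> ((real k + 1) * D + C) * y powr (-3/4)"
      using D(2)[OF y] by (smt (verit) mult_right_mono powr_ge_zero)
  qed
qed

text \<open>
  The bound for the derivative of \<open>clifford_moment k (c * b)\<close> in the form in which Poisson
  summation asks for it, uniform down to \<open>b = 0\<close>.
\<close>
lemma clifford_moment1_decay_scaled:
  assumes c: "0 < c"
  obtains K where "0 \<le> K" "\<And>b. 0 \<le> b \<Longrightarrow> \<bar>c * clifford_moment1 (Suc k) (c * b)\<bar> \<le> K * (1 + b) powr (-5/4)"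
proof -
  obtain C where C: "0 \<le> C" "\<And>y. 1 \<le> y \<Longrightarrow> \<bar>clifford_moment1 (Suc k) y\<bar> \<le> C * y powr (-5/4)"
    using clifford_moment_decay by metis
  have "continuous_on {0..1} (clifford_moment1 (Suc k))"
    unfolding clifford_moment1_def[abs_def]
    by (intro continuous_at_imp_continuous_on ballI DERIV_isCont[OF termdiffs_strong_converges_everywhere] summable_clifford_moment1)
  from compact_imp_bounded[OF compact_continuous_image[OF this]]
  obtain B where "\<forall>y\<in>{0..1}. \<bar>clifford_moment1 (Suc k) y\<bar> \<le> B" by (auto simp: bounded_iff)
  hence B: "\<bar>clifford_moment1 (Suc k) y\<bar> \<le> \<bar>B\<bar>" if "0 \<le> y" "y \<le> 1" for y using that by force
  define K where "K = (C + \<bar>B\<bar>) * 2 powr (5/4)"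
  have K: "\<bar>clifford_moment1 (Suc k) y\<bar> \<le> K * (1 + y) powr (-5/4)" if "0 \<le> y" for y
  proof -
    have *: "2 powr (5/4) * (1+y) powr (-5/4) = ((1+y)/2) powr (-5/4)"
      using that by (simp add: powr_divide powr_minus field_simps)
    show ?thesis
    proof (cases "1 \<le> y")
      case True
      have "y powr (-5/4) \<le> ((1+y)/2) powr (-5/4)" using True by (intro powr_mono2') auto
      hence "C * y powr (-5/4) \<le> (C + \<bar>B\<bar>) * ((1+y)/2) powr (-5/4)" using C by (intro mult_mono) auto
      with C(2)[OF True] show ?thesis unfolding K_def mult.assoc * by linarith
    next
      case False
      have "1 powr (-5/4) \<le> ((1+y)/2) powr (-5/4)" using False that by (intro powr_mono2') auto
      hence "\<bar>B\<bar> * 1 \<le> (C + \<bar>B\<bar>) * ((1+y)/2) powr (-5/4)" using C by (intro mult_mono) auto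
      with B[of y] False that show ?thesis unfolding K_def mult.assoc * by linarith
    qed
  qed
  have K0: "0 \<le> K" using C unfolding K_def by simp
  \<comment> \<open>The rescaling from \<open>1 + c b\<close> to \<open>1 + b\<close> costs at most the factor \<open>min 1 c\<close>.\<close>
  define m where "m = min 1 c"
  have m: "0 < m" "m \<le> 1" "m \<le> c" using c by (auto simp: m_def)
  show ?thesis
  proof (rule that[of "c * K * m powr (-5/4)"])
    show "0 \<le> c * K * m powr (-5/4)" using c K0 by simp
    fix b :: real assume b: "0 \<le> b"
    have "m * (1 + b) \<le> 1 + c * b" using m b by (simp add: distrib_left add_mono mult_right_mono)
    hence "(1 + c * b) powr (-5/4) \<le> (m * (1+b)) powr (-5/4)" using m b by (intro powr_mono2') auto
    also have "\<dots> = m powr (-5/4) * (1+b) powr (-5/4)" using m b by (simp add: powr_mult)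
    finally have "K * (1 + c * b) powr (-5/4) \<le> K * (m powr (-5/4) * (1+b) powr (-5/4))" using K0 by (intro mult_left_mono)
    with K[of "c * b"] have "\<bar>clifford_moment1 (Suc k) (c * b)\<bar> \<le> K * (m powr (-5/4) * (1+b) powr (-5/4))" using c b by simp
    hence "c * \<bar>clifford_moment1 (Suc k) (c * b)\<bar> \<le> c * (K * (m powr (-5/4) * (1+b) powr (-5/4)))" using c by (intro mult_left_mono) auto
    thus "\<bar>c * clifford_moment1 (Suc k) (c * b)\<bar> \<le> c * K * m powr (-5/4) * (1 + b) powr (-5/4)"
      using c by (simp add: abs_mult mult_ac)
  qed
qed

lemma tendsto_0_if_powr_decay:
  fixes F :: "real \<Rightarrow> real"
  assumes "\<And>y. 1 \<le> y \<Longrightarrow> \<bar>F y\<bar> \<le> C * y powr (-a)" "0 < a"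
  shows "(F \<longlongrightarrow> 0) at_top"
proof (rule tendsto_rabs_zero_cancel, rule tendsto_sandwich[of "\<lambda>_. 0" "\<lambda>y. \<bar>F y\<bar>" at_top "\<lambda>y. C * y powr (-a)"])
  show "((\<lambda>y. C * y powr (-a)) \<longlongrightarrow> 0) at_top"
    using tendsto_mult_right_zero[OF tendsto_neg_powr[OF _ filterlim_ident], of "-a" C] assms by simp
  show "\<forall>\<^sub>F y in at_top. \<bar>F y\<bar> \<le> C * y powr (-a)"
    using eventually_ge_at_top[of 1] by eventually_elim (use assms in auto)
qed auto

lemma clifford_tendsto_0: "(clifford \<longlongrightarrow> 0) at_top"
  using clifford_decay tendsto_0_if_powr_decay[of clifford _ "1/4"] by (metis minus_divide_left zero_less_divide_1_iff zero_less_numeral)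

lemma clifford_moment_tendsto_0: "(clifford_moment k \<longlongrightarrow> 0) at_top"
  using clifford_moment_decay[of k] tendsto_0_if_powr_decay[of "clifford_moment k" _ "3/4"] by (metis minus_divide_left zero_less_divide_iff zero_less_numeral)

text \<open>
  The zero mode of Poisson summation.  By the recurrences, \<open>k G\<^bsub>k-1\<^esub> - P\<close> is an antiderivative
  of \<open>G\<^sub>k\<close> that tends to 0 at infinity; for \<open>k \<ge> 1\<close> it also vanishes at 0.  For \<open>k = 0\<close> the limit
  is \<open>1/c\<close>, which cancels within a bracket.
\<close>
lemma integral_clifford_moment_tendsto:
  assumes c: "0 < c"
  shows "\<exists>Z. (\<lambda>N. integral {0..real N} (\<lambda>b. clifford_moment k (c * b))) \<longlonglongrightarrow> Z \<and> (1 \<le> k \<longrightarrow> Z = 0)"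
proof -
  have cN: "filterlim (\<lambda>N. c * real N) at_top sequentially"
    using c by (intro filterlim_tendsto_pos_mult_at_top[OF tendsto_const _ filterlim_real_sequentially]) auto
  have P: "(\<lambda>N. clifford (c * real N)) \<longlonglongrightarrow> 0" by (rule filterlim_compose[OF clifford_tendsto_0 cN])
  have G: "(\<lambda>N. clifford_moment i (c * real N)) \<longlonglongrightarrow> 0" for i by (rule filterlim_compose[OF clifford_moment_tendsto_0 cN])
  \<comment> \<open>An antiderivative of \<open>clifford_moment k\<close>; the case distinction avoids \<open>k - 1\<close> at 0.\<close>
  define A where "A y = (if k = 0 then - clifford y else real k * clifford_moment (k - 1) y - clifford y)" for y
  have D: "(A has_real_derivative clifford_moment k y) (at y)" for y
  proof (cases k)
    case 0 thus ?thesis unfolding A_def using DERIV_minus[OF DERIV_clifford] by simp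
  next
    case (Suc i)
    have "((\<lambda>y. real k * clifford_moment i y - clifford y) has_real_derivative real k * (- clifford_moment1 k y) - (- clifford_moment 0 y)) (at y)"
      unfolding Suc by (intro DERIV_diff DERIV_cmult DERIV_clifford_moment DERIV_clifford)
    thus ?thesis unfolding A_def using Suc clifford_moment_eq[of k y] by (simp add: add.commute)
  qed
  have "((\<lambda>b. clifford_moment k (c * b)) has_integral (A (c * real N) / c - A (c * 0) / c)) {0..real N}" for N
  proof (rule fundamental_theorem_of_calculus)
    fix b :: real
    have "((\<lambda>b. A (c * b) / c) has_real_derivative clifford_moment k (c * b) * c / c) (at b)"
      by (intro DERIV_cdivide DERIV_chain2[OF D] DERIV_cmult_Id)
    thus "((\<lambda>b. A (c * b) / c) has_vector_derivative clifford_moment k (c * b)) (at b within {0..real N})"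
      using c by (auto intro: has_field_derivative_at_within simp flip: has_real_derivative_iff_has_vector_derivative)
  qed simp
  hence I: "integral {0..real N} (\<lambda>b. clifford_moment k (c * b)) = A (c * real N) / c - A 0 / c" for N
    using integral_unique by fastforce
  have "(\<lambda>N. A (c * real N)) \<longlonglongrightarrow> 0"
    unfolding A_def using tendsto_minus[OF P] tendsto_diff[OF tendsto_mult_right_zero[OF G[of "k-1"], of "real k"] P]
    by (cases k) simp_all
  hence L: "(\<lambda>N. A (c * real N) / c - A 0 / c) \<longlonglongrightarrow> 0 / c - A 0 / c" using c by (intro tendsto_intros) auto
  have "A 0 = 0" if k1: "1 \<le> k"
  proof -
    obtain i where i: "k = Suc i" using k1 by (cases k) auto
    show ?thesis using mult_clifford_moment1[of 0 i] i by (simp add: A_def add.commute)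
  qed
  thus ?thesis using L unfolding I by (intro exI[of _ "- A 0 / c"]) auto
qed

section \<open>Fourier transforms of the moments\<close>

lemma continuous_on_clifford [continuous_intros]:
  "continuous_on S f \<Longrightarrow> continuous_on S (\<lambda>x. clifford (f x))"
proof (rule continuous_on_compose2[of UNIV clifford])
  show "continuous_on UNIV clifford"
    by (intro continuous_at_imp_continuous_on ballI DERIV_isCont[OF DERIV_clifford])
qed auto

lemma continuous_on_clifford_moment [continuous_intros]:
  "continuous_on S f \<Longrightarrow> continuous_on S (\<lambda>x. clifford_moment k (f x))"
proof (rule continuous_on_compose2[of UNIV "clifford_moment k"])
  show "continuous_on UNIV (clifford_moment k)"
    by (intro continuous_at_imp_continuous_on ballI DERIV_isCont[OF DERIV_clifford_moment])
qed auto

lemma clifford_bounded: obtains B where "0 \<le> B" "\<And>y. 0 \<le> y \<Longrightarrow> \<bar>clifford y\<bar> \<le> B"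
proof -
  obtain C where C: "0 \<le> C" "\<And>y. 1 \<le> y \<Longrightarrow> \<bar>clifford y\<bar> \<le> C * y powr (-1/4)" using clifford_decay by metis
  have "continuous_on {0..1} (\<lambda>y. clifford y)" by (intro continuous_intros)
  from compact_imp_bounded[OF compact_continuous_image[OF this]]
  obtain A where A: "\<forall>y\<in>{0..1}. \<bar>clifford y\<bar> \<le> A" by (auto simp: bounded_iff)
  show ?thesis
  proof (rule that[of "\<bar>A\<bar> + C"])
    fix y :: real assume y: "0 \<le> y"
    show "\<bar>clifford y\<bar> \<le> \<bar>A\<bar> + C"
    proof (cases "y \<le> 1")
      case True thus ?thesis using A y C(1) by force
    next
      case False
      have "C * y powr (-1/4) \<le> C * 1" using False C(1) powr_mono[of "-1/4" 0 y] by (intro mult_left_mono) auto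
      thus ?thesis using C(2)[of y] False by simp
    qed
  qed (use C in auto)
qed

lemma has_vector_derivative_complex_of_real:
  "((\<lambda>x. complex_of_real (f x)) has_vector_derivative complex_of_real d) (at x within S)" if "(f has_real_derivative d) (at x within S)"
  using that by (simp add: has_real_derivative_iff_has_vector_derivative has_vector_derivative_of_real)

text \<open>
  The upper limit \<open>N\<close> is a multiple of the period of \<open>exp(-\<i>\<omega>b)\<close>, so that boundary
  terms at \<open>b = N\<close> carry no phase.
\<close>
context
  fixes \<kappa> \<omega> :: real and N :: nat
  assumes \<omega>: "0 < \<omega>" and period: "exp (real N *\<^sub>R (- (\<i> * \<omega>))) = 1"
begin

text \<open>
  Let \<open>Y(w) = \<integral>\<^sub>0\<^sup>N P(\<kappa>wb) exp(-\<i>\<omega>b) db\<close>.  Differentiation in \<open>w\<close> produces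
  \<open>-\<kappa>bG\<^sub>0(\<kappa>wb)\<close> under the integral, and \<open>bG\<^sub>0(\<kappa>wb)\<close> is the antiderivative of \<open>P(\<kappa>wb)\<close> in \<open>b\<close>;
  integration by parts leads back to \<open>Y\<close>.  The truncated transform thus obeys a linear equation of
  first order, and no improper integral in \<open>b\<close> has to be handled directly.
\<close>
lemma clifford_transform_ode:
  "((\<lambda>w. integral {0..real N} (\<lambda>b. complex_of_real (clifford (\<kappa> * w * b)) * exp (b *\<^sub>R (- (\<i> * \<omega>)))))
     has_vector_derivative
     - (\<kappa> / (\<i> * \<omega>)) * (integral {0..real N} (\<lambda>b. complex_of_real (clifford (\<kappa> * w * b)) * exp (b *\<^sub>R (- (\<i> * \<omega>))))
           - real N * clifford_moment 0 (\<kappa> * w * real N))) (at w)"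
proof -
  let ?s = "\<i> * complex_of_real \<omega>"
  let ?E = "\<lambda>b::real. exp (b *\<^sub>R (- ?s))"
  have "((\<lambda>w. integral (cbox 0 (real N)) (\<lambda>b. complex_of_real (clifford (\<kappa> * w * b)) * ?E b)) has_vector_derivative
     integral (cbox 0 (real N)) (\<lambda>b. complex_of_real (- clifford_moment 0 (\<kappa> * w * b) * (\<kappa> * b)) * ?E b)) (at w within UNIV)"
  proof (rule leibniz_rule_vector_derivative)
    fix w b :: real
    have "((\<lambda>w. clifford (\<kappa> * w * b)) has_real_derivative - clifford_moment 0 (\<kappa> * w * b) * (\<kappa> * b)) (at w)"
      by (rule DERIV_chain2[OF DERIV_clifford]) (auto intro!: derivative_eq_intros)
    from has_vector_derivative_mult_left[OF has_vector_derivative_complex_of_real[OF this]]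
    show "((\<lambda>w. complex_of_real (clifford (\<kappa> * w * b)) * ?E b) has_vector_derivative
        complex_of_real (- clifford_moment 0 (\<kappa> * w * b) * (\<kappa> * b)) * ?E b) (at w within UNIV)" .
  next
    fix w :: real
    show "(\<lambda>b. complex_of_real (clifford (\<kappa> * w * b)) * ?E b) integrable_on cbox 0 (real N)"
      by (intro integrable_continuous continuous_intros)
  next
    show "continuous_on (UNIV \<times> cbox 0 (real N)) (\<lambda>(w, b). complex_of_real (- clifford_moment 0 (\<kappa> * w * b) * (\<kappa> * b)) * ?E b)"
      unfolding split_def by (intro continuous_intros)
  qed auto
  moreover have "integral {0..real N} (\<lambda>b. complex_of_real (- clifford_moment 0 (\<kappa> * w * b) * (\<kappa> * b)) * ?E b) =
     - (\<kappa> / ?s) * (integral {0..real N} (\<lambda>b. complex_of_real (clifford (\<kappa> * w * b)) * ?E b) - real N * clifford_moment 0 (\<kappa> * w * real N))"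
  proof -
    let ?G = "\<lambda>b. complex_of_real (b * clifford_moment 0 (\<kappa> * w * b))"
    have G: "(?G has_vector_derivative complex_of_real (clifford (\<kappa> * w * b))) (at b)" for b
    proof (rule has_vector_derivative_complex_of_real)
      have "((\<lambda>b. clifford_moment 0 (\<kappa> * w * b)) has_real_derivative - clifford_moment1 (Suc 0) (\<kappa> * w * b) * (\<kappa> * w)) (at b)"
        by (rule DERIV_chain2[OF DERIV_clifford_moment]) (auto intro!: derivative_eq_intros)
      from DERIV_mult[OF DERIV_ident this]
      show "((\<lambda>b. b * clifford_moment 0 (\<kappa> * w * b)) has_real_derivative clifford (\<kappa> * w * b)) (at b)"
        by (rule DERIV_cong) (use mult_clifford_moment1[of "\<kappa> * w * b" 0] in \<open>simp add: algebra_simps\<close>)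
    qed
    have "((\<lambda>b. ?G b * (?E b * (- ?s)) + complex_of_real (clifford (\<kappa> * w * b)) * ?E b) has_integral (?G (real N) * ?E (real N) - ?G 0 * ?E 0)) {0..real N}"
    proof (rule fundamental_theorem_of_calculus)
      fix b :: real
      show "((\<lambda>b. ?G b * ?E b) has_vector_derivative ?G b * (?E b * (- ?s)) + complex_of_real (clifford (\<kappa> * w * b)) * ?E b) (at b within {0..real N})"
        by (rule has_vector_derivative_mult[OF has_vector_derivative_at_within[OF G] exp_scaleR_has_vector_derivative_right])
    qed simp
    hence 1: "((\<lambda>b. ?G b * (?E b * (- ?s)) + complex_of_real (clifford (\<kappa> * w * b)) * ?E b) has_integral complex_of_real (real N * clifford_moment 0 (\<kappa> * w * real N))) {0..real N}"
      using period by simp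
    have 2: "((\<lambda>b. complex_of_real (clifford (\<kappa> * w * b)) * ?E b) has_integral integral {0..real N} (\<lambda>b. complex_of_real (clifford (\<kappa> * w * b)) * ?E b)) {0..real N}"
      by (intro integrable_integral integrable_continuous_real continuous_intros)
    have "((\<lambda>b. (\<kappa> / ?s) * ((?G b * (?E b * (- ?s)) + complex_of_real (clifford (\<kappa> * w * b)) * ?E b) - complex_of_real (clifford (\<kappa> * w * b)) * ?E b))
      has_integral (\<kappa> / ?s) * (complex_of_real (real N * clifford_moment 0 (\<kappa> * w * real N)) - integral {0..real N} (\<lambda>b. complex_of_real (clifford (\<kappa> * w * b)) * ?E b))) {0..real N}"
      by (intro has_integral_mult_right has_integral_diff 1 2)
    moreover have "(\<kappa> / ?s) * ((?G b * (?E b * (- ?s)) + complex_of_real (clifford (\<kappa> * w * b)) * ?E b) - complex_of_real (clifford (\<kappa> * w * b)) * ?E b)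
       = complex_of_real (- clifford_moment 0 (\<kappa> * w * b) * (\<kappa> * b)) * ?E b" for b
      using \<omega> by (simp add: field_simps)
    ultimately have "((\<lambda>b. complex_of_real (- clifford_moment 0 (\<kappa> * w * b) * (\<kappa> * b)) * ?E b) has_integral
       (\<kappa> / ?s) * (complex_of_real (real N * clifford_moment 0 (\<kappa> * w * real N)) - integral {0..real N} (\<lambda>b. complex_of_real (clifford (\<kappa> * w * b)) * ?E b))) {0..real N}"
      by (simp only:)
    from integral_unique[OF this] show ?thesis by (simp only: minus_mult_left[symmetric] minus_mult_right minus_diff_eq of_real_mult of_real_of_nat_eq)
  qed
  ultimately show ?thesis by (simp only: box_real)
qed

text \<open>
  The solution of the linear equation by an integrating factor, with the boundary term absorbed
  into \<open>P(\<kappa>wN)\<close>, whose derivative it is.  Every term except the first contains \<open>P\<close> at an argument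
  proportional to \<open>N\<close>, and therefore vanishes as \<open>N\<close> grows.
\<close>
lemma clifford_transform_finite:
  assumes "0 \<le> w"
  shows "integral {0..real N} (\<lambda>b. complex_of_real (clifford (\<kappa> * w * b)) * exp (b *\<^sub>R (- (\<i> * \<omega>)))) =
     exp (w *\<^sub>R (\<i> * (\<kappa> / \<omega>))) * (1 / (\<i> * \<omega>) - (\<kappa> / \<omega>\<^sup>2) * integral {0..w} (\<lambda>\<gamma>. exp (\<gamma> *\<^sub>R (- (\<i> * (\<kappa> / \<omega>)))) * complex_of_real (clifford (\<kappa> * \<gamma> * real N))))
       - clifford (\<kappa> * w * real N) / (\<i> * \<omega>)"
proof -
  let ?s = "\<i> * complex_of_real \<omega>" and ?u = "- (\<i> * complex_of_real (\<kappa> / \<omega>))"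
  let ?E = "\<lambda>b::real. exp (b *\<^sub>R (- ?s))"
  define Y where "Y w = integral {0..real N} (\<lambda>b. complex_of_real (clifford (\<kappa> * w * b)) * ?E b)" for w
  define P where "P w = complex_of_real (clifford (\<kappa> * w * real N))" for w
  have s0: "?s \<noteq> 0" using \<omega> by simp
  have u: "?u = \<kappa> / ?s" using \<omega> by (simp add: complex_eq_iff Re_divide Im_divide power2_eq_square)
  have Y: "(Y has_vector_derivative - ?u * (Y w - real N * clifford_moment 0 (\<kappa> * w * real N))) (at w)" for w
    unfolding Y_def[abs_def] u using clifford_transform_ode[of w] by simp
  have P: "(P has_vector_derivative - complex_of_real (clifford_moment 0 (\<kappa> * w * real N) * (\<kappa> * real N))) (at w)" for w
  proof -
    have "((\<lambda>w. clifford (\<kappa> * w * real N)) has_real_derivative - clifford_moment 0 (\<kappa> * w * real N) * (\<kappa> * real N)) (at w)"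
      by (rule DERIV_chain2[OF DERIV_clifford]) (auto intro!: derivative_eq_intros)
    from has_vector_derivative_complex_of_real[OF this] show ?thesis unfolding P_def[abs_def] by simp
  qed
  \<comment> \<open>The integrating factor is \<open>exp(wu)\<close> with \<open>u = \<kappa>/s\<close>; adding \<open>P/s\<close> removes the boundary term.\<close>
  define V where "V w = exp (w *\<^sub>R ?u) * (Y w + P w * (1 / ?s))" for w
  have V: "(V has_vector_derivative exp (w *\<^sub>R ?u) * (?u / ?s) * P w) (at w)" for w
  proof -
    have "(V has_vector_derivative exp (w *\<^sub>R ?u) * (- ?u * (Y w - real N * clifford_moment 0 (\<kappa> * w * real N)) +
        - complex_of_real (clifford_moment 0 (\<kappa> * w * real N) * (\<kappa> * real N)) * (1 / ?s)) + (exp (w *\<^sub>R ?u) * ?u) * (Y w + P w * (1 / ?s))) (at w)"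
      unfolding V_def[abs_def]
      by (intro has_vector_derivative_mult has_vector_derivative_add has_vector_derivative_mult_left Y P exp_scaleR_has_vector_derivative_right)
    moreover have "exp (w *\<^sub>R ?u) * (- ?u * (Y w - real N * clifford_moment 0 (\<kappa> * w * real N)) +
        - complex_of_real (clifford_moment 0 (\<kappa> * w * real N) * (\<kappa> * real N)) * (1 / ?s)) + (exp (w *\<^sub>R ?u) * ?u) * (Y w + P w * (1 / ?s))
        = exp (w *\<^sub>R ?u) * (?u / ?s) * P w"
    proof -
      have alg: "e * (- (q / z) * (y - n * c) + - (c * (q * n)) * (1 / z)) + (e * (q / z)) * (y + p * (1 / z)) = e * ((q / z) / z) * p"
        if "z \<noteq> 0" for e q z y n c p :: complex
        using that by (simp add: field_simps)
      show ?thesis unfolding u of_real_mult of_real_of_nat_eq by (rule alg[OF s0])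
    qed
    ultimately show ?thesis by (simp only:)
  qed
  have "((\<lambda>\<gamma>. exp (\<gamma> *\<^sub>R ?u) * (?u / ?s) * P \<gamma>) has_integral (V w - V 0)) {0..w}"
    by (rule fundamental_theorem_of_calculus) (use assms V in \<open>auto intro: has_vector_derivative_at_within\<close>)
  from integral_unique[OF this]
  have "V w - V 0 = integral {0..w} (\<lambda>\<gamma>. exp (\<gamma> *\<^sub>R ?u) * (?u / ?s) * P \<gamma>)" by (rule sym)
  also have "(\<lambda>\<gamma>. exp (\<gamma> *\<^sub>R ?u) * (?u / ?s) * P \<gamma>) = (\<lambda>\<gamma>. (?u / ?s) * (exp (\<gamma> *\<^sub>R ?u) * P \<gamma>))"
    by (simp only: mult_ac)
  finally have "V w - V 0 = (?u / ?s) * integral {0..w} (\<lambda>\<gamma>. exp (\<gamma> *\<^sub>R ?u) * P \<gamma>)"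
    by (simp only: integral_mult_right)
  hence Vw: "V w = V 0 + (?u / ?s) * integral {0..w} (\<lambda>\<gamma>. exp (\<gamma> *\<^sub>R ?u) * P \<gamma>)"
    by (metis add.commute diff_add_cancel)
  have Y0: "Y 0 = 0"
  proof -
    have "((\<lambda>b. ?E b * (- ?s)) has_integral (?E (real N) - ?E 0)) {0..real N}"
      by (rule fundamental_theorem_of_calculus, simp, rule exp_scaleR_has_vector_derivative_right)
    hence "((\<lambda>b. ?E b * (- ?s)) has_integral 0) {0..real N}" using period by simp
    from has_integral_mult_left[OF this, of "- (1 / ?s)"]
    have "(?E has_integral 0) {0..real N}" using s0 by (simp add: mult.assoc)
    thus ?thesis unfolding Y_def using integral_unique by (auto simp: clifford_0)
  qed
  have V0: "V 0 = 1 / ?s" unfolding V_def Y0 P_def by (simp add: clifford_0)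
  have "Y w = exp (w *\<^sub>R (- ?u)) * V w - P w * (1 / ?s)"
    unfolding V_def by (simp add: algebra_simps flip: exp_add mult.assoc)
  also have "\<dots> = exp (w *\<^sub>R (- ?u)) * (1 / ?s + (?u / ?s) * integral {0..w} (\<lambda>\<gamma>. exp (\<gamma> *\<^sub>R ?u) * P \<gamma>)) - P w * (1 / ?s)"
    unfolding Vw V0 ..
  also have "?u / ?s = - (\<kappa> / \<omega>\<^sup>2)" using \<omega> by (simp add: field_simps power2_eq_square)
  finally show ?thesis unfolding Y_def P_def by simp
qed

text \<open>
  Since \<open>w\<^bsup>k+1\<^esup> G\<^sub>k(\<kappa>wb)\<close> has the derivative \<open>w\<^sup>k P(\<kappa>wb)\<close> in \<open>w\<close>, the transform of a moment
  is an integral of transforms of \<open>P\<close>.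
\<close>
lemma clifford_moment_transform_finite:
  assumes "0 \<le> w"
  shows "w ^ Suc k * integral {0..real N} (\<lambda>b. complex_of_real (clifford_moment k (\<kappa> * w * b)) * exp (b *\<^sub>R (- (\<i> * \<omega>)))) =
     integral {0..w} (\<lambda>\<gamma>. \<gamma> ^ k * integral {0..real N} (\<lambda>b. complex_of_real (clifford (\<kappa> * \<gamma> * b)) * exp (b *\<^sub>R (- (\<i> * \<omega>)))))"
proof -
  let ?E = "\<lambda>b::real. exp (b *\<^sub>R (- (\<i> * complex_of_real \<omega>)))"
  have "((\<lambda>w. integral (cbox 0 (real N)) (\<lambda>b. complex_of_real (w ^ Suc k * clifford_moment k (\<kappa> * w * b)) * ?E b)) has_vector_derivative
     integral (cbox 0 (real N)) (\<lambda>b. complex_of_real (w ^ k * clifford (\<kappa> * w * b)) * ?E b)) (at w within UNIV)" for w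
  proof (rule leibniz_rule_vector_derivative)
    fix w b :: real
    have 1: "((\<lambda>w. clifford_moment k (\<kappa> * w * b)) has_real_derivative - clifford_moment1 (Suc k) (\<kappa> * w * b) * (\<kappa> * b)) (at w)"
      by (rule DERIV_chain2[OF DERIV_clifford_moment]) (auto intro!: derivative_eq_intros)
    have "((\<lambda>w. w ^ Suc k * clifford_moment k (\<kappa> * w * b)) has_real_derivative w ^ k * clifford (\<kappa> * w * b)) (at w)"
    proof (rule DERIV_cong[OF DERIV_mult[OF DERIV_pow 1]])
      show "real (Suc k) * w ^ (Suc k - Suc 0) * clifford_moment k (\<kappa> * w * b) + - clifford_moment1 (Suc k) (\<kappa> * w * b) * (\<kappa> * b) * w ^ Suc k = w ^ k * clifford (\<kappa> * w * b)"
      proof -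
        have "clifford (\<kappa> * w * b) = (real k + 1) * clifford_moment k (\<kappa> * w * b) - \<kappa> * w * b * clifford_moment1 (Suc k) (\<kappa> * w * b)"
          using mult_clifford_moment1[of "\<kappa> * w * b" k] by simp
        thus ?thesis by (simp only: diff_Suc_Suc) (simp add: algebra_simps)
      qed
    qed
    from has_vector_derivative_mult_left[OF has_vector_derivative_complex_of_real[OF this]]
    show "((\<lambda>w. complex_of_real (w ^ Suc k * clifford_moment k (\<kappa> * w * b)) * ?E b) has_vector_derivative
        complex_of_real (w ^ k * clifford (\<kappa> * w * b)) * ?E b) (at w within UNIV)" .
  next
    fix w :: real
    show "(\<lambda>b. complex_of_real (w ^ Suc k * clifford_moment k (\<kappa> * w * b)) * ?E b) integrable_on cbox 0 (real N)"
      by (intro integrable_continuous continuous_intros)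
  next
    show "continuous_on (UNIV \<times> cbox 0 (real N)) (\<lambda>(w, b). complex_of_real (w ^ k * clifford (\<kappa> * w * b)) * ?E b)"
      unfolding split_def by (intro continuous_intros)
  qed auto
  hence "((\<lambda>\<gamma>. integral (cbox 0 (real N)) (\<lambda>b. complex_of_real (\<gamma> ^ k * clifford (\<kappa> * \<gamma> * b)) * ?E b)) has_integral
     (integral (cbox 0 (real N)) (\<lambda>b. complex_of_real (w ^ Suc k * clifford_moment k (\<kappa> * w * b)) * ?E b)
       - integral (cbox 0 (real N)) (\<lambda>b. complex_of_real (0 ^ Suc k * clifford_moment k (\<kappa> * 0 * b)) * ?E b))) {0..w}"
    by (intro fundamental_theorem_of_calculus assms) (auto intro: has_vector_derivative_at_within)
  from integral_unique[OF this] show ?thesis by (simp add: mult.assoc)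
qed

end

text \<open>
  The second part is the domination that permits integrating the first over the parameter.
\<close>
lemma clifford_transform_tendsto:
  assumes \<kappa>: "0 < \<kappa>" and w: "0 < w" and \<omega>: "\<omega> = 2*pi*real j" and j: "1 \<le> j"
  shows "(\<lambda>N. integral {0..real N} (\<lambda>b. complex_of_real (clifford (\<kappa> * w * b)) * exp (b *\<^sub>R (- (\<i> * \<omega>)))))
     \<longlonglongrightarrow> exp (w *\<^sub>R (\<i> * (\<kappa> / \<omega>))) / (\<i> * \<omega>)"
  and "\<exists>B. \<forall>N. \<forall>\<gamma>\<in>{0..w}. norm (integral {0..real N} (\<lambda>b. complex_of_real (clifford (\<kappa> * \<gamma> * b)) * exp (b *\<^sub>R (- (\<i> * \<omega>))))) \<le> B"
proof -
  have \<omega>0: "0 < \<omega>" using \<omega> j by simp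
  have period: "exp (real N *\<^sub>R (- (\<i> * \<omega>))) = 1" for N
    unfolding exp_eq_1 by (intro conjI exI[of _ "- (int j * int N)"]) (simp_all add: \<omega>)
  let ?I = "\<lambda>N \<gamma>. exp (\<gamma> *\<^sub>R (- (\<i> * (\<kappa> / \<omega>)))) * complex_of_real (clifford (\<kappa> * \<gamma> * real N))"
  have ne: "norm (exp (\<gamma> *\<^sub>R (- (\<i> * (\<kappa> / \<omega>))))) = 1" "norm (exp (\<gamma> *\<^sub>R (\<i> * (\<kappa> / \<omega>)))) = 1" for \<gamma> :: real
    by (simp_all add: norm_exp_eq_Re)
  obtain B where B: "0 \<le> B" "\<And>y. 0 \<le> y \<Longrightarrow> \<bar>clifford y\<bar> \<le> B" using clifford_bounded by blast
  have PN: "(\<lambda>N. clifford (\<kappa> * \<gamma> * real N)) \<longlonglongrightarrow> 0" if "0 < \<gamma>" for \<gamma>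
    by (rule filterlim_compose[OF clifford_tendsto_0 filterlim_tendsto_pos_mult_at_top[OF tendsto_const _ filterlim_real_sequentially]])
       (use that \<kappa> in auto)
  have nI: "norm (?I N \<gamma>) \<le> B" if "0 \<le> \<gamma>" for N \<gamma>
    unfolding norm_mult ne using B(2)[of "\<kappa> * \<gamma> * real N"] that \<kappa> by simp
  have Ii: "?I N integrable_on {0..\<gamma>}" for N \<gamma> by (intro integrable_continuous_real continuous_intros)
  have "(\<lambda>N. integral {0..w} (?I N)) \<longlonglongrightarrow> integral {0..w} (\<lambda>\<gamma>. if \<gamma> = 0 then 1 else 0)"
  proof (rule dominated_convergence(2)[where h = "\<lambda>_. B"])
    fix \<gamma> assume \<gamma>: "\<gamma> \<in> {0..w}"
    \<comment> \<open>At \<open>\<gamma> = 0\<close> there is no decay in \<open>N\<close>, but a single point does not affect the integral.\<close>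
    show "(\<lambda>N. ?I N \<gamma>) \<longlonglongrightarrow> (if \<gamma> = 0 then 1 else 0)"
    proof (cases "\<gamma> = 0")
      case False
      hence "(\<lambda>N. ?I N \<gamma>) \<longlonglongrightarrow> exp (\<gamma> *\<^sub>R (- (\<i> * (\<kappa> / \<omega>)))) * complex_of_real 0"
        using \<gamma> by (intro tendsto_intros PN) auto
      thus ?thesis using False by simp
    qed (simp add: clifford_0)
  qed (use nI Ii in auto)
  moreover have "integral {0..w} (\<lambda>\<gamma>. if \<gamma> = 0 then 1 else 0 :: complex) = integral {0..w} (\<lambda>_. 0)"
    by (rule integral_spike[of "{0}"]) auto
  ultimately have I0: "(\<lambda>N. integral {0..w} (?I N)) \<longlonglongrightarrow> 0" by simp
  have "(\<lambda>N. exp (w *\<^sub>R (\<i> * (\<kappa> / \<omega>))) * (1 / (\<i> * \<omega>) - (\<kappa> / \<omega>\<^sup>2) * integral {0..w} (?I N)) - clifford (\<kappa> * w * real N) / (\<i> * \<omega>))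
    \<longlonglongrightarrow> exp (w *\<^sub>R (\<i> * (\<kappa> / \<omega>))) * (1 / (\<i> * \<omega>) - complex_of_real (\<kappa> / \<omega>\<^sup>2) * 0) - complex_of_real 0 / (\<i> * \<omega>)"
    using \<omega>0 by (intro tendsto_diff[OF tendsto_mult[OF tendsto_const tendsto_diff[OF tendsto_const tendsto_mult[OF tendsto_const I0]]]
        tendsto_divide[OF tendsto_of_real[OF PN[OF w]] tendsto_const]]) auto
  thus "(\<lambda>N. integral {0..real N} (\<lambda>b. complex_of_real (clifford (\<kappa> * w * b)) * exp (b *\<^sub>R (- (\<i> * \<omega>)))))
     \<longlonglongrightarrow> exp (w *\<^sub>R (\<i> * (\<kappa> / \<omega>))) / (\<i> * \<omega>)"
    using clifford_transform_finite[OF \<omega>0 period, where w = w and \<kappa> = \<kappa>] w by simp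
  have "norm (integral {0..real N} (\<lambda>b. complex_of_real (clifford (\<kappa> * \<gamma> * b)) * exp (b *\<^sub>R (- (\<i> * \<omega>)))))
      \<le> 1 / \<omega> + \<kappa> / \<omega>\<^sup>2 * (B * w) + B / \<omega>" if \<gamma>: "\<gamma> \<in> {0..w}" for N \<gamma>
  proof -
    have "norm (integral {0..\<gamma>} (?I N)) \<le> B * \<gamma>"
    proof -
      have "norm (integral {0..\<gamma>} (?I N)) \<le> integral {0..\<gamma>} (\<lambda>_. B)"
        by (rule integral_norm_bound_integral[OF Ii]) (use nI in auto)
      thus ?thesis using \<gamma> by (simp add: mult.commute)
    qed
    also have "\<dots> \<le> B * w" using \<gamma> B by (intro mult_left_mono) auto
    finally have i: "norm (integral {0..\<gamma>} (?I N)) \<le> B * w" .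
    have gen: "norm (x * (a - d) - c) \<le> norm x * (norm a + norm d) + norm c" for x a d c :: complex
      using norm_triangle_ineq4[of "x * (a - d)" c] mult_left_mono[OF norm_triangle_ineq4[of a d], of "norm x"]
      by (simp add: norm_mult)
    have "norm (exp (\<gamma> *\<^sub>R (\<i> * (\<kappa> / \<omega>))) * (1 / (\<i> * \<omega>) - (\<kappa> / \<omega>\<^sup>2) * integral {0..\<gamma>} (?I N)) - clifford (\<kappa> * \<gamma> * real N) / (\<i> * \<omega>))
      \<le> norm (exp (\<gamma> *\<^sub>R (\<i> * (\<kappa> / \<omega>)))) * (norm (1 / (\<i> * \<omega>)) + norm ((\<kappa> / \<omega>\<^sup>2) * integral {0..\<gamma>} (?I N))) + norm (clifford (\<kappa> * \<gamma> * real N) / (\<i> * \<omega>))"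
      by (rule gen)
    also have "\<dots> = 1 / \<omega> + \<kappa> / \<omega>\<^sup>2 * norm (integral {0..\<gamma>} (?I N)) + \<bar>clifford (\<kappa> * \<gamma> * real N)\<bar> / \<omega>"
      using \<omega>0 \<kappa> unfolding ne by (simp add: norm_mult norm_divide norm_power)
    also have "\<dots> \<le> 1 / \<omega> + \<kappa> / \<omega>\<^sup>2 * (B * w) + B / \<omega>"
      using i B(2)[of "\<kappa> * \<gamma> * real N"] \<gamma> \<kappa> \<omega>0 by (intro add_mono mult_left_mono divide_right_mono) auto
    finally show ?thesis using clifford_transform_finite[OF \<omega>0 period, where w = \<gamma> and \<kappa> = \<kappa>] \<gamma> by simp
  qed
  thus "\<exists>B. \<forall>N. \<forall>\<gamma>\<in>{0..w}. norm (integral {0..real N} (\<lambda>b. complex_of_real (clifford (\<kappa> * \<gamma> * b)) * exp (b *\<^sub>R (- (\<i> * \<omega>))))) \<le> B"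
    by blast
qed

text \<open>
  The limit in \<open>clifford_transform_tendsto\<close> is integrated over \<open>\<gamma>\<close> and the real part of
  the product with \<open>exp(\<i>\<omega>\<theta>)\<close> is taken.
\<close>
lemma clifford_moment_cos_transform:
  assumes \<kappa>: "0 < \<kappa>" and w: "0 < w" and j: "1 \<le> j"
  shows "(\<lambda>N. integral {0..real N} (\<lambda>b. clifford_moment k (\<kappa> * w * b) * cos (2*pi*real j * (b - \<theta>))))
     \<longlonglongrightarrow> integral {0..w} (\<lambda>\<gamma>. \<gamma> ^ k * sin (2*pi*real j * \<theta> + \<kappa> * \<gamma> / (2*pi*real j))) / (2*pi*real j * w ^ Suc k)"
proof -
  define \<omega> where "\<omega> = 2*pi*real j"
  have \<omega>0: "0 < \<omega>" using \<omega>_def j by simp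
  have period: "exp (real N *\<^sub>R (- (\<i> * \<omega>))) = 1" for N
    unfolding exp_eq_1 by (intro conjI exI[of _ "- (int j * int N)"]) (simp_all add: \<omega>_def)
  let ?Y = "\<lambda>N \<gamma>. integral {0..real N} (\<lambda>b. complex_of_real (clifford (\<kappa> * \<gamma> * b)) * exp (b *\<^sub>R (- (\<i> * \<omega>))))"
  let ?W = "\<lambda>N. integral {0..real N} (\<lambda>b. complex_of_real (clifford_moment k (\<kappa> * w * b)) * exp (b *\<^sub>R (- (\<i> * \<omega>))))"
  let ?L = "\<lambda>\<gamma>. \<gamma> ^ k * (exp (\<gamma> *\<^sub>R (\<i> * (\<kappa> / \<omega>))) / (\<i> * \<omega>))"
  have e1: "exp (t *\<^sub>R (\<i> * complex_of_real r)) = cis (t * r)" "exp (t *\<^sub>R (- (\<i> * complex_of_real r))) = cis (- (t * r))" for t r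
    by (simp_all add: cis_conv_exp scaleR_conv_of_real mult_ac)
  obtain B where B: "\<And>N \<gamma>. \<gamma> \<in> {0..w} \<Longrightarrow> norm (?Y N \<gamma>) \<le> B"
    using clifford_transform_tendsto(2)[OF \<kappa> w \<omega>_def j] by blast
  have "(\<lambda>N. integral {0..w} (\<lambda>\<gamma>. \<gamma> ^ k * ?Y N \<gamma>)) \<longlonglongrightarrow> integral {0..w} (\<lambda>\<gamma>. if \<gamma> = 0 then 0 else ?L \<gamma>)"
  proof (rule dominated_convergence(2)[where h = "\<lambda>_. w ^ k * B"])
    show "(\<lambda>\<gamma>. \<gamma> ^ k * ?Y N \<gamma>) integrable_on {0..w}" for N
    proof (intro integrable_continuous_real continuous_intros)
      show "continuous_on {0..w} (?Y N)"
        using clifford_transform_ode[OF \<omega>0 period, where \<kappa> = \<kappa>]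
        by (meson has_vector_derivative_continuous continuous_at_imp_continuous_on)
    qed
    fix \<gamma> assume \<gamma>: "\<gamma> \<in> {0..w}"
    show "norm (\<gamma> ^ k * ?Y N \<gamma>) \<le> w ^ k * B" for N
      unfolding norm_mult norm_power using \<gamma> by (intro mult_mono B) (auto simp: norm_power intro!: power_mono)
    show "(\<lambda>N. \<gamma> ^ k * ?Y N \<gamma>) \<longlonglongrightarrow> (if \<gamma> = 0 then 0 else ?L \<gamma>)"
    proof (cases "\<gamma> = 0")
      case True
      have Y0: "?Y N 0 = 0" for N
        using clifford_transform_finite[OF \<omega>0 period, where w = 0 and \<kappa> = \<kappa>] by (simp add: clifford_0)
      show ?thesis unfolding True Y0 by simp
    next
      case False
      thus ?thesis using \<gamma> by (simp only: if_False, intro tendsto_mult tendsto_const clifford_transform_tendsto(1)[OF \<kappa> _ \<omega>_def j]) auto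
    qed
  qed auto
  also have "integral {0..w} (\<lambda>\<gamma>. if \<gamma> = 0 then 0 else ?L \<gamma>) = integral {0..w} ?L"
    by (rule integral_spike[of "{0}"]) auto
  finally have lim: "(\<lambda>N. w ^ Suc k * ?W N) \<longlonglongrightarrow> integral {0..w} ?L"
    using clifford_moment_transform_finite[OF \<omega>0 period, where w = w and \<kappa> = \<kappa> and k = k] w by simp
  have "(\<lambda>N. Re (exp (\<theta> *\<^sub>R (\<i> * \<omega>)) * (w ^ Suc k * ?W N))) \<longlonglongrightarrow> Re (exp (\<theta> *\<^sub>R (\<i> * \<omega>)) * integral {0..w} ?L)"
    by (intro tendsto_Re tendsto_mult tendsto_const lim)
  moreover have "Re (exp (\<theta> *\<^sub>R (\<i> * \<omega>)) * (w ^ Suc k * ?W N)) =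
      w ^ Suc k * integral {0..real N} (\<lambda>b. clifford_moment k (\<kappa> * w * b) * cos (\<omega> * (b - \<theta>)))" for N
  proof -
    have "((\<lambda>b. complex_of_real (clifford_moment k (\<kappa> * w * b)) * exp (b *\<^sub>R (- (\<i> * \<omega>)))) has_integral ?W N) {0..real N}"
      by (intro integrable_integral integrable_continuous_real continuous_intros)
    from has_integral_linear[OF has_integral_mult_right[OF this, of "exp (\<theta> *\<^sub>R (\<i> * \<omega>))"] bounded_linear_Re]
    have "((\<lambda>b. Re (exp (\<theta> *\<^sub>R (\<i> * \<omega>)) * (complex_of_real (clifford_moment k (\<kappa> * w * b)) * exp (b *\<^sub>R (- (\<i> * \<omega>)))))) has_integral
        Re (exp (\<theta> *\<^sub>R (\<i> * \<omega>)) * ?W N)) {0..real N}" by (simp add: o_def)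
    moreover have "Re (exp (\<theta> *\<^sub>R (\<i> * \<omega>)) * (complex_of_real (clifford_moment k (\<kappa> * w * b)) * exp (b *\<^sub>R (- (\<i> * \<omega>))))) =
        clifford_moment k (\<kappa> * w * b) * cos (\<omega> * (b - \<theta>))" for b
      unfolding e1 by (simp add: cos_diff algebra_simps)
    ultimately have "((\<lambda>b. clifford_moment k (\<kappa> * w * b) * cos (\<omega> * (b - \<theta>))) has_integral Re (exp (\<theta> *\<^sub>R (\<i> * \<omega>)) * ?W N)) {0..real N}"
      by (simp only:)
    note I = integral_unique[OF this]
    have gen: "Re (e * (complex_of_real r * W)) = r * Re (e * W)" for e r W by (simp add: algebra_simps)
    show ?thesis unfolding of_real_power[symmetric] gen I ..
  qed
  moreover have "Re (exp (\<theta> *\<^sub>R (\<i> * \<omega>)) * integral {0..w} ?L) = integral {0..w} (\<lambda>\<gamma>. \<gamma> ^ k * sin (\<omega> * \<theta> + \<kappa> * \<gamma> / \<omega>)) / \<omega>"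
  proof -
    have "(?L has_integral integral {0..w} ?L) {0..w}"
      using \<omega>0 by (intro integrable_integral integrable_continuous_real continuous_intros) auto
    from has_integral_linear[OF has_integral_mult_right[OF this, of "exp (\<theta> *\<^sub>R (\<i> * \<omega>))"] bounded_linear_Re]
    have "((\<lambda>\<gamma>. Re (exp (\<theta> *\<^sub>R (\<i> * \<omega>)) * ?L \<gamma>)) has_integral Re (exp (\<theta> *\<^sub>R (\<i> * \<omega>)) * integral {0..w} ?L)) {0..w}"
      by (simp add: o_def)
    moreover have "Re (exp (\<theta> *\<^sub>R (\<i> * \<omega>)) * ?L \<gamma>) = \<gamma> ^ k * sin (\<omega> * \<theta> + \<kappa> * \<gamma> / \<omega>) / \<omega>" for \<gamma>
    proof -
      have e2: "exp (\<gamma> *\<^sub>R (\<i> * (\<kappa> / \<omega>))) / (\<i> * \<omega>) = Complex (sin (\<gamma> * (\<kappa> / \<omega>)) / \<omega>) (- cos (\<gamma> * (\<kappa> / \<omega>)) / \<omega>)"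
        unfolding e1 using \<omega>0 by (simp add: complex_eq_iff Re_divide Im_divide power2_eq_square)
      have arg: "\<omega> * \<theta> + \<kappa> * \<gamma> / \<omega> = \<theta> * \<omega> + \<gamma> * (\<kappa> / \<omega>)" by simp
      show ?thesis unfolding e2 arg sin_add unfolding e1
        by (simp add: add_divide_distrib algebra_simps flip: of_real_power)
    qed
    ultimately have "((\<lambda>\<gamma>. \<gamma> ^ k * sin (\<omega> * \<theta> + \<kappa> * \<gamma> / \<omega>) / \<omega>) has_integral Re (exp (\<theta> *\<^sub>R (\<i> * \<omega>)) * integral {0..w} ?L)) {0..w}"
      by (simp only:)
    from integral_unique[OF this] show ?thesis by simp
  qed
  ultimately have "(\<lambda>N. w ^ Suc k * integral {0..real N} (\<lambda>b. clifford_moment k (\<kappa> * w * b) * cos (\<omega> * (b - \<theta>)))) \<longlonglongrightarrow>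
      integral {0..w} (\<lambda>\<gamma>. \<gamma> ^ k * sin (\<omega> * \<theta> + \<kappa> * \<gamma> / \<omega>)) / \<omega>" by (simp only:)
  from tendsto_divide[OF this tendsto_const[of "w ^ Suc k"]] show ?thesis
    using w unfolding \<omega>_def by (simp add: mult_ac)
qed

section \<open>An oscillatory integral with a floor function in the phase\<close>

text \<open>
  A shift changes the integral only through the two ends of the interval.
\<close>
lemma shift_integral_diff_bound:
  fixes F :: "real \<Rightarrow> complex"
  assumes F: "F integrable_on {a..b + \<delta>}" and B: "\<And>v. v \<in> {a..b + \<delta>} \<Longrightarrow> norm (F v) \<le> B"
    and d: "0 \<le> \<delta>" "a + \<delta> \<le> b"
  shows "norm (integral {a..b} F - integral {a..b} (\<lambda>v. F (v + \<delta>))) \<le> 2 * B * \<delta>"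
proof -
  have i: "F integrable_on {c..e}" if "a \<le> c" "e \<le> b + \<delta>" for c e
    using F by (rule integrable_on_subinterval) (use that in auto)
  have s: "integral {a..b} (\<lambda>v. F (v + \<delta>)) = integral {a+\<delta>..b+\<delta>} F"
    using integral_shift_real_ivl[of "a+\<delta>" \<delta> "b+\<delta>" F] by simp
  have 1: "integral {a..a+\<delta>} F + integral {a+\<delta>..b} F = integral {a..b} F"
    using d by (intro Henstock_Kurzweil_Integration.integral_combine i) auto
  have 2: "integral {a+\<delta>..b} F + integral {b..b+\<delta>} F = integral {a+\<delta>..b+\<delta>} F"
    using d by (intro Henstock_Kurzweil_Integration.integral_combine i) auto
  have nb: "norm (integral {c..c+\<delta>} F) \<le> B * \<delta>" if "a \<le> c" "c \<le> b" for c
  proof -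
    have "norm (integral {c..c+\<delta>} F) \<le> integral {c..c+\<delta>} (\<lambda>_. B)"
      by (rule integral_norm_bound_integral[OF i]) (use that d B in auto)
    thus ?thesis using d by (simp add: mult.commute)
  qed
  have "integral {a..b} F - integral {a..b} (\<lambda>v. F (v + \<delta>)) = integral {a..a+\<delta>} F - integral {b..b+\<delta>} F"
    unfolding s 1[symmetric] 2[symmetric] by simp
  also have "norm \<dots> \<le> B * \<delta> + B * \<delta>"
    by (intro order_trans[OF norm_triangle_ineq4] add_mono nb) (use d in auto)
  finally show ?thesis by simp
qed

lemma floor_phase_shift: "cis (\<theta> * real_of_int \<lfloor>T * (v + real i / T)\<rfloor>) = cis (\<theta> * real i) * cis (\<theta> * real_of_int \<lfloor>T * v\<rfloor>)" if "0 < T"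
proof -
  have "T * (v + real i / T) = T * v + real_of_int (int i)" using that by (simp add: distrib_left)
  hence "\<lfloor>T * (v + real i / T)\<rfloor> = \<lfloor>T * v\<rfloor> + int i" by (simp only: floor_add_int)
  thus ?thesis by (simp add: cis_mult distrib_left add.commute)
qed

lemma cis_diff_bound: "norm (cis a - cis b) \<le> \<bar>a - b\<bar>"
proof -
  have "cis a - cis b = cis b * (cis (a - b) - 1)" by (simp add: algebra_simps cis_mult)
  hence "norm (cis a - cis b) = norm (cis (a - b) - 1)" by (simp add: norm_mult)
  also have "\<dots> = norm (exp (\<i> * complex_of_real (a - b)) - 1)" by (simp add: cis_conv_exp)
  also have "\<dots> \<le> \<bar>a - b\<bar>"
  proof -
    have "(norm (cis (a-b) - 1))\<^sup>2 = 2 - 2 * cos (a - b)"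
      by (simp add: cmod_power2 power2_diff sin_squared_eq)
    also have "\<dots> = (2 * sin ((a-b)/2))\<^sup>2"
    proof -
      have h: "2 * ((a-b)/2) = a - b" by simp
      show ?thesis using cos_double_sin[of "(a-b)/2"] unfolding h by (simp add: power2_eq_square)
    qed
    also have "\<dots> \<le> (a-b)\<^sup>2"
      unfolding abs_le_square_iff[symmetric] using abs_sin_x_le_abs_x[of "(a-b)/2"] by (simp add: abs_mult)
    finally show ?thesis by (simp add: cis_conv_exp abs_le_square_iff[symmetric])
  qed
  finally show ?thesis .
qed

text \<open>
  Taylor expansion in the shift: \<open>T/(v+\<delta>) = T/v - i/v\<^sup>2 + O(1/T)\<close> for \<open>\<delta> = i/T\<close>.  The shift
  is just large enough for the linear term to survive as \<open>T\<close> grows.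
\<close>
lemma phase_linearization:
  fixes T v \<delta> \<eta> \<epsilon> :: real
  assumes "0 < \<epsilon>" "\<epsilon> \<le> v" "0 < T" "\<delta> = real i / T" "\<bar>\<eta>\<bar> = 1"
  shows "norm (cis (\<eta> * (T / (v + \<delta>))) / complex_of_real (v + \<delta>) - cis (\<eta> * (T / v)) * cis (- \<eta> * real i / v\<^sup>2) / complex_of_real v)
     \<le> (real i / \<epsilon>\<^sup>2 + (real i)\<^sup>2 / \<epsilon>^4) / T"
proof -
  have d0: "0 \<le> \<delta>" using assms by simp
  have v0: "0 < v" using assms by simp
  let ?A = "cis (\<eta> * (T / (v + \<delta>)))" and ?B = "cis (\<eta> * (T / v) + (- \<eta> * real i / v\<^sup>2))"
  have e: "?A / complex_of_real (v + \<delta>) - ?B / complex_of_real v =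
     ?A * complex_of_real (1 / (v + \<delta>) - 1 / v) + (?A - ?B) * complex_of_real (1 / v)"
    using v0 d0 by (simp add: divide_inverse algebra_simps)
  have n1: "norm (?A * complex_of_real (1 / (v + \<delta>) - 1 / v)) \<le> (real i / \<epsilon>\<^sup>2) / T"
  proof -
    have d: "1 / (v + \<delta>) - 1 / v = - (\<delta> / ((v + \<delta>) * v))" using v0 d0 by (simp add: field_simps)
    have "norm (?A * complex_of_real (1 / (v + \<delta>) - 1 / v)) = \<bar>- (\<delta> / ((v + \<delta>) * v))\<bar>"
      unfolding norm_mult norm_cis norm_of_real d by simp
    also have "\<dots> = \<delta> / ((v + \<delta>) * v)" using v0 d0 by simp
    also have "\<dots> \<le> \<delta> / (\<epsilon> * \<epsilon>)" using assms(1,2) d0 v0 by (intro divide_left_mono mult_mono mult_pos_pos) auto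
    also have "\<dots> = (real i / \<epsilon>\<^sup>2) / T" by (simp add: assms(4) power2_eq_square)
    finally show ?thesis .
  qed
  have n2: "norm ((?A - ?B) * complex_of_real (1 / v)) \<le> ((real i)\<^sup>2 / \<epsilon>^4) / T"
  proof -
    have T: "T * \<delta> = real i" using assms by simp
    have "\<eta> * (T / (v + \<delta>)) - (\<eta> * (T / v) + (- \<eta> * real i / v\<^sup>2)) = \<eta> * (T * \<delta> * \<delta> / (v\<^sup>2 * (v + \<delta>)))"
      unfolding T[symmetric] using v0 d0 by (simp add: field_simps power2_eq_square)
    also have "\<bar>\<dots>\<bar> = real i * \<delta> / (v\<^sup>2 * (v + \<delta>))" unfolding T using assms v0 d0 by (simp add: abs_mult)
    finally have "norm (?A - ?B) \<le> real i * \<delta> / (v\<^sup>2 * (v + \<delta>))" using cis_diff_bound by metis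
    also have "\<dots> \<le> real i * \<delta> / (\<epsilon>\<^sup>2 * \<epsilon>)" using assms(1,2) d0 v0 by (intro divide_left_mono mult_mono mult_pos_pos power_mono) auto
    finally have "norm (?A - ?B) \<le> real i * \<delta> / \<epsilon>^3" by (simp add: power2_eq_square power3_eq_cube)
    moreover have "1 / v \<le> 1 / \<epsilon>" using assms by (intro divide_left_mono) auto
    ultimately have "norm (?A - ?B) * (1 / v) \<le> real i * \<delta> / \<epsilon>^3 * (1 / \<epsilon>)" using v0 d0 assms(1) by (intro mult_mono) auto
    also have "\<dots> = ((real i)\<^sup>2 / \<epsilon>^4) / T" using assms by (simp add: power2_eq_square power4_eq_xxxx power3_eq_cube)
    finally show ?thesis using v0 by (simp add: norm_mult norm_divide)
  qed
  have "norm (?A / complex_of_real (v + \<delta>) - ?B / complex_of_real v) \<le> (real i / \<epsilon>\<^sup>2) / T + ((real i)\<^sup>2 / \<epsilon>^4) / T"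
    unfolding e by (intro order_trans[OF norm_triangle_ineq] add_mono n1 n2)
  thus ?thesis by (simp add: cis_mult add_divide_distrib)
qed

text \<open>
  The factor by which a shift of \<open>v\<close> by \<open>1/T\<close> multiplies \<open>osc\<close>, to leading order.  Cancellation
  fails where it equals 1: there the phases of the floor and of \<open>T/v\<close> are in resonance.
\<close>
definition resonance :: "real \<Rightarrow> real \<Rightarrow> real \<Rightarrow> complex" where
  "resonance \<theta> \<eta> v = cis (\<theta> - \<eta> / v\<^sup>2)"

text \<open>
  The sign \<open>\<eta> = \<plusminus>1\<close> selects one of the two exponentials in \<open>sin (T / v)\<close>.
\<close>
definition osc :: "real \<Rightarrow> real \<Rightarrow> real \<Rightarrow> real \<Rightarrow> complex" where
  "osc \<theta> \<eta> T v = cis (\<theta> * real_of_int \<lfloor>T * v\<rfloor>) * (cis (\<eta> * (T / v)) / complex_of_real v)"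

lemma osc_integrable:
  assumes "0 < a" and c: "continuous_on {a..b} c"
  shows "(\<lambda>v. osc \<theta> \<eta> T v * c v) integrable_on {a..b}"
proof -
  obtain B where B: "\<forall>v\<in>{a..b}. norm (c v) \<le> B"
    using compact_imp_bounded[OF compact_continuous_image[OF c]] by (auto simp: bounded_iff)
  have cm: "cis \<in> borel_measurable borel"
    by (intro borel_measurable_continuous_onI) (auto intro!: continuous_intros)
  show ?thesis
  proof (rule bounded_measurable_integrable[where B = "1 / a * \<bar>B\<bar>"])
    have [measurable]: "c \<in> borel_measurable (lebesgue_on {a..b})"
      using c by (intro continuous_imp_measurable_on_sets_lebesgue) auto
    have 1: "(\<lambda>v. \<theta> * real_of_int \<lfloor>T * v\<rfloor>) \<in> borel_measurable (borel :: real measure)" by measurable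
    have 2: "(\<lambda>v. \<eta> * (T / v)) \<in> borel_measurable (borel :: real measure)" by measurable
    have 3: "(\<lambda>v. complex_of_real v) \<in> borel_measurable borel"
      by (intro borel_measurable_continuous_onI continuous_intros)
    have "(\<lambda>v. osc \<theta> \<eta> T v) \<in> borel_measurable (lebesgue_on {a..b})"
      unfolding osc_def
      by (rule borel_measurable_imp_lebesgue_on)
         (intro borel_measurable_times borel_measurable_divide measurable_compose[OF 1 cm] measurable_compose[OF 2 cm] 3)
    thus "(\<lambda>v. osc \<theta> \<eta> T v * c v) \<in> borel_measurable (lebesgue_on {a..b})" by simp
    fix v assume v: "v \<in> {a..b}"
    have "norm (osc \<theta> \<eta> T v) = 1 / v" using v assms(1) by (simp add: osc_def norm_mult norm_divide)
    also have "\<dots> \<le> 1 / a" using v assms(1) by (intro divide_left_mono) auto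
    finally show "norm (osc \<theta> \<eta> T v * c v) \<le> 1 / a * \<bar>B\<bar>"
      unfolding norm_mult using B v assms(1) by (intro mult_mono) (auto intro: order_trans[OF _ abs_ge_self])
  qed
qed

lemma norm_osc: "0 < v \<Longrightarrow> norm (osc \<theta> \<eta> T v) = 1 / v"
  by (simp add: osc_def norm_mult norm_divide)

text \<open>
  Shifting by \<open>i/T\<close> changes the integral little, and it multiplies the integrand by
  \<open>resonance ^ i\<close> up to \<open>O(1/T)\<close>.
\<close>
lemma osc_shift_bound:
  assumes e: "0 < \<epsilon>" "\<epsilon> + real i / T \<le> K" and T: "0 < T" and \<eta>: "\<bar>\<eta>\<bar> = 1"
  shows "norm (integral {\<epsilon>..K} (osc \<theta> \<eta> T) - integral {\<epsilon>..K} (\<lambda>v. osc \<theta> \<eta> T v * resonance \<theta> \<eta> v ^ i))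
     \<le> (2 * real i / \<epsilon> + (real i / \<epsilon>\<^sup>2 + (real i)\<^sup>2 / \<epsilon>^4) * (K - \<epsilon>)) / T"
proof -
  define \<delta> where "\<delta> = real i / T"
  have d0: "0 \<le> \<delta>" using T by (simp add: \<delta>_def)
  have eK: "\<epsilon> \<le> K" using e d0 \<delta>_def by linarith
  have int: "osc \<theta> \<eta> T integrable_on {\<epsilon>..b}" for b
    using osc_integrable[of \<epsilon> b "\<lambda>_. 1"] e by simp
  have 1: "norm (integral {\<epsilon>..K} (osc \<theta> \<eta> T) - integral {\<epsilon>..K} (\<lambda>v. osc \<theta> \<eta> T (v + \<delta>))) \<le> 2 * (1 / \<epsilon>) * \<delta>"
  proof (rule shift_integral_diff_bound[OF int])
    fix v assume "v \<in> {\<epsilon>..K + \<delta>}"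
    thus "norm (osc \<theta> \<eta> T v) \<le> 1 / \<epsilon>" using e by (subst norm_osc) (auto intro!: divide_left_mono)
  qed (use d0 e \<delta>_def in auto)
  have i1: "(\<lambda>v. osc \<theta> \<eta> T (v + \<delta>)) integrable_on {\<epsilon>..K}"
  proof -
    have "osc \<theta> \<eta> T integrable_on {\<epsilon>+\<delta>..K+\<delta>}"
      using int[of "K + \<delta>"] by (rule integrable_on_subinterval) (use d0 in auto)
    thus ?thesis using has_integral_shift_real_ivl_iff[of "osc \<theta> \<eta> T" _ "\<epsilon>" "\<delta>" "K"]
      by (metis add_diff_cancel_right' has_integral_integrable_integral has_integral_shift_real_ivl)
  qed
  have i2: "(\<lambda>v. osc \<theta> \<eta> T v * resonance \<theta> \<eta> v ^ i) integrable_on {\<epsilon>..K}"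
    unfolding resonance_def using e by (intro osc_integrable continuous_intros) auto
  have "norm (integral {\<epsilon>..K} (\<lambda>v. osc \<theta> \<eta> T (v + \<delta>) - osc \<theta> \<eta> T v * resonance \<theta> \<eta> v ^ i))
     \<le> integral {\<epsilon>..K} (\<lambda>_. (real i / \<epsilon>\<^sup>2 + (real i)\<^sup>2 / \<epsilon>^4) / T)"
  proof (rule integral_norm_bound_integral[OF integrable_diff[OF i1 i2]])
    fix v assume v: "v \<in> {\<epsilon>..K}"
    have r: "resonance \<theta> \<eta> v ^ i = cis (\<theta> * real i) * cis (- \<eta> * real i / v\<^sup>2)"
      unfolding resonance_def Complex.DeMoivre cis_mult
      by (rule arg_cong[where f = cis]) (simp add: algebra_simps diff_divide_distrib)
    have f: "cis (\<theta> * real_of_int \<lfloor>T * (v + \<delta>)\<rfloor>) = cis (\<theta> * real i) * cis (\<theta> * real_of_int \<lfloor>T * v\<rfloor>)"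
      unfolding \<delta>_def by (rule floor_phase_shift[OF T])
    have alg: "a * f * p - f * (y / z) * (a * c) = a * f * (p - y * c / z)" for a f p y z c :: complex
      by (simp add: algebra_simps)
    have "osc \<theta> \<eta> T (v + \<delta>) - osc \<theta> \<eta> T v * resonance \<theta> \<eta> v ^ i =
       cis (\<theta> * real i) * cis (\<theta> * real_of_int \<lfloor>T * v\<rfloor>) *
       (cis (\<eta> * (T / (v + \<delta>))) / complex_of_real (v + \<delta>) - cis (\<eta> * (T / v)) * cis (- \<eta> * real i / v\<^sup>2) / complex_of_real v)"
      unfolding osc_def r f by (rule alg)
    also have "norm \<dots> \<le> (real i / \<epsilon>\<^sup>2 + (real i)\<^sup>2 / \<epsilon>^4) / T"
      unfolding norm_mult norm_cis using phase_linearization[OF e(1) _ T \<delta>_def \<eta>, of v] v by simp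
    finally show "norm (osc \<theta> \<eta> T (v + \<delta>) - osc \<theta> \<eta> T v * resonance \<theta> \<eta> v ^ i) \<le> (real i / \<epsilon>\<^sup>2 + (real i)\<^sup>2 / \<epsilon>^4) / T" .
  qed auto
  hence 2: "norm (integral {\<epsilon>..K} (\<lambda>v. osc \<theta> \<eta> T (v + \<delta>)) - integral {\<epsilon>..K} (\<lambda>v. osc \<theta> \<eta> T v * resonance \<theta> \<eta> v ^ i))
     \<le> (K - \<epsilon>) * ((real i / \<epsilon>\<^sup>2 + (real i)\<^sup>2 / \<epsilon>^4) / T)"
    using eK by (simp add: Henstock_Kurzweil_Integration.integral_diff[OF i1 i2])
  have "norm (integral {\<epsilon>..K} (osc \<theta> \<eta> T) - integral {\<epsilon>..K} (\<lambda>v. osc \<theta> \<eta> T v * resonance \<theta> \<eta> v ^ i)) \<le>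
    2 * (1 / \<epsilon>) * \<delta> + (K - \<epsilon>) * ((real i / \<epsilon>\<^sup>2 + (real i)\<^sup>2 / \<epsilon>^4) / T)"
    using norm_triangle_le[OF add_mono[OF 1 2]] by simp
  also have "\<dots> = (2 * real i / \<epsilon> + (real i / \<epsilon>\<^sup>2 + (real i)\<^sup>2 / \<epsilon>^4) * (K - \<epsilon>)) / T"
  proof -
    have alg: "2 * (1 / e) * (n / t) + k * (X / t) = (2 * n / e + X * k) / t" for e n t k X :: real
      by (simp add: add_divide_distrib mult.commute)
    show ?thesis unfolding \<delta>_def by (rule alg)
  qed
  finally show ?thesis .
qed

definition resonance_mean :: "real \<Rightarrow> real \<Rightarrow> nat \<Rightarrow> real \<Rightarrow> complex" where
  "resonance_mean \<theta> \<eta> H v = (\<Sum>i<H. resonance \<theta> \<eta> v ^ i) / of_nat H"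

text \<open>
  A bounded geometric sum divided by \<open>H\<close>.
\<close>
lemma resonance_mean_tendsto_0:
  assumes "resonance \<theta> \<eta> v \<noteq> 1"
  shows "(\<lambda>H. resonance_mean \<theta> \<eta> H v) \<longlonglongrightarrow> 0"
proof -
  let ?r = "resonance \<theta> \<eta> v"
  have n: "norm ?r = 1" by (simp add: resonance_def)
  have bnd: "norm (resonance_mean \<theta> \<eta> H v) \<le> (2 / norm (?r - 1)) * (1 / real H)" for H
  proof -
    have "norm (\<Sum>i<H. ?r ^ i) = norm (?r ^ H - 1) / norm (?r - 1)"
      using geometric_sum[OF assms, of H] by (simp add: norm_divide)
    also have "\<dots> \<le> 2 / norm (?r - 1)"
      using norm_triangle_ineq4[of "?r ^ H" 1] n by (intro divide_right_mono) (auto simp: norm_power)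
    finally show ?thesis unfolding resonance_mean_def norm_divide
      using divide_right_mono[of "norm (\<Sum>i<H. ?r ^ i)" "2 / norm (?r - 1)" "real H"] by simp
  qed
  have lim: "(\<lambda>H. (2 / norm (?r - 1)) * (1 / real H)) \<longlonglongrightarrow> 0"
    by (intro tendsto_mult_right_zero lim_1_over_n)
  show ?thesis by (rule Lim_null_comparison[OF always_eventually[OF allI[OF bnd]] lim])
qed

lemma norm_resonance_mean_le: "norm (resonance_mean \<theta> \<eta> H v) \<le> 1"
proof -
  have "norm (\<Sum>i<H. resonance \<theta> \<eta> v ^ i) \<le> (\<Sum>i<H. 1)"
    by (intro order_trans[OF norm_sum] sum_mono) (simp add: norm_power resonance_def)
  thus ?thesis unfolding resonance_mean_def by (cases "H = 0") (simp_all add: norm_divide divide_simps)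
qed

lemma resonance_points_negligible:
  assumes \<eta>: "\<eta> \<noteq> 0"
  shows "negligible {v. 0 < v \<and> resonance \<theta> \<eta> v = 1}"
proof -
  let ?f = "\<lambda>n::int. sqrt (\<eta> / (\<theta> - 2 * pi * real_of_int n))"
  have sub: "{v. 0 < v \<and> resonance \<theta> \<eta> v = 1} \<subseteq> range ?f"
  proof
    fix v assume "v \<in> {v. 0 < v \<and> resonance \<theta> \<eta> v = 1}"
    hence "0 < v \<and> resonance \<theta> \<eta> v = 1" by (simp only: mem_Collect_eq)
    hence v: "0 < v" "cis (\<theta> - \<eta> / v\<^sup>2) = 1" by (simp_all only: resonance_def)
    have "cos (\<theta> - \<eta> / v\<^sup>2) = 1" using arg_cong[OF v(2), of Re] by (simp only: cis.sel one_complex.sel)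
    then obtain n :: int where n: "\<theta> - \<eta> / v\<^sup>2 = real_of_int n * 2 * pi" using cos_one_2pi_int by blast
    define D where "D = \<theta> - 2 * pi * real_of_int n"
    have "\<eta> = D * v\<^sup>2" using n v unfolding D_def by (simp add: field_simps)
    moreover from this have "D \<noteq> 0" using \<eta> by auto
    ultimately have "v\<^sup>2 = \<eta> / (\<theta> - 2 * pi * real_of_int n)" unfolding D_def by simp
    moreover have "v = sqrt (v\<^sup>2)" using v(1) by simp
    ultimately have "v = ?f n" by (simp only:)
    thus "v \<in> range ?f" by blast
  qed
  have "negligible (\<Union>n. {?f n})" by (intro negligible_countable_Union) auto
  thus ?thesis by (rule negligible_subset) (use sub in auto)
qed

text \<open>
  The integral is nearly unchanged when \<open>osc\<close> is multiplied by \<open>resonance ^ i\<close>, hence also when it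
  is multiplied by the mean of these powers over \<open>i < H\<close>.  This mean is small in \<open>L\<^sup>1\<close> for large
  \<open>H\<close> by dominated convergence; \<open>H\<close> is fixed before \<open>T\<close> tends to infinity.
\<close>
lemma oscillatory_middle_tendsto_0:
  assumes e: "0 < \<epsilon>" "\<epsilon> < K" and \<eta>: "\<bar>\<eta>\<bar> = 1"
  shows "((\<lambda>T. integral {\<epsilon>..K} (osc \<theta> \<eta> T)) \<longlongrightarrow> 0) at_top"
proof -
  have mc: "continuous_on {\<epsilon>..K} (resonance_mean \<theta> \<eta> H)" for H
  proof (cases "H = 0")
    case False
    have "continuous_on {\<epsilon>..K} (\<lambda>v. resonance \<theta> \<eta> v)"
      unfolding resonance_def using e by (intro continuous_intros) auto
    thus ?thesis unfolding resonance_mean_def[abs_def] using False by (intro continuous_intros) auto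
  qed (simp add: resonance_mean_def[abs_def])
  have mi: "(\<lambda>v. norm (resonance_mean \<theta> \<eta> H v) / v) integrable_on {\<epsilon>..K}" for H
    using e by (intro integrable_continuous_real continuous_intros mc) auto
  have lim: "(\<lambda>H. integral {\<epsilon>..K} (\<lambda>v. norm (resonance_mean \<theta> \<eta> H v) / v)) \<longlonglongrightarrow> 0"
  proof -
    have conv: "(\<lambda>H. norm (resonance_mean \<theta> \<eta> H v) / v) \<longlonglongrightarrow> (if resonance \<theta> \<eta> v = 1 then 1 / v else 0)"
      if v: "v \<in> {\<epsilon>..K}" for v
    proof (cases "resonance \<theta> \<eta> v = 1")
      case True
      have "\<forall>\<^sub>F H in sequentially. norm (resonance_mean \<theta> \<eta> H v) / v = 1 / v"
        using eventually_ge_at_top[of "1::nat"] by eventually_elim (use True in \<open>simp add: resonance_mean_def\<close>)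
      thus ?thesis using True by (simp add: tendsto_eventually)
    next
      case False
      have "(\<lambda>H. norm (resonance_mean \<theta> \<eta> H v) / v) \<longlonglongrightarrow> norm (0::complex) / v"
        using v e by (intro tendsto_intros resonance_mean_tendsto_0 False) auto
      thus ?thesis using False by simp
    qed
    have "(\<lambda>H. integral {\<epsilon>..K} (\<lambda>v. norm (resonance_mean \<theta> \<eta> H v) / v)) \<longlonglongrightarrow> integral {\<epsilon>..K} (\<lambda>v. if resonance \<theta> \<eta> v = 1 then 1 / v else 0)"
    proof (rule dominated_convergence(2)[OF mi _ _ conv, where h = "\<lambda>_. 1 / \<epsilon>"])
      fix H v assume "v \<in> {\<epsilon>..K}"
      thus "norm (norm (resonance_mean \<theta> \<eta> H v) / v) \<le> 1 / \<epsilon>"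
        using e norm_resonance_mean_le[of \<theta> \<eta> H v] by (auto intro!: frac_le)
    qed auto
    also have "integral {\<epsilon>..K} (\<lambda>v. if resonance \<theta> \<eta> v = 1 then 1 / v else 0) = integral {\<epsilon>..K} (\<lambda>_. 0::real)"
    proof (rule integral_spike[of "{v. 0 < v \<and> resonance \<theta> \<eta> v = 1}"])
      show "negligible {v. 0 < v \<and> resonance \<theta> \<eta> v = 1}" by (rule resonance_points_negligible) (use \<eta> in auto)
    qed (use e in auto)
    finally show ?thesis by simp
  qed
  show ?thesis
  proof (rule tendstoI)
    fix r :: real assume r: "0 < r"
    hence "\<forall>\<^sub>F H in sequentially. integral {\<epsilon>..K} (\<lambda>v. norm (resonance_mean \<theta> \<eta> H v) / v) < r / 2"
      using order_tendstoD(2)[OF lim, of "r/2"] by simp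
    hence "\<forall>\<^sub>F H in sequentially. integral {\<epsilon>..K} (\<lambda>v. norm (resonance_mean \<theta> \<eta> H v) / v) < r / 2 \<and> 1 \<le> H"
      using eventually_ge_at_top[of "1::nat"] by eventually_elim auto
    then obtain H where H: "1 \<le> H" "integral {\<epsilon>..K} (\<lambda>v. norm (resonance_mean \<theta> \<eta> H v) / v) < r / 2"
      by (auto simp: eventually_sequentially)
    \<comment> \<open>The constant of \<open>osc_shift_bound\<close> for the largest shift, valid for all \<open>i < H\<close>.\<close>
    define C where "C = 2 * real H / \<epsilon> + (real H / \<epsilon>\<^sup>2 + (real H)\<^sup>2 / \<epsilon>^4) * (K - \<epsilon>)"
    have "((\<lambda>T. C / T) \<longlongrightarrow> 0) at_top" by (intro tendsto_divide_0[OF tendsto_const] filterlim_at_top_imp_at_infinity filterlim_ident)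
    hence "\<forall>\<^sub>F T in at_top. C / T < r / 2" using r by (intro order_tendstoD(2)) auto
    moreover have "\<forall>\<^sub>F T in at_top. max 1 (real H / (K - \<epsilon>)) \<le> T" by (rule eventually_ge_at_top)
    ultimately show "\<forall>\<^sub>F T in at_top. dist (integral {\<epsilon>..K} (osc \<theta> \<eta> T)) 0 < r"
    proof eventually_elim
      case (elim T)
      hence T: "0 < T" by simp
      have HT: "\<epsilon> + real H / T \<le> K" using elim T e by (simp add: field_simps)
      let ?I = "integral {\<epsilon>..K} (osc \<theta> \<eta> T)" and ?J = "\<lambda>i. integral {\<epsilon>..K} (\<lambda>v. osc \<theta> \<eta> T v * resonance \<theta> \<eta> v ^ i)"
      have Ji: "(\<lambda>v. osc \<theta> \<eta> T v * resonance \<theta> \<eta> v ^ i) integrable_on {\<epsilon>..K}" for i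
        unfolding resonance_def using e by (intro osc_integrable continuous_intros) auto
      have b: "norm (?I - ?J i) \<le> C / T" if "i < H" for i
      proof -
        have "real i / T \<le> real H / T" using that T by (intro divide_right_mono) auto
        hence "norm (?I - ?J i) \<le> (2 * real i / \<epsilon> + (real i / \<epsilon>\<^sup>2 + (real i)\<^sup>2 / \<epsilon>^4) * (K - \<epsilon>)) / T"
          using HT by (intro osc_shift_bound e T \<eta>) auto
        also have "\<dots> \<le> C / T" unfolding C_def using that T e
          by (intro divide_right_mono add_mono mult_right_mono mult_left_mono power_mono) auto
        finally show ?thesis .
      qed
      have "norm (of_nat H * ?I - (\<Sum>i<H. ?J i)) = norm (\<Sum>i<H. ?I - ?J i)" by (simp add: sum_subtractf)
      also have "\<dots> \<le> (\<Sum>i<H. C / T)" using b by (intro order_trans[OF norm_sum] sum_mono) auto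
      finally have 1: "norm (of_nat H * ?I - (\<Sum>i<H. ?J i)) \<le> real H * (C / T)" by simp
      have "(\<Sum>i<H. ?J i) = integral {\<epsilon>..K} (\<lambda>v. \<Sum>i<H. osc \<theta> \<eta> T v * resonance \<theta> \<eta> v ^ i)"
        by (rule integral_sum[symmetric]) (use Ji in auto)
      also have "norm \<dots> \<le> integral {\<epsilon>..K} (\<lambda>v. real H * (norm (resonance_mean \<theta> \<eta> H v) / v))"
      proof (rule integral_norm_bound_integral)
        show "(\<lambda>v. \<Sum>i<H. osc \<theta> \<eta> T v * resonance \<theta> \<eta> v ^ i) integrable_on {\<epsilon>..K}" by (intro integrable_sum Ji) auto
        show "(\<lambda>v. real H * (norm (resonance_mean \<theta> \<eta> H v) / v)) integrable_on {\<epsilon>..K}"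
          by (intro integrable_on_mult_right mi)
        fix v assume v: "v \<in> {\<epsilon>..K}"
        have "(\<Sum>i<H. osc \<theta> \<eta> T v * resonance \<theta> \<eta> v ^ i) = osc \<theta> \<eta> T v * (of_nat H * resonance_mean \<theta> \<eta> H v)"
          unfolding resonance_mean_def sum_distrib_left[symmetric] using H(1) by simp
        also have "norm \<dots> = real H * (norm (resonance_mean \<theta> \<eta> H v) / v)"
          using v e by (simp add: norm_mult norm_osc)
        finally show "norm (\<Sum>i<H. osc \<theta> \<eta> T v * resonance \<theta> \<eta> v ^ i) \<le> real H * (norm (resonance_mean \<theta> \<eta> H v) / v)" by simp
      qed
      also have "\<dots> = real H * integral {\<epsilon>..K} (\<lambda>v. norm (resonance_mean \<theta> \<eta> H v) / v)" by (rule integral_mult_right)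
      also have "\<dots> \<le> real H * (r / 2)" using H by (intro mult_left_mono) auto
      finally have 2: "norm (\<Sum>i<H. ?J i) \<le> real H * (r / 2)" .
      have "real H * norm ?I = norm ((of_nat H * ?I - (\<Sum>i<H. ?J i)) + (\<Sum>i<H. ?J i))" by (simp add: norm_mult)
      also have "\<dots> \<le> real H * (C / T) + real H * (r / 2)" by (intro order_trans[OF norm_triangle_ineq] add_mono 1 2)
      also have "\<dots> < real H * (r / 2) + real H * (r / 2)" using elim(1) H by (intro add_strict_right_mono mult_strict_left_mono) auto
      finally have "real H * norm ?I < real H * r" by (simp add: field_simps)
      thus ?case using H by simp
    qed
  qed
qed

definition osc_sin :: "real \<Rightarrow> real \<Rightarrow> real \<Rightarrow> complex" where
  "osc_sin \<theta> T v = cis (\<theta> * real_of_int \<lfloor>T * v\<rfloor>) * complex_of_real (sin (T / v) / v)"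

lemma osc_sin_eq: "osc_sin \<theta> T v = (osc \<theta> 1 T v - osc \<theta> (-1) T v) / (2 * \<i>)"
proof -
  have "complex_of_real (sin u) = (cis u - cis (- u)) / (2 * \<i>)" for u
    by (simp add: complex_eq_iff Re_divide Im_divide)
  note s = this
  have alg: "c * (((a - b) / d) / z) = (c * (a / z) - c * (b / z)) / d" for a b c d z :: complex
    by (simp add: algebra_simps diff_divide_distrib)
  show ?thesis unfolding osc_sin_def osc_def of_real_divide s mult_1_left mult_minus1 by (rule alg)
qed

lemma osc_integrable_plain: "0 < a \<Longrightarrow> osc \<theta> \<eta> T integrable_on {a..b}"
  using osc_integrable[of a b "\<lambda>_. 1"] by simp

lemma osc_sin_integrable: "0 < a \<Longrightarrow> osc_sin \<theta> T integrable_on {a..b}"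
  unfolding osc_sin_eq[abs_def] divide_inverse
  by (intro integrable_on_mult_left integrable_diff osc_integrable_plain)

lemma norm_osc_sin_le: "0 < v \<Longrightarrow> norm (osc_sin \<theta> T v) \<le> 1 / v"
  by (simp add: osc_sin_def norm_mult norm_divide divide_right_mono)

lemma osc_sin_middle_tendsto_0:
  assumes e: "0 < \<epsilon>" "\<epsilon> < K"
  shows "((\<lambda>T. integral {\<epsilon>..K} (osc_sin \<theta> T)) \<longlongrightarrow> 0) at_top"
proof -
  have "integral {\<epsilon>..K} (osc_sin \<theta> T) = (integral {\<epsilon>..K} (osc \<theta> 1 T) - integral {\<epsilon>..K} (osc \<theta> (-1) T)) * inverse (2 * \<i>)" for T
    unfolding osc_sin_eq[abs_def] divide_inverse
    by (simp only: integral_mult_left Henstock_Kurzweil_Integration.integral_diff[OF osc_integrable_plain[OF e(1)] osc_integrable_plain[OF e(1)]])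
  moreover have "((\<lambda>T. (integral {\<epsilon>..K} (osc \<theta> 1 T) - integral {\<epsilon>..K} (osc \<theta> (-1) T)) * inverse (2 * \<i>)) \<longlongrightarrow> (0 - 0) * inverse (2 * \<i>)) at_top"
    by (intro tendsto_mult tendsto_diff tendsto_const oscillatory_middle_tendsto_0 e) auto
  ultimately show ?thesis by simp
qed

text \<open>
  Integration by parts with \<open>(v/T cos(T/v))' = sin(T/v)/v + cos(T/v)/T\<close>.
\<close>
lemma sin_inverse_integral_bound:
  assumes "0 < p" "p \<le> q" "0 < T"
  shows "norm (integral {p..q} (\<lambda>v. complex_of_real (sin (T / v) / v))) \<le> 2 * q / T"
proof -
  have 1: "((\<lambda>v. cos (T / v) / T + sin (T / v) / v) has_integral (q / T * cos (T / q) - p / T * cos (T / p))) {p..q}"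
  proof (rule fundamental_theorem_of_calculus[OF assms(2)])
    fix v assume "v \<in> {p..q}"
    hence v: "0 < v" using assms by auto
    have "((\<lambda>v. v / T * cos (T / v)) has_real_derivative (cos (T / v) / T + sin (T / v) / v)) (at v)"
      using v assms by (auto intro!: derivative_eq_intros simp: field_simps power2_eq_square)
    thus "((\<lambda>v. v / T * cos (T / v)) has_vector_derivative (cos (T / v) / T + sin (T / v) / v)) (at v within {p..q})"
      by (auto intro: has_field_derivative_at_within simp flip: has_real_derivative_iff_has_vector_derivative)
  qed
  have c: "(\<lambda>v. cos (T / v) / T) integrable_on {p..q}" "(\<lambda>v. sin (T / v) / v) integrable_on {p..q}"
    using assms by (intro integrable_continuous_real continuous_intros; auto)+
  have gen1: "S = E - C" if "I = E" "I = C + S" for I E C S :: real using that by simp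
  have gen: "\<bar>S\<bar> \<le> a + b + c" if "S = A - B - C" "\<bar>C\<bar> \<le> c" "\<bar>A\<bar> \<le> a" "\<bar>B\<bar> \<le> b" for S A B C a b c :: real
    using that by linarith
  have "integral {p..q} (\<lambda>v. sin (T / v) / v) = (q / T * cos (T / q) - p / T * cos (T / p)) - integral {p..q} (\<lambda>v. cos (T / v) / T)"
    by (rule gen1[OF integral_unique[OF 1] Henstock_Kurzweil_Integration.integral_add[OF c]])
  moreover have "\<bar>integral {p..q} (\<lambda>v. cos (T / v) / T)\<bar> \<le> (q - p) / T"
  proof -
    have "norm (integral {p..q} (\<lambda>v. cos (T / v) / T)) \<le> integral {p..q} (\<lambda>_. 1 / T)"
      by (rule integral_norm_bound_integral[OF c(1)]) (use assms in \<open>auto simp: divide_right_mono\<close>)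
    thus ?thesis using assms by simp
  qed
  moreover have "\<bar>q / T * cos (T / q)\<bar> \<le> q / T" "\<bar>p / T * cos (T / p)\<bar> \<le> p / T"
    using assms by (simp_all add: abs_mult mult_left_le divide_right_mono)
  ultimately have "\<bar>integral {p..q} (\<lambda>v. sin (T / v) / v)\<bar> \<le> q / T + p / T + (q - p) / T" by (rule gen)
  also have "\<dots> = 2 * q / T" using assms by (simp add: field_simps)
  finally have r: "\<bar>integral {p..q} (\<lambda>v. sin (T / v) / v)\<bar> \<le> 2 * q / T" .
  have "integral {p..q} (\<lambda>v. complex_of_real (sin (T / v) / v)) = complex_of_real (integral {p..q} (\<lambda>v. sin (T / v) / v))"
    using integral_unique[OF has_integral_linear[OF integrable_integral[OF c(2)] bounded_linear_of_real[where 'a = complex]]]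
    by (simp only: o_def)
  thus ?thesis using r by (simp only: norm_of_real)
qed

text \<open>
  For small \<open>v\<close> the factor \<open>sin(T/v)\<close> oscillates much faster than the floor jumps.  On each
  interval \<open>[m/T, (m+1)/T]\<close> the floor is constant, and the \<open>n\<close> bounds \<open>O(n/T\<^sup>2)\<close> add up to
  \<open>O((n/T)\<^sup>2)\<close>.
\<close>
lemma osc_sin_low_bound:
  fixes J n :: nat
  assumes J: "1 \<le> J" and T: "0 < T"
  shows "J \<le> n \<Longrightarrow> real n / T \<le> q \<Longrightarrow> q \<le> (real n + 1) / T \<Longrightarrow>
    norm (integral {real J / T..q} (osc_sin \<theta> T)) \<le> (real n + 1 - real J) * (2 * (real n + 1) / T\<^sup>2)"
proof (induction n arbitrary: q)
  case 0 thus ?case using J by simp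
next
  case (Suc n)
  have piece: "norm (integral {real m / T..r} (osc_sin \<theta> T)) \<le> 2 * (real m + 1) / T\<^sup>2"
    if m: "1 \<le> m" "real m / T \<le> r" "r \<le> (real m + 1) / T" for m r
  proof -
    have p: "0 < real m / T" using m T by simp
    have "integral {real m / T..r} (osc_sin \<theta> T) = integral {real m / T..r} (\<lambda>v. cis (\<theta> * real m) * complex_of_real (sin (T / v) / v))"
    proof (rule integral_spike[of "{(real m + 1) / T}"])
      fix v assume v: "v \<in> {real m / T..r} - {(real m + 1) / T}"
      hence "real m / T \<le> v" "v < (real m + 1) / T" using m by auto
      hence "real m \<le> T * v" "T * v < real m + 1" using T by (simp_all add: field_simps)
      hence "\<lfloor>T * v\<rfloor> = int m" by linarith
      thus "cis (\<theta> * real m) * complex_of_real (sin (T / v) / v) = osc_sin \<theta> T v" by (simp add: osc_sin_def)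
    qed simp
    also have "\<dots> = cis (\<theta> * real m) * integral {real m / T..r} (\<lambda>v. complex_of_real (sin (T / v) / v))" by (rule integral_mult_right)
    also have "norm \<dots> \<le> 2 * r / T" unfolding norm_mult norm_cis using sin_inverse_integral_bound[OF p m(2) T] by simp
    also have "\<dots> \<le> 2 * ((real m + 1) / T) / T" using m T by (intro divide_right_mono mult_left_mono) auto
    finally show ?thesis by (simp add: power2_eq_square)
  qed
  show ?case
  proof (cases "J = Suc n")
    case True
    have "norm (integral {real J / T..q} (osc_sin \<theta> T)) \<le> 2 * (real J + 1) / T\<^sup>2"
      using piece[of J q] J Suc.prems True by simp
    thus ?thesis using True by simp
  next
    case False
    hence Jn: "J \<le> n" using Suc.prems by simp
    have j0: "0 < real J / T" using J T by simp
    have le: "real J / T \<le> real (Suc n) / T" using Jn T by (intro divide_right_mono) auto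
    have "integral {real J / T..q} (osc_sin \<theta> T) = integral {real J / T..real (Suc n) / T} (osc_sin \<theta> T) + integral {real (Suc n) / T..q} (osc_sin \<theta> T)"
      using le Suc.prems j0 by (intro Henstock_Kurzweil_Integration.integral_combine[symmetric] osc_sin_integrable) auto
    also have "norm \<dots> \<le> (real n + 1 - real J) * (2 * (real n + 1) / T\<^sup>2) + 2 * (real (Suc n) + 1) / T\<^sup>2"
    proof (intro order_trans[OF norm_triangle_ineq] add_mono)
      show "norm (integral {real J / T..real (Suc n) / T} (osc_sin \<theta> T)) \<le> (real n + 1 - real J) * (2 * (real n + 1) / T\<^sup>2)"
        using T by (intro Suc.IH Jn) (auto simp: divide_right_mono add.commute)
      show "norm (integral {real (Suc n) / T..q} (osc_sin \<theta> T)) \<le> 2 * (real (Suc n) + 1) / T\<^sup>2"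
        using Suc.prems by (intro piece) auto
    qed
    also have "\<dots> \<le> (real n + 1 - real J) * (2 * (real (Suc n) + 1) / T\<^sup>2) + 2 * (real (Suc n) + 1) / T\<^sup>2"
      using Jn by (intro add_right_mono mult_left_mono divide_right_mono) auto
    also have "\<dots> = (real (Suc n) + 1 - real J) * (2 * (real (Suc n) + 1) / T\<^sup>2)"
    proof -
      have e: "real (Suc n) + 1 - real J = (real n + 1 - real J) + 1" by simp
      show ?thesis unfolding e distrib_right mult_1_left ..
    qed
    finally show ?thesis .
  qed
qed

text \<open>
  For large \<open>v\<close> the factor \<open>sin(T/v)/v\<close> hardly changes under \<open>v \<mapsto> v + 1/T\<close>, whereas the floor
  phase gains the factor \<open>cis \<theta> \<noteq> 1\<close>.  The bound does not depend on the upper limit \<open>R\<close>.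
\<close>
lemma osc_sin_high_bound:
  assumes K: "0 < K" "K + 1 / T \<le> R" and T: "0 < T"
  shows "norm (1 - cis \<theta>) * norm (integral {K..R} (osc_sin \<theta> T)) \<le> 3 / (K * T) + 1 / K\<^sup>2"
proof -
  define \<delta> where "\<delta> = 1 / T"
  have d: "0 < \<delta>" "T * \<delta> = 1" using T by (auto simp: \<delta>_def)
  let ?F = "osc_sin \<theta> T"
  have int: "?F integrable_on {K..b}" for b using K by (intro osc_sin_integrable)
  have KR: "K \<le> R" using K d(1) unfolding \<delta>_def by linarith
  have 1: "norm (integral {K..R} ?F - integral {K..R} (\<lambda>v. ?F (v + \<delta>))) \<le> 2 * (1 / K) * \<delta>"
  proof (rule shift_integral_diff_bound[OF int])
    fix v assume v: "v \<in> {K..R + \<delta>}"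
    have "norm (?F v) \<le> 1 / v" using v K by (intro norm_osc_sin_le) auto
    also have "\<dots> \<le> 1 / K" using v K by (intro divide_left_mono) auto
    finally show "norm (?F v) \<le> 1 / K" .
  qed (use d K \<delta>_def in auto)
  have i1: "(\<lambda>v. ?F (v + \<delta>)) integrable_on {K..R}"
  proof -
    have "?F integrable_on {K+\<delta>..R+\<delta>}"
      using int[of "R + \<delta>"] by (rule integrable_on_subinterval) (use d in auto)
    then obtain I where "(?F has_integral I) {K+\<delta>..R+\<delta>}" by (auto simp: integrable_on_def)
    from has_integral_shift_real_ivl[OF this, of \<delta>] show ?thesis by (auto simp: integrable_on_def)
  qed
  have i2: "(\<lambda>v. cis \<theta> * ?F v) integrable_on {K..R}" using int by (rule integrable_on_mult_right)
  have B: "((\<lambda>v. \<delta> * (1 / v\<^sup>2 + T / v^3)) has_integral \<delta> * ((- 1 / R - T / (2 * R\<^sup>2)) - (- 1 / K - T / (2 * K\<^sup>2)))) {K..R}"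
  proof (intro has_integral_mult_right fundamental_theorem_of_calculus[OF KR])
    fix v assume "v \<in> {K..R}"
    hence v: "0 < v" using K by auto
    have "((\<lambda>v. - 1 / v - T / (2 * v\<^sup>2)) has_real_derivative (1 / v\<^sup>2 + T / v^3)) (at v)"
      using v by (auto intro!: derivative_eq_intros simp: field_simps power2_eq_square power3_eq_cube)
    thus "((\<lambda>v. - 1 / v - T / (2 * v\<^sup>2)) has_vector_derivative (1 / v\<^sup>2 + T / v^3)) (at v within {K..R})"
      by (auto intro: has_field_derivative_at_within simp flip: has_real_derivative_iff_has_vector_derivative)
  qed
  have "norm (integral {K..R} (\<lambda>v. ?F (v + \<delta>) - cis \<theta> * ?F v)) \<le> integral {K..R} (\<lambda>v. \<delta> * (1 / v\<^sup>2 + T / v^3))"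
  proof (rule integral_norm_bound_integral[OF integrable_diff[OF i1 i2] has_integral_integrable[OF B]])
    fix v assume "v \<in> {K..R}"
    hence v: "0 < v" using K by auto
    have f: "cis (\<theta> * real_of_int \<lfloor>T * (v + \<delta>)\<rfloor>) = cis \<theta> * cis (\<theta> * real_of_int \<lfloor>T * v\<rfloor>)"
      using floor_phase_shift[OF T, of \<theta> v 1] by (simp add: \<delta>_def)
    have "?F (v + \<delta>) - cis \<theta> * ?F v = cis \<theta> * cis (\<theta> * real_of_int \<lfloor>T * v\<rfloor>) * complex_of_real (sin (T / (v + \<delta>)) / (v + \<delta>) - sin (T / v) / v)"
      unfolding osc_sin_def f by (simp add: algebra_simps)
    hence "norm (?F (v + \<delta>) - cis \<theta> * ?F v) = \<bar>sin (T / (v + \<delta>)) / (v + \<delta>) - sin (T / v) / v\<bar>"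
      by (simp only: norm_mult norm_cis norm_of_real mult_1_left)
    also have "sin (T / (v + \<delta>)) / (v + \<delta>) - sin (T / v) / v = sin (T / (v + \<delta>)) * (1 / (v + \<delta>) - 1 / v) + (sin (T / (v + \<delta>)) - sin (T / v)) * (1 / v)"
      by (simp add: algebra_simps diff_divide_distrib)
    also have "\<bar>\<dots>\<bar> \<le> \<delta> / v\<^sup>2 + T * \<delta> / v\<^sup>2 * (1 / v)"
    proof (rule order_trans[OF abs_triangle_ineq add_mono])
      have h: "\<bar>1 / (v + \<delta>) - 1 / v\<bar> \<le> \<delta> / v\<^sup>2"
      proof -
        have "1 / (v + \<delta>) - 1 / v = - (\<delta> / ((v + \<delta>) * v))" using v d by (simp add: field_simps)
        hence "\<bar>1 / (v + \<delta>) - 1 / v\<bar> = \<delta> / ((v + \<delta>) * v)" using v d by simp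
        also have "\<dots> \<le> \<delta> / (v * v)" using v d by (intro divide_left_mono mult_right_mono mult_pos_pos) auto
        finally show ?thesis by (simp add: power2_eq_square)
      qed
      show "\<bar>sin (T / (v + \<delta>)) * (1 / (v + \<delta>) - 1 / v)\<bar> \<le> \<delta> / v\<^sup>2"
        using h mult_right_mono[of "\<bar>sin (T / (v + \<delta>))\<bar>" 1 "\<bar>1 / (v + \<delta>) - 1 / v\<bar>"] by (simp add: abs_mult)
      have "\<bar>sin (T / (v + \<delta>)) - sin (T / v)\<bar> \<le> \<bar>T / (v + \<delta>) - T / v\<bar>"
        using cis_diff_bound[of "T / (v + \<delta>)" "T / v"] abs_Im_le_cmod[of "cis (T / (v + \<delta>)) - cis (T / v)"] by simp
      also have "\<dots> = T * \<bar>1 / (v + \<delta>) - 1 / v\<bar>" 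
      proof -
        have "T / (v + \<delta>) - T / v = T * (1 / (v + \<delta>) - 1 / v)" by (simp add: right_diff_distrib)
        thus ?thesis using T by (simp only: abs_mult abs_of_pos)
      qed
      also have "\<dots> \<le> T * (\<delta> / v\<^sup>2)" using h T by (intro mult_left_mono) auto
      finally have "\<bar>sin (T / (v + \<delta>)) - sin (T / v)\<bar> \<le> T * \<delta> / v\<^sup>2" by simp
      thus "\<bar>(sin (T / (v + \<delta>)) - sin (T / v)) * (1 / v)\<bar> \<le> T * \<delta> / v\<^sup>2 * (1 / v)"
        unfolding abs_mult using v by (intro mult_mono) auto
    qed
    also have "\<dots> = \<delta> * (1 / v\<^sup>2 + T / v^3)" by (simp add: algebra_simps power2_eq_square power3_eq_cube)
    finally show "norm (?F (v + \<delta>) - cis \<theta> * ?F v) \<le> \<delta> * (1 / v\<^sup>2 + T / v^3)" .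
  qed
  also have "\<dots> = \<delta> * ((- 1 / R - T / (2 * R\<^sup>2)) - (- 1 / K - T / (2 * K\<^sup>2)))" by (rule integral_unique[OF B])
  also have "\<dots> \<le> \<delta> * (1 / K + T / (2 * K\<^sup>2))"
  proof -
    have "0 \<le> 1 / R" "0 \<le> T / (2 * R\<^sup>2)" using K KR T by auto
    hence "- 1 / R - T / (2 * R\<^sup>2) - (- 1 / K - T / (2 * K\<^sup>2)) \<le> 1 / K + T / (2 * K\<^sup>2)"
      unfolding minus_divide_left[symmetric] by linarith
    thus ?thesis using d by (intro mult_left_mono) auto
  qed
  also have "\<dots> = \<delta> / K + (T * \<delta>) / (2 * K\<^sup>2)" by (simp add: distrib_left mult.commute)
  also have "\<dots> \<le> \<delta> / K + 1 / K\<^sup>2" unfolding d using K by (simp add: field_simps)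
  finally have 2: "norm (integral {K..R} (\<lambda>v. ?F (v + \<delta>)) - cis \<theta> * integral {K..R} ?F) \<le> \<delta> / K + 1 / K\<^sup>2"
    by (simp only: Henstock_Kurzweil_Integration.integral_diff[OF i1 i2] integral_mult_right)
  have "norm (1 - cis \<theta>) * norm (integral {K..R} ?F) = norm (integral {K..R} ?F - cis \<theta> * integral {K..R} ?F)"
    by (simp only: norm_mult[symmetric] left_diff_distrib mult_1_left)
  also have "\<dots> \<le> 2 * (1 / K) * \<delta> + (\<delta> / K + 1 / K\<^sup>2)"
    using norm_triangle_le[OF add_mono[OF 1 2]] by simp
  also have "\<dots> = 3 / (K * T) + 1 / K\<^sup>2" using K T unfolding \<delta>_def by (simp add: field_simps)
  finally show ?thesis .
qed

text \<open>
  The ranges near 0 and near infinity contribute arbitrarily little for all large \<open>T\<close>, and the middle range tends to 0.  Uniformity in \<open>R\<close> makes up for the lack of absolute convergence at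
  infinity.
\<close>
lemma osc_sin_small:
  assumes c: "cis \<theta> \<noteq> 1" and r: "0 < r" and J: "1 \<le> J"
  shows "\<exists>K. \<forall>\<^sub>F T in at_top. \<forall>R\<ge>K. norm (integral {real J / T..R} (osc_sin \<theta> T)) < r"
proof -
  define \<gamma> where "\<gamma> = norm (1 - cis \<theta>)"
  have g: "0 < \<gamma>" using c by (simp add: \<gamma>_def)
  \<comment> \<open>The low range is bounded by \<open>8\<epsilon>\<^sup>2 \<le> 8\<epsilon>\<close>, the high range by \<open>(1/K)/\<gamma>\<close> up to a term \<open>O(1/T)\<close>.\<close>
  define \<epsilon> where "\<epsilon> = min 1 (r / 64)"
  have e: "0 < \<epsilon>" "\<epsilon> \<le> 1" "\<epsilon> \<le> r / 64" using r by (auto simp: \<epsilon>_def)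
  define K where "K = max 2 (8 / (\<gamma> * r))"
  have K: "2 \<le> K" "8 / (\<gamma> * r) \<le> K" by (auto simp: K_def)
  have eK: "\<epsilon> < K" using e K by simp
  have "\<forall>\<^sub>F T in at_top. norm (integral {\<epsilon>..K} (osc_sin \<theta> T)) < r / 4"
    using tendstoD[OF osc_sin_middle_tendsto_0[OF e(1) eK], of "r / 4"] r by simp
  moreover have "\<forall>\<^sub>F T in at_top. max (max (2::real) (real J / \<epsilon>)) (max (1 / \<epsilon>) (12 / (K * \<gamma> * (r/4)))) \<le> T" by (rule eventually_ge_at_top)
  ultimately have "\<forall>\<^sub>F T in at_top. \<forall>R\<ge>K + 1. norm (integral {real J / T..R} (osc_sin \<theta> T)) < r"
  proof eventually_elim
    case (elim T)
    hence T: "2 \<le> T" "real J / \<epsilon> \<le> T" "1 / \<epsilon> \<le> T" "12 / (K * \<gamma> * (r/4)) \<le> T" by auto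
    hence T0: "0 < T" by simp
    have Je: "real J / T \<le> \<epsilon>" using T(2) T0 e by (simp add: field_simps)
    have Te: "1 / T \<le> \<epsilon>" using T(3) T0 e by (simp add: field_simps)
    show ?case
    proof (intro allI impI)
      fix R assume R: "K + 1 \<le> R"
      have "integral {real J / T..R} (osc_sin \<theta> T) = integral {real J / T..\<epsilon>} (osc_sin \<theta> T) + integral {\<epsilon>..R} (osc_sin \<theta> T)"
        using Je R eK J T0 by (intro Henstock_Kurzweil_Integration.integral_combine[symmetric] osc_sin_integrable) auto
      also have "integral {\<epsilon>..R} (osc_sin \<theta> T) = integral {\<epsilon>..K} (osc_sin \<theta> T) + integral {K..R} (osc_sin \<theta> T)"
        using e R eK by (intro Henstock_Kurzweil_Integration.integral_combine[symmetric] osc_sin_integrable) auto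
      finally have split: "integral {real J / T..R} (osc_sin \<theta> T) = integral {real J / T..\<epsilon>} (osc_sin \<theta> T) + (integral {\<epsilon>..K} (osc_sin \<theta> T) + integral {K..R} (osc_sin \<theta> T))" .
      have low: "norm (integral {real J / T..\<epsilon>} (osc_sin \<theta> T)) \<le> r / 4"
      proof -
        define n where "n = nat \<lfloor>T * \<epsilon>\<rfloor>"
        have te: "0 \<le> T * \<epsilon>" using T0 e by simp
        have n: "real n \<le> T * \<epsilon>" "T * \<epsilon> < real n + 1" unfolding n_def using te by linarith+
        have "real J < real n + 1" using Je T0 n by (simp add: field_simps)
        hence Jn: "J \<le> n" by simp
        have "norm (integral {real J / T..\<epsilon>} (osc_sin \<theta> T)) \<le> (real n + 1 - real J) * (2 * (real n + 1) / T\<^sup>2)"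
          using n T0 by (intro osc_sin_low_bound J T0 Jn) (simp_all add: field_simps)
        also have "\<dots> \<le> (real n + 1) * (2 * (real n + 1) / T\<^sup>2)" by (intro mult_right_mono) auto
        also have "\<dots> = 2 * ((real n + 1) / T)\<^sup>2" by (simp add: power2_eq_square)
        also have "\<dots> \<le> 2 * (2 * \<epsilon>)\<^sup>2"
        proof (intro mult_left_mono power_mono)
          have "1 \<le> T * \<epsilon>" using Te T0 by (simp add: field_simps)
          hence "real n + 1 \<le> 2 * \<epsilon> * T" using n by (simp add: mult.commute)
          thus "(real n + 1) / T \<le> 2 * \<epsilon>" using T0 by (simp add: divide_le_eq)
        qed (use T0 in auto)
        also have "\<dots> = 8 * (\<epsilon> * \<epsilon>)" by (simp add: power2_eq_square)
        also have "\<dots> \<le> 8 * (\<epsilon> * 1)" using e by (intro mult_left_mono) auto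
        also have "\<dots> \<le> r / 4" using e by simp
        finally show ?thesis .
      qed
      have "1 / T \<le> 1" using T by simp
      hence KR: "K + 1 / T \<le> R" using R by linarith
      have "\<gamma> * norm (integral {K..R} (osc_sin \<theta> T)) \<le> 3 / (K * T) + 1 / K\<^sup>2"
        unfolding \<gamma>_def by (rule osc_sin_high_bound[OF _ KR T0]) (use K in simp)
      also have "\<dots> \<le> \<gamma> * r / 4 + \<gamma> * r / 8"
      proof (rule add_mono)
        show "3 / (K * T) \<le> \<gamma> * r / 4"
          using T(4) K g r T0 by (simp add: field_simps)
        have "1 / K\<^sup>2 \<le> 1 / K" using K by (simp add: power2_eq_square field_simps)
        also have "\<dots> \<le> \<gamma> * r / 8" using K(2) g r K(1) by (simp add: field_simps)
        finally show "1 / K\<^sup>2 \<le> \<gamma> * r / 8" .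
      qed
      finally have "\<gamma> * norm (integral {K..R} (osc_sin \<theta> T)) \<le> \<gamma> * (3 / 8 * r)" by (simp add: field_simps)
      hence high: "norm (integral {K..R} (osc_sin \<theta> T)) \<le> 3 / 8 * r" using g by simp
      have "norm (integral {real J / T..R} (osc_sin \<theta> T)) \<le> norm (integral {real J / T..\<epsilon>} (osc_sin \<theta> T)) + (norm (integral {\<epsilon>..K} (osc_sin \<theta> T)) + norm (integral {K..R} (osc_sin \<theta> T)))"
        unfolding split by (intro order_trans[OF norm_triangle_ineq] add_left_mono norm_triangle_ineq)
      also have "\<dots> < r" using low high elim(1) r by linarith
      finally show "norm (integral {real J / T..R} (osc_sin \<theta> T)) < r" .
    qed
  qed
  thus ?thesis by blast
qed

text \<open>
  In the variable \<open>v\<close> with \<open>w = x/(Tv)\<close> and \<open>T\<^sup>2 = 2\<pi>Mx\<close> one has \<open>x/w = Tv\<close> and \<open>2\<pi>Mw = T/v\<close>,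
  which balances the two oscillations: both have frequency of order \<open>T\<close> when \<open>v\<close> is of order 1.
\<close>
lemma floor_oscillation_tendsto_0:
  fixes x \<theta> \<psi> :: real and J :: nat
  assumes c: "cis \<theta> \<noteq> 1" and x: "0 < x" and J: "1 \<le> J"
  shows "(\<lambda>M. integral {0..x / real J} (\<lambda>w. cos (\<theta> * real_of_int \<lfloor>x / w\<rfloor> + \<psi>) * (sin (2*pi*real M * w) / w))) \<longlonglongrightarrow> 0"
proof (rule tendstoI)
  fix r :: real assume r: "0 < r"
  let ?f = "\<lambda>M w. cos (\<theta> * real_of_int \<lfloor>x / w\<rfloor> + \<psi>) * (sin (2*pi*real M * w) / w)"
  obtain K where K: "\<forall>\<^sub>F T in at_top. \<forall>R\<ge>K. norm (integral {real J / T..R} (osc_sin \<theta> T)) < r / 2"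
    using osc_sin_small[OF c _ J, of "r / 2"] r by auto
  have "filterlim (\<lambda>M. sqrt (2*pi*x * real M)) at_top sequentially"
    using x by (intro filterlim_compose[OF sqrt_at_top] filterlim_tendsto_pos_mult_at_top[OF tendsto_const _ filterlim_real_sequentially]) auto
  from eventually_compose_filterlim[OF K this] eventually_gt_at_top[of "0::nat"]
  show "\<forall>\<^sub>F M in sequentially. dist (integral {0..x / real J} (?f M)) 0 < r"
  proof eventually_elim
    case (elim M)
    define T where "T = sqrt (2*pi*x * real M)"
    have T0: "0 < T" using x elim(2) by (simp add: T_def)
    have TT: "T * T = 2*pi*x * real M" using x unfolding T_def by simp
    \<comment> \<open>The range \<open>v > R\<close>, that is \<open>w < a\<close>, is disposed of by the trivial bound \<open>2\<pi>M a = T/R\<close>.\<close>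
    define R where "R = max (max K (real J / T)) (4 * T / r)"
    have R: "K \<le> R" "real J / T \<le> R" "4 * T / r \<le> R" by (auto simp: R_def)
    have J0: "0 < real J / T" using J T0 by simp
    have R0: "0 < R" using R J0 by linarith
    define a where "a = x / (T * R)"
    have a: "0 < a" "a \<le> x / real J"
    proof -
      show "0 < a" using x T0 R0 by (simp add: a_def)
      show "a \<le> x / real J" unfolding a_def using R(2) T0 R0 J x by (intro divide_left_mono mult_pos_pos) (auto simp: field_simps)
    qed
    have fb: "\<bar>?f M w\<bar> \<le> 2*pi*real M" if "0 \<le> w" for w
    proof (cases "w = 0")
      case False
      have "\<bar>?f M w\<bar> = \<bar>cos (\<theta> * real_of_int \<lfloor>x / w\<rfloor> + \<psi>)\<bar> * (\<bar>sin (2*pi*real M * w)\<bar> / \<bar>w\<bar>)"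
        by (simp only: abs_mult abs_divide)
      also have "\<dots> \<le> 1 * (\<bar>2*pi*real M * w\<bar> / \<bar>w\<bar>)"
        by (intro mult_mono divide_right_mono abs_sin_x_le_abs_x) auto
      finally have "\<bar>?f M w\<bar> \<le> 1 * (\<bar>2*pi*real M * w\<bar> / \<bar>w\<bar>)" .
      thus ?thesis using False that by simp
    qed simp
    have fm: "?f M \<in> borel_measurable (lebesgue_on S)" for S
      by (rule borel_measurable_imp_lebesgue_on) measurable
    have fi: "?f M absolutely_integrable_on {p..q}" if "0 \<le> p" for p q
      by (rule bounded_measurable_absolutely_integrable[OF fm, where B = "2*pi*real M"]) (use fb that in auto)
    have fi': "?f M integrable_on {p..q}" if "0 \<le> p" for p q
      using fi[OF that] set_lebesgue_integral_eq_integral(1) by blast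
    have "integral {0..x / real J} (?f M) = integral {0..a} (?f M) + integral {a..x / real J} (?f M)"
      using a by (intro Henstock_Kurzweil_Integration.integral_combine[symmetric] fi') auto
    moreover have "\<bar>integral {0..a} (?f M)\<bar> \<le> r / 4"
    proof -
      have "norm (integral {0..a} (?f M)) \<le> integral {0..a} (\<lambda>_. 2*pi*real M)"
        by (rule integral_norm_bound_integral[OF fi']) (use fb in auto)
      also have "\<dots> = T * T / x * a" using a TT x by simp
      also have "\<dots> = T / R" unfolding a_def using x T0 R0 by (simp add: field_simps)
      also have "\<dots> \<le> r / 4" using R(3) R0 r by (simp add: field_simps)
      finally show ?thesis by simp
    qed
    moreover have "\<bar>integral {a..x / real J} (?f M)\<bar> < r / 2"
    proof -
      let ?g = "\<lambda>v. x / (T * v)" and ?S = "{real J / T..R}"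
      have gS: "?g ` ?S = {a..x / real J}"
      proof (intro subset_antisym subsetI)
        fix w assume "w \<in> ?g ` ?S"
        then obtain v where v: "v \<in> ?S" "w = x / (T * v)" by auto
        hence v0: "0 < v" using J0 by auto
        have "w \<le> x / (T * (real J / T))" unfolding v(2) using v v0 T0 x J0 by (intro divide_left_mono mult_left_mono mult_pos_pos) auto
        moreover have "a \<le> w" unfolding v(2) a_def using v v0 T0 x R0 by (intro divide_left_mono mult_left_mono mult_pos_pos) auto
        ultimately show "w \<in> {a..x / real J}" using T0 by simp
      next
        fix w assume w: "w \<in> {a..x / real J}"
        hence w0: "0 < w" using a by auto
        have "x / (T * w) \<in> ?S"
        proof -
          have "real J / T \<le> x / (T * w)" using w w0 T0 J x by (simp add: field_simps)
          moreover have "x / (T * w) \<le> R" using w w0 T0 R0 x unfolding a_def by (simp add: field_simps)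
          ultimately show ?thesis by simp
        qed
        moreover have "w = ?g (x / (T * w))" using w0 T0 x by simp
        ultimately show "w \<in> ?g ` ?S" by blast
      qed
      have "(\<lambda>v. \<bar>- x / (T * v\<^sup>2)\<bar> * ?f M (?g v)) absolutely_integrable_on ?S \<and>
          integral ?S (\<lambda>v. \<bar>- x / (T * v\<^sup>2)\<bar> * ?f M (?g v)) = integral {a..x / real J} (?f M)"
      proof (rule iffD2[OF has_absolute_integral_change_of_variables_1'[where g = ?g]])
        show "?S \<in> sets lebesgue" by simp
        show "(?g has_real_derivative - x / (T * v\<^sup>2)) (at v within ?S)" if v: "v \<in> ?S" for v
        proof -
          have v0: "0 < v" using v J0 by auto
          have "(?g has_real_derivative - x / (T * v\<^sup>2)) (at v)"
            using v0 T0 by (auto intro!: derivative_eq_intros simp: field_simps power2_eq_square)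
          thus ?thesis by (rule has_field_derivative_at_within)
        qed
        show "inj_on ?g ?S"
        proof (rule inj_onI)
          fix u v assume "u \<in> ?S" "v \<in> ?S" "?g u = ?g v"
          moreover from this have "0 < u" "0 < v" using J0 by auto
          ultimately show "u = v" using x T0 by (simp add: field_simps)
        qed
        show "?f M absolutely_integrable_on ?g ` ?S \<and> integral (?g ` ?S) (?f M) = integral {a..x / real J} (?f M)"
          unfolding gS using fi a by simp
      qed
      hence I1: "integral {a..x / real J} (?f M) = integral ?S (\<lambda>v. \<bar>- x / (T * v\<^sup>2)\<bar> * ?f M (?g v))" by simp
      also have "\<dots> = integral ?S (\<lambda>v. Re (cis \<psi> * osc_sin \<theta> T v))"
      proof (rule integral_cong)
        fix v assume "v \<in> ?S"
        hence v0: "0 < v" using J0 by auto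
        have 1: "x / ?g v = T * v" using x T0 v0 by simp
        have 2: "2*pi*real M * ?g v = T / v"
        proof -
          have "2*pi*real M * ?g v = (T * T) / (T * v)" unfolding TT by simp
          thus ?thesis using T0 by simp
        qed
        have 3: "\<bar>- x / (T * v\<^sup>2)\<bar> * (s / ?g v) = s / v" for s
          using x T0 v0 by (simp add: field_simps power2_eq_square)
        have "\<bar>- x / (T * v\<^sup>2)\<bar> * ?f M (?g v) = cos (\<theta> * real_of_int \<lfloor>T * v\<rfloor> + \<psi>) * (sin (T / v) / v)"
          unfolding 1 2 using 3[of "sin (T / v)"] by (simp only: mult.left_commute)
        also have "\<dots> = Re (cis \<psi> * osc_sin \<theta> T v)"
          unfolding osc_sin_def mult.assoc[symmetric] cis_mult by (simp add: add.commute)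
        finally show "\<bar>- x / (T * v\<^sup>2)\<bar> * ?f M (?g v) = Re (cis \<psi> * osc_sin \<theta> T v)" .
      qed
      also have "\<dots> = Re (cis \<psi> * integral ?S (osc_sin \<theta> T))"
        using integral_unique[OF has_integral_linear[OF has_integral_mult_right[where c = "cis \<psi>",
            OF integrable_integral[OF osc_sin_integrable[OF J0, where \<theta> = \<theta> and T = T and b = R]]] bounded_linear_Re]]
        by (simp only: o_def)
      also have "\<bar>\<dots>\<bar> \<le> norm (integral ?S (osc_sin \<theta> T))"
        using abs_Re_le_cmod[of "cis \<psi> * integral ?S (osc_sin \<theta> T)"] by (simp only: norm_mult norm_cis mult_1_left)
      also have "\<dots> < r / 2" using elim(1) R(1) unfolding T_def by blast
      finally show ?thesis .
    qed
    ultimately show ?case using r by simp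
  qed
qed

section \<open>Mixed derivatives of both sides\<close>

text \<open>
  Iterated derivatives are identified from a family in which each member is the derivative of the
  preceding one; on an open set, this replaces any discussion of higher differentiability.
\<close>
lemma deriv_funpow_eqI:
  fixes f :: "real \<Rightarrow> real"
  assumes S: "open S" and 0: "\<And>t. t \<in> S \<Longrightarrow> f t = F 0 t"
    and D: "\<And>i t. t \<in> S \<Longrightarrow> (F i has_real_derivative F (Suc i) t) (at t)" and t: "t \<in> S"
  shows "(deriv ^^ k) f t = F k t"
  using t
proof (induction k arbitrary: t)
  case 0 thus ?case using assms(2) by simp
next
  case (Suc k)
  have "((deriv ^^ k) f has_real_derivative F (Suc k) t) (at t)"
    by (rule has_field_derivative_transform_within_open[OF D[OF Suc.prems] S Suc.prems]) (simp add: Suc.IH)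
  thus ?case by (simp add: DERIV_imp_deriv)
qed

lemma diffs_funpow: "(diffs ^^ r) c n = fact (n + r) / fact n * (c (n + r) :: real)"
proof (induction r arbitrary: n)
  case (Suc r)
  have "(diffs ^^ Suc r) c n = real (Suc n) * (fact (Suc n + r) / fact (Suc n) * c (Suc n + r))"
    by (simp add: diffs_def Suc.IH del: fact_Suc)
  also have "real (Suc n) * (fact (Suc n + r) / fact (Suc n) * c (Suc n + r)) = fact (n + Suc r) / fact n * c (n + Suc r)"
    by (simp add: fact_reduce divide_simps)
  finally show ?case .
qed simp

lemma summable_diffs_funpow:
  fixes c :: "nat \<Rightarrow> real"
  assumes "\<And>x. summable (\<lambda>n. c n * x ^ n)"
  shows "summable (\<lambda>n. (diffs ^^ r) c n * x ^ n)"
proof (induction r arbitrary: x)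
  case (Suc r)
  show ?case using termdiff_converges_all[OF Suc.IH] by simp
qed (use assms in simp)

lemma DERIV_powser_funpow:
  fixes c :: "nat \<Rightarrow> real"
  assumes "\<And>x. summable (\<lambda>n. c n * x ^ n)"
  shows "((\<lambda>x. \<Sum>n. (diffs ^^ r) c n * x ^ n) has_real_derivative (\<Sum>n. (diffs ^^ Suc r) c n * x ^ n)) (at x)"
  using termdiffs_strong_converges_everywhere[OF summable_diffs_funpow[OF assms, of r], of x] by simp

text \<open>
  The \<open>r\<close>-th derivative of \<open>clifford_moment 0\<close> as a power series.
\<close>
definition clifford_deriv :: "nat \<Rightarrow> real \<Rightarrow> real" where
  "clifford_deriv r z = (\<Sum>n. (diffs ^^ r) (\<lambda>j. clifford_coeff j / (real j + 1)) n * z ^ n)"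

lemma summable_clifford_moment_0: "summable (\<lambda>j. clifford_coeff j / (real j + 1) * y ^ j)"
  using summable_clifford_moment[of 0 y] by simp

lemma clifford_deriv_0: "clifford_deriv 0 z = clifford_moment 0 z"
  by (simp add: clifford_deriv_def clifford_moment_def)

lemma DERIV_clifford_deriv: "(clifford_deriv r has_real_derivative clifford_deriv (Suc r) z) (at z)"
  unfolding clifford_deriv_def[abs_def] by (rule DERIV_powser_funpow[OF summable_clifford_moment_0])

text \<open>
  The \<open>k\<close>-th derivative of \<open>u\<^sup>k G\<^sub>0\<^bsup>(k)\<^esup>(\<mu>u)\<close> is \<open>(-1)\<^sup>k G\<^sub>k(\<mu>u)\<close>.  Both differentiations
  multiply the coefficient of order \<open>n + k\<close> by \<open>(n+k)!/n!\<close>, which turns its denominator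
  \<open>(n+k)!\<^sup>2\<close> into \<open>n!\<^sup>2\<close> and leaves the factor \<open>1/(n+k+1)\<close>, the hallmark of the moment.
\<close>
lemma power_times_clifford_deriv_funpow:
  obtains B where "\<And>u. B 0 u = u ^ k * clifford_deriv k (\<mu> * u)"
    "\<And>r u. (B r has_real_derivative B (Suc r) u) (at u)" "\<And>u. B k u = (-1) ^ k * clifford_moment k (\<mu> * u)"
proof -
  define a where "a = (\<lambda>n. (diffs ^^ k) (\<lambda>j. clifford_coeff j / (real j + 1)) n)"
  \<comment> \<open>The coefficients of \<open>u\<^sup>k G\<^sub>0\<^bsup>(k)\<^esup>(\<mu>u)\<close>.\<close>
  define d where "d i = (if i < k then 0 else a (i - k) * \<mu> ^ (i - k))" for i
  have asum: "summable (\<lambda>n. a n * x ^ n)" for x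
    unfolding a_def by (rule summable_diffs_funpow[OF summable_clifford_moment_0])
  have sh: "d (n + k) * u ^ (n + k) = u ^ k * (a n * (\<mu> * u) ^ n)" for n u
    by (simp add: d_def power_add power_mult_distrib)
  have dsum: "summable (\<lambda>n. d n * x ^ n)" for x
  proof (subst summable_iff_shift[of _ k, symmetric])
    show "summable (\<lambda>n. d (n + k) * x ^ (n + k))" unfolding sh by (intro summable_mult asum)
  qed
  define B where "B r u = (\<Sum>n. (diffs ^^ r) d n * u ^ n)" for r u
  show ?thesis
  proof (rule that[of B])
    fix u
    have "B 0 u = (\<Sum>n. d n * u ^ n)" by (simp add: B_def)
    also have "\<dots> = (\<Sum>n. d (n + k) * u ^ (n + k)) + (\<Sum>n<k. d n * u ^ n)"
      by (rule suminf_split_initial_segment[OF dsum])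
    also have "(\<Sum>n<k. d n * u ^ n) = 0" by (intro sum.neutral) (auto simp: d_def)
    also have "(\<Sum>n. d (n + k) * u ^ (n + k)) = u ^ k * (\<Sum>n. a n * (\<mu> * u) ^ n)"
      unfolding sh by (intro suminf_mult asum)
    finally show "B 0 u = u ^ k * clifford_deriv k (\<mu> * u)" by (simp add: clifford_deriv_def a_def)
    show "(B r has_real_derivative B (Suc r) u) (at u)" for r
      unfolding B_def[abs_def] by (rule DERIV_powser_funpow[OF dsum])
    have "(diffs ^^ k) d n * u ^ n = (-1) ^ k * (clifford_coeff n / (real n + real k + 1) * (\<mu> * u) ^ n)" for n
    proof -
      have "(diffs ^^ k) d n = fact (n + k) / fact n * (a n * \<mu> ^ n)" unfolding diffs_funpow by (simp add: d_def)
      also have "a n = fact (n + k) / fact n * (clifford_coeff (n + k) / (real (n + k) + 1))" unfolding a_def diffs_funpow ..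
      also have "clifford_coeff (n + k) = (-1) ^ k * ((-1) ^ n / (fact (n + k))\<^sup>2)" by (simp add: clifford_coeff_def power_add)
      finally show ?thesis
        by (simp add: clifford_coeff_def power2_eq_square power_mult_distrib)
    qed
    thus "B k u = (-1) ^ k * clifford_moment k (\<mu> * u)"
      unfolding B_def clifford_moment_def by (simp only: suminf_mult[OF summable_clifford_moment])
  qed
qed

text \<open>
  The square roots cancel, so the term is an entire function of the product \<open>uv\<close>.
\<close>
lemma bessel_term_eq:
  assumes "0 < u" "0 < v" "0 < x"
  shows "bessel_term x u v = 2 * pi * sqrt x * clifford_moment 0 (4 * pi\<^sup>2 * x * u * v)"
proof -
  define h where "h = 2 * pi * sqrt (u * v * x)"
  have h0: "0 < h" using assms by (simp add: h_def)
  have h2: "h * h = 4 * pi\<^sup>2 * x * u * v" using assms by (simp add: h_def power2_eq_square)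
  have hh: "4 * pi * sqrt (u * v * x) / 2 = h" by (simp add: h_def)
  have t: "(-1) ^ k * rGamma (1 + real k + 1) / fact k * (4 * pi * sqrt (u * v * x) / 2) powr (1 + 2 * real k)
      = h * (clifford_coeff k / (real k + real 0 + 1) * (4 * pi\<^sup>2 * x * u * v) ^ k)" for k
  proof -
    have rg: "rGamma (1 + real k + 1) = 1 / fact (Suc k)"
      using Gamma_fact[of "Suc k", where 'a = real] by (simp add: rGamma_inverse_Gamma divide_inverse add_ac del: fact_Suc)
    have pw: "(4 * pi * sqrt (u * v * x) / 2) powr (1 + 2 * real k) = h * (h * h) ^ k"
    proof -
      have "h powr (1 + 2 * real k) = h powr (real (1 + 2 * k))" by simp
      also have "\<dots> = h ^ (1 + 2 * k)" by (rule powr_realpow[OF h0])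
      also have "\<dots> = h * (h * h) ^ k" by (simp add: power_mult power2_eq_square)
      finally show ?thesis unfolding hh .
    qed
    have c: "clifford_coeff k / (real k + real 0 + 1) = (-1) ^ k * (1 / fact (Suc k)) / fact k"
      by (simp add: clifford_coeff_def power2_eq_square divide_simps mult_ac)
    show ?thesis unfolding rg pw c h2 by (rule mult.left_commute)
  qed
  have b1: "bessel_J 1 (4 * pi * sqrt (u * v * x)) = h * clifford_moment 0 (4 * pi\<^sup>2 * x * u * v)"
    unfolding bessel_J_def t clifford_moment_def by (rule suminf_mult[OF summable_clifford_moment])
  have b2: "h / sqrt (u * v) = 2 * pi * sqrt x" using assms by (simp add: h_def real_sqrt_mult)
  have "bessel_term x u v = h / sqrt (u * v) * clifford_moment 0 (4 * pi\<^sup>2 * x * u * v)"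
    unfolding bessel_term_def b1 by (rule times_divide_eq_left[symmetric])
  thus ?thesis unfolding b2 .
qed

lemma DERIV_scaled_clifford_deriv:
  "((\<lambda>t. (e * lam * U) ^ r * clifford_deriv r (lam * U * (\<beta> + e * t))) has_real_derivative
     (e * lam * U) ^ Suc r * clifford_deriv (Suc r) (lam * U * (\<beta> + e * t))) (at t)"
proof -
  have "((\<lambda>t. clifford_deriv r (lam * U * (\<beta> + e * t))) has_real_derivative clifford_deriv (Suc r) (lam * U * (\<beta> + e * t)) * (lam * U * e)) (at t)"
    by (rule DERIV_chain2[OF DERIV_clifford_deriv]) (auto intro!: derivative_eq_intros)
  from DERIV_cmult[OF this, of "(e * lam * U) ^ r"] show ?thesis by (rule DERIV_cong) (simp add: mult_ac)
qed

text \<open>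
  Each reflected variable \<open>1 - \<sigma>\<close> or \<open>1 - \<theta>\<close> contributes a sign \<open>(-1)\<^sup>k\<close>; the two signs
  cancel in the last term.
\<close>
lemma mixed_deriv_bessel_bracket:
  fixes \<sigma> \<theta> x :: real and k :: nat
  assumes \<sigma>: "0 < \<sigma>" "\<sigma> < 1" and \<theta>: "0 < \<theta>" "\<theta> < 1" and x: "0 < x"
  defines "g \<equiv> \<lambda>u v. clifford_moment k (4 * pi\<^sup>2 * x * u * v)"
  shows "mixed_deriv k (bessel_bracket x m n) \<sigma> \<theta> = 2 * pi * sqrt x * (- (4 * pi\<^sup>2 * x)) ^ k *
     (g (real m + \<sigma>) (real n + \<theta>) + (-1) ^ k * g (real m + 1 - \<sigma>) (real n + \<theta>)
      - (-1) ^ k * g (real m + \<sigma>) (real n + 1 - \<theta>) - g (real m + 1 - \<sigma>) (real n + 1 - \<theta>))"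
proof -
  define lam where "lam = 4 * pi\<^sup>2 * x"
  define c where "c = 2 * pi * sqrt x"
  define F where "F r U t = (1 * lam * U) ^ r * clifford_deriv r (lam * U * (real n + 1 * t))
      - (-1 * lam * U) ^ r * clifford_deriv r (lam * U * (real n + 1 + -1 * t))" for r U t
  have F0: "c * F 0 u t = bessel_term x u (real n + t) - bessel_term x u (real n + 1 - t)" if "0 < u" "t \<in> {0<..<1}" for u t
    using that x by (simp add: F_def clifford_deriv_0 bessel_term_eq c_def lam_def algebra_simps)
  have FD: "((\<lambda>t. F r U t) has_real_derivative F (Suc r) U t) (at t)" for r U t
    unfolding F_def by (intro DERIV_diff DERIV_scaled_clifford_deriv)
  have inner: "(deriv ^^ k) (\<lambda>t. bessel_bracket x m n s t) \<theta> = c * (F k (real m + s) \<theta> + F k (real m + 1 - s) \<theta>)"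
    if s: "s \<in> {0<..<1}" for s
  proof (rule deriv_funpow_eqI[where S = "{0<..<1}" and F = "\<lambda>r t. c * (F r (real m + s) t + F r (real m + 1 - s) t)"])
    show "bessel_bracket x m n s t = c * (F 0 (real m + s) t + F 0 (real m + 1 - s) t)" if "t \<in> {0<..<1}" for t
      using F0[of "real m + s" t] F0[of "real m + 1 - s" t] that s unfolding bessel_bracket_def by (simp add: distrib_left)
  qed (use \<theta> in \<open>auto intro!: DERIV_cmult DERIV_add FD\<close>)
  obtain B where B: "\<And>u. B 0 u = u ^ k * clifford_deriv k ((lam * (real n + \<theta>)) * u)"
    "\<And>r u. (B r has_real_derivative B (Suc r) u) (at u)" "\<And>u. B k u = (-1) ^ k * clifford_moment k ((lam * (real n + \<theta>)) * u)"
    by (rule power_times_clifford_deriv_funpow[of k "lam * (real n + \<theta>)"]) blast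
  obtain B' where B': "\<And>u. B' 0 u = u ^ k * clifford_deriv k ((lam * (real n + 1 - \<theta>)) * u)"
    "\<And>r u. (B' r has_real_derivative B' (Suc r) u) (at u)" "\<And>u. B' k u = (-1) ^ k * clifford_moment k ((lam * (real n + 1 - \<theta>)) * u)"
    by (rule power_times_clifford_deriv_funpow[of k "lam * (real n + 1 - \<theta>)"]) blast
  define G where "G r u = lam ^ k * B r u - (- lam) ^ k * B' r u" for r u
  have G0: "F k u \<theta> = G 0 u" for u
  proof -
    have e1: "(1 * lam * u) ^ k = lam ^ k * u ^ k" "(-1 * lam * u) ^ k = (- lam) ^ k * u ^ k"
      by (simp_all flip: power_mult_distrib)
    have e2: "lam * u * (real n + 1 * \<theta>) = lam * (real n + \<theta>) * u" "lam * u * (real n + 1 + -1 * \<theta>) = lam * (real n + 1 - \<theta>) * u"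
      by simp_all
    show ?thesis unfolding F_def G_def B B' e1 e2 by (simp only: mult.assoc)
  qed
  have GD: "(G r has_real_derivative G (Suc r) u) (at u)" for r u
    unfolding G_def[abs_def] by (intro DERIV_diff DERIV_cmult B B')
  have GD1: "((\<lambda>s. G r (a + e * s)) has_real_derivative e * G (Suc r) (a + e * s)) (at s)" for r a e s
    by (rule DERIV_cong[OF DERIV_chain2[OF GD]]) (auto intro!: derivative_eq_intros)
  have "mixed_deriv k (bessel_bracket x m n) \<sigma> \<theta> = c * (1 ^ k * G k (real m + 1 * \<sigma>) + (-1) ^ k * G k (real m + 1 + (-1) * \<sigma>))"
    unfolding mixed_deriv_def
  proof (rule deriv_funpow_eqI[where S = "{0<..<1}" and F = "\<lambda>r s. c * (1 ^ r * G r (real m + 1 * s) + (-1) ^ r * G r (real m + 1 + (-1) * s))"])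
    show "(deriv ^^ k) (bessel_bracket x m n s) \<theta> = c * (1 ^ 0 * G 0 (real m + 1 * s) + (-1) ^ 0 * G 0 (real m + 1 + (-1) * s))"
      if "s \<in> {0<..<1}" for s
      using inner[OF that] by (simp add: G0)
    show "((\<lambda>s. c * (1 ^ r * G r (real m + 1 * s) + (-1) ^ r * G r (real m + 1 + (-1) * s))) has_real_derivative
        c * (1 ^ Suc r * G (Suc r) (real m + 1 * s) + (-1) ^ Suc r * G (Suc r) (real m + 1 + (-1) * s))) (at s)" for r s
    proof (rule DERIV_cmult, rule DERIV_cong[OF DERIV_add[OF DERIV_cmult[OF GD1] DERIV_cmult[OF GD1]]])
    qed simp
  qed (use \<sigma> in auto)
  also have "\<dots> = c * (G k (real m + \<sigma>) + (-1) ^ k * G k (real m + 1 - \<sigma>))" by simp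
  finally have M: "mixed_deriv k (bessel_bracket x m n) \<sigma> \<theta> = c * (G k (real m + \<sigma>) + (-1) ^ k * G k (real m + 1 - \<sigma>))" .
  have Gk: "G k u = (- lam) ^ k * (g u (real n + \<theta>) - (-1) ^ k * g u (real n + 1 - \<theta>))" for u
  proof -
    have s: "(- lam) ^ k = (-1) ^ k * lam ^ k" by (simp flip: power_mult_distrib)
    show ?thesis unfolding G_def B B' g_def s lam_def[symmetric] by (simp add: algebra_simps)
  qed
  have alg: "c * (l * (p - s * q) + s * (l * (p' - s * q'))) = c * l * (p + s * p' - s * q - (s * s) * q')" for l p q s p' q'
    by (simp add: algebra_simps)
  have ss: "(-1) ^ k * (-1) ^ k = (1::real)" by (simp flip: power_mult_distrib)
  show ?thesis unfolding M Gk alg ss mult_1_left unfolding c_def lam_def ..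
qed

text \<open>
  All derivatives of the cotangent are polynomials in the cotangent, because \<open>cot' = -(1 + cot\<^sup>2)\<close>.
  This is needed to know that they exist; their values matter for \<open>k = 0\<close> only, since the outer
  derivatives in \<open>\<sigma>\<close> annihilate them otherwise.
\<close>
lemma cot_higher_derivs:
  obtains C :: "nat \<Rightarrow> real \<Rightarrow> real" where "\<And>t. C 0 t = cot (pi * t) / 4"
    "\<And>r t. t \<in> {0<..<1} \<Longrightarrow> (C r has_real_derivative C (Suc r) t) (at t)"
proof -
  \<comment> \<open>The chain rule with \<open>cot(\<pi>t)' = -\<pi>(1 + cot\<^sup>2)\<close>.\<close>
  define p :: "nat \<Rightarrow> real poly" where "p = rec_nat [:0, 1/4:] (\<lambda>_ q. pderiv q * [:-pi, 0, -pi:])"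
  have p: "p 0 = [:0, 1/4:]" "p (Suc r) = pderiv (p r) * [:-pi, 0, -pi:]" for r by (simp_all add: p_def)
  show ?thesis
  proof (rule that[of "\<lambda>r t. poly (p r) (cot (pi * t))"])
    show "poly (p 0) (cot (pi * t)) = cot (pi * t) / 4" for t by (simp add: p)
    fix r and t :: real assume t: "t \<in> {0<..<1}"
    have s: "sin (pi * t) \<noteq> 0" using sin_gt_zero[of "pi * t"] t by simp
    have e: "- inverse ((sin (pi * t))\<^sup>2) = - (1 + (cot (pi * t))\<^sup>2)"
    proof -
      have "1 = (sin (pi * t))\<^sup>2 + (cos (pi * t))\<^sup>2" by simp
      thus ?thesis using s unfolding cot_def power_divide by (simp add: field_simps)
    qed
    have "((\<lambda>t. cot (pi * t)) has_real_derivative - inverse ((sin (pi * t))\<^sup>2) * pi) (at t)"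
      by (rule DERIV_chain2[where f = cot and g = "\<lambda>t. pi * t", OF DERIV_cot[OF s]]) (auto intro!: derivative_eq_intros)
    from DERIV_chain2[OF poly_DERIV this, of "p r"]
    show "((\<lambda>t. poly (p r) (cot (pi * t))) has_real_derivative poly (p (Suc r)) (cot (pi * t))) (at t)"
      by (rule DERIV_cong, unfold e) (simp add: p power2_eq_square algebra_simps)
  qed
qed

lemma DERIV_sin_shift: "((\<lambda>t. \<nu> ^ r * sin (\<nu> * t + real r * pi / 2)) has_real_derivative \<nu> ^ Suc r * sin (\<nu> * t + real (Suc r) * pi / 2)) (at t)"
proof -
  have a: "\<nu> * t + real (Suc r) * pi / 2 = (\<nu> * t + real r * pi / 2) + pi / 2" by (simp add: field_simps)
  have b: "sin (y + pi / 2) = cos y" for y by (simp add: sin_add)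
  show ?thesis unfolding a b by (auto intro!: derivative_eq_intros)
qed

lemma DERIV_cos_shift: "((\<lambda>t. \<nu> ^ r * cos (\<nu> * t + real r * pi / 2)) has_real_derivative \<nu> ^ Suc r * cos (\<nu> * t + real (Suc r) * pi / 2)) (at t)"
proof -
  have a: "\<nu> * t + real (Suc r) * pi / 2 = (\<nu> * t + real r * pi / 2) + pi / 2" by (simp add: field_simps)
  have b: "cos (y + pi / 2) = - sin y" for y by (simp add: cos_add)
  show ?thesis unfolding a b by (auto intro!: derivative_eq_intros)
qed

lemma DERIV_primed_sum:
  assumes "\<And>m n. ((\<lambda>t. f m n t) has_real_derivative f' m n) (at t)"
  shows "((\<lambda>t. primed_sum x (\<lambda>m n. f m n t)) has_real_derivative primed_sum x f') (at t)"
  unfolding primed_sum_def split_def by (intro DERIV_sum DERIV_cmult assms)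

lemma mixed_deriv_primed_sum:
  fixes \<sigma> \<theta> x :: real
  assumes \<sigma>: "0 < \<sigma>" "\<sigma> < 1" and \<theta>: "0 < \<theta>" "\<theta> < 1"
  shows "mixed_deriv k (\<lambda>s t. primed_sum x (\<lambda>m n. cos (2 * pi * real m * s) * sin (2 * pi * real n * t)) + cot (pi * t) / 4) \<sigma> \<theta>
    = primed_sum x (\<lambda>m n. ((2 * pi * real m) ^ k * cos (2 * pi * real m * \<sigma> + real k * pi / 2)) * ((2 * pi * real n) ^ k * sin (2 * pi * real n * \<theta> + real k * pi / 2)))
      + (if k = 0 then cot (pi * \<theta>) / 4 else 0)"
proof -
  obtain C :: "nat \<Rightarrow> real \<Rightarrow> real" where C: "\<And>t. C 0 t = cot (pi * t) / 4"
    "\<And>r t. t \<in> {0<..<1} \<Longrightarrow> (C r has_real_derivative C (Suc r) t) (at t)" using cot_higher_derivs by blast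
  let ?S = "\<lambda>r n t. (2 * pi * real n) ^ r * sin (2 * pi * real n * t + real r * pi / 2)"
  let ?K = "\<lambda>r m s. (2 * pi * real m) ^ r * cos (2 * pi * real m * s + real r * pi / 2)"
  have inner: "(deriv ^^ k) (\<lambda>t. primed_sum x (\<lambda>m n. cos (2 * pi * real m * s) * sin (2 * pi * real n * t)) + cot (pi * t) / 4) \<theta> =
      primed_sum x (\<lambda>m n. cos (2 * pi * real m * s) * ?S k n \<theta>) + C k \<theta>" for s
  proof (rule deriv_funpow_eqI[where S = "{0<..<1}" and F = "\<lambda>r t. primed_sum x (\<lambda>m n. cos (2 * pi * real m * s) * ?S r n t) + C r t"])
    show "((\<lambda>t. primed_sum x (\<lambda>m n. cos (2 * pi * real m * s) * ?S r n t) + C r t) has_real_derivative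
        primed_sum x (\<lambda>m n. cos (2 * pi * real m * s) * ?S (Suc r) n t) + C (Suc r) t) (at t)" if "t \<in> {0<..<1}" for r t
      by (intro DERIV_add DERIV_primed_sum DERIV_cmult DERIV_sin_shift C that)
  qed (use \<theta> C in auto)
  have "mixed_deriv k (\<lambda>s t. primed_sum x (\<lambda>m n. cos (2 * pi * real m * s) * sin (2 * pi * real n * t)) + cot (pi * t) / 4) \<sigma> \<theta>
     = primed_sum x (\<lambda>m n. ?K k m \<sigma> * ?S k n \<theta>) + (if k = 0 then C k \<theta> else 0)"
    unfolding mixed_deriv_def inner
  proof (rule deriv_funpow_eqI[where S = UNIV and F = "\<lambda>r s. primed_sum x (\<lambda>m n. ?K r m s * ?S k n \<theta>) + (if r = 0 then C k \<theta> else 0)"])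
    fix r s
    have 1: "((\<lambda>s. primed_sum x (\<lambda>m n. ?K r m s * ?S k n \<theta>)) has_real_derivative primed_sum x (\<lambda>m n. ?K (Suc r) m s * ?S k n \<theta>)) (at s)"
      by (intro DERIV_primed_sum DERIV_cmult_right DERIV_cos_shift)
    have 2: "((\<lambda>s. if r = 0 then C k \<theta> else 0) has_real_derivative 0) (at s)" by simp
    show "((\<lambda>s. primed_sum x (\<lambda>m n. ?K r m s * ?S k n \<theta>) + (if r = 0 then C k \<theta> else 0)) has_real_derivative
        primed_sum x (\<lambda>m n. ?K (Suc r) m s * ?S k n \<theta>) + (if Suc r = 0 then C k \<theta> else 0)) (at s)"
      using DERIV_add[OF 1 2] by simp
  qed auto
  thus ?thesis using C(1) by (cases k) auto
qed

section \<open>Sums under a hyperbola\<close>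

text \<open>
  Summation by parts for increasing weights.
\<close>
lemma Abel_bound:
  fixes a b :: "nat \<Rightarrow> real"
  assumes mono: "\<And>j. a j \<le> a (Suc j)" and a0: "0 \<le> a 0" and B: "\<And>n. \<bar>\<Sum>j<n. b j\<bar> \<le> B"
  shows "\<bar>\<Sum>j<N. a j * b j\<bar> \<le> 2 * B * a N"
proof -
  have ap: "0 \<le> a n" for n by (induction n) (use a0 mono order_trans in blast)+
  have B0: "0 \<le> B" using B[of 0] by simp
  have id: "(\<Sum>j<N. a j * b j) = a N * (\<Sum>j<N. b j) - (\<Sum>j<N. (a (Suc j) - a j) * (\<Sum>i<Suc j. b i))"
    by (induction N) (simp_all add: algebra_simps)
  have "\<bar>\<Sum>j<N. (a (Suc j) - a j) * (\<Sum>i<Suc j. b i)\<bar> \<le> (\<Sum>j<N. (a (Suc j) - a j) * B)"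
  proof (rule order_trans[OF sum_abs sum_mono])
    fix j show "\<bar>(a (Suc j) - a j) * (\<Sum>i<Suc j. b i)\<bar> \<le> (a (Suc j) - a j) * B"
      unfolding abs_mult using mono[of j] B[of "Suc j"] by (intro mult_mono) auto
  qed
  also have "\<dots> = (a N - a 0) * B"
    unfolding sum_distrib_right[symmetric] by (simp add: sum_lessThan_telescope)
  also have "\<dots> \<le> a N * B" using a0 B0 by (intro mult_right_mono) auto
  finally have 1: "\<bar>\<Sum>j<N. (a (Suc j) - a j) * (\<Sum>i<Suc j. b i)\<bar> \<le> a N * B" .
  have 2: "\<bar>a N * (\<Sum>j<N. b j)\<bar> \<le> a N * B"
    unfolding abs_mult using ap[of N] B[of N] by (intro mult_mono) auto
  have "\<bar>a N * (\<Sum>j<N. b j) - (\<Sum>j<N. (a (Suc j) - a j) * (\<Sum>i<Suc j. b i))\<bar> \<le> a N * B + a N * B"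
    by (rule order_trans[OF abs_triangle_ineq4 add_mono[OF 2 1]])
  thus ?thesis unfolding id[symmetric] by (simp add: mult_ac)
qed

text \<open>
  The sum telescopes after multiplication by \<open>2 sin(\<alpha>/2)\<close>.
\<close>
lemma cos_progression_bound:
  assumes "0 < sin (\<alpha> / 2)"
  shows "\<bar>\<Sum>j<n. cos (\<alpha> * real j + \<beta>)\<bar> \<le> 1 / sin (\<alpha> / 2)"
proof -
  have "2 * sin (\<alpha> / 2) * (\<Sum>j<n. cos (\<alpha> * real j + \<beta>)) = sin (\<alpha> * real n + \<beta> - \<alpha> / 2) - sin (\<beta> - \<alpha> / 2)"
  proof (induction n)
    case (Suc n)
    have "2 * (sin (\<alpha> / 2) * cos (\<alpha> * real n + \<beta>)) = sin (\<alpha> * real (Suc n) + \<beta> - \<alpha> / 2) - sin (\<alpha> * real n + \<beta> - \<alpha> / 2)"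
    proof -
      have e: "\<alpha> / 2 + (\<alpha> * real n + \<beta>) = \<alpha> * real (Suc n) + \<beta> - \<alpha> / 2" "\<alpha> / 2 - (\<alpha> * real n + \<beta>) = - (\<alpha> * real n + \<beta> - \<alpha> / 2)"
        by (simp_all add: field_simps)
      show ?thesis unfolding sin_times_cos e sin_minus by simp
    qed
    with Suc show ?case by (simp add: distrib_left mult.assoc)
  qed simp
  hence "2 * sin (\<alpha> / 2) * \<bar>\<Sum>j<n. cos (\<alpha> * real j + \<beta>)\<bar> = \<bar>sin (\<alpha> * real n + \<beta> - \<alpha> / 2) - sin (\<beta> - \<alpha> / 2)\<bar>"
    using assms by (metis abs_mult abs_of_pos mult_pos_pos zero_less_numeral)
  also have "\<dots> \<le> 2"
    using abs_sin_le_one[of "\<alpha> * real n + \<beta> - \<alpha> / 2"] abs_sin_le_one[of "\<beta> - \<alpha> / 2"] by linarith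
  finally show ?thesis using assms by (simp add: field_simps)
qed

lemma Suc_power_diff:
  "(real j + 1) ^ k - real j ^ k = (\<Sum>i<k. real j ^ (k - Suc i) * (real j + 1) ^ i)"
  using power_diff_sumr2[of "real j + 1" k "real j"] by simp

lemma power_diff_bound:
  fixes p q :: real
  assumes "0 \<le> q" "q \<le> p" "p \<le> R"
  shows "p ^ k - q ^ k \<le> real k * R ^ (k - 1) * (p - q)"
proof -
  have S: "(\<Sum>i<k. q ^ (k - Suc i) * p ^ i) \<le> (\<Sum>i<k. R ^ (k - 1))"
  proof (rule sum_mono)
    fix i assume i: "i \<in> {..<k}"
    have "q ^ (k - Suc i) * p ^ i \<le> R ^ (k - Suc i) * R ^ i" using assms by (intro mult_mono power_mono) auto
    also have "\<dots> = R ^ (k - 1)" using i by (simp flip: power_add)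
    finally show "q ^ (k - Suc i) * p ^ i \<le> R ^ (k - 1)" .
  qed
  have "p ^ k - q ^ k = (p - q) * (\<Sum>i<k. q ^ (k - Suc i) * p ^ i)" by (rule power_diff_sumr2)
  also have "\<dots> \<le> (p - q) * (\<Sum>i<k. R ^ (k - 1))" using assms S by (intro mult_left_mono) auto
  finally show ?thesis by (simp add: mult_ac)
qed

context
  fixes \<theta> x :: real and k :: nat
  assumes \<theta>: "0 < \<theta>" "\<theta> < 1" and x: "0 < x"
begin

text \<open>
  The sine arising from \<open>k\<close> derivatives of \<open>sin (2 * pi * real j * \<theta>)\<close>, without the factor
  \<open>(2\<pi>j)\<^sup>k\<close>.
\<close>
definition phase_sin :: "nat \<Rightarrow> real" where
  "phase_sin j = sin (2 * pi * real j * \<theta> + real k * pi / 2)"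

text \<open>
  A discrete antiderivative of \<open>phase_sin\<close>, normalised to have mean 0, so that its own partial sums
  are bounded as well and a second summation by parts is possible.
\<close>
definition phase_prim :: "real \<Rightarrow> real" where
  "phase_prim N = - cos (2 * pi * \<theta> * N + (pi * \<theta> + real k * pi / 2)) / (2 * sin (pi * \<theta>))"

text \<open>
  At \<open>w = 0\<close> the convention \<open>x / 0 = 0\<close> makes the sum empty.
\<close>
definition hyperbola_sum :: "real \<Rightarrow> real" where
  "hyperbola_sum w = (\<Sum>j = 1..nat \<lfloor>x / w\<rfloor>. (real j * w) ^ k * phase_sin j)"

lemma sin_pi_theta_pos: "0 < sin (pi * \<theta>)" using \<theta> by (intro sin_gt_zero) auto

lemma phase_sin_eq: "phase_sin (Suc j) = phase_prim (real (Suc j)) - phase_prim (real j)"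
proof -
  let ?c = "2 * pi * real (Suc j) * \<theta> + real k * pi / 2"
  have 1: "2 * pi * \<theta> * real (Suc j) + (pi * \<theta> + real k * pi / 2) = ?c + pi * \<theta>"
    "2 * pi * \<theta> * real j + (pi * \<theta> + real k * pi / 2) = ?c - pi * \<theta>" by (simp_all add: algebra_simps)
  show ?thesis unfolding phase_prim_def phase_sin_def 1 cos_add cos_diff
    using sin_pi_theta_pos by (simp add: field_simps)
qed

lemma phase_prim_bound: "\<bar>phase_prim N\<bar> \<le> 1 / (2 * sin (pi * \<theta>))"
  unfolding phase_prim_def using sin_pi_theta_pos by (simp add: divide_right_mono abs_mult)

lemma phase_prim_sum_bound: "\<bar>\<Sum>j<n. phase_prim (real j)\<bar> \<le> 1 / (2 * (sin (pi * \<theta>))\<^sup>2)"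
proof -
  have "\<bar>\<Sum>j<n. cos (2 * pi * \<theta> * real j + (pi * \<theta> + real k * pi / 2))\<bar> \<le> 1 / sin (2 * pi * \<theta> / 2)"
    by (rule cos_progression_bound) (use sin_pi_theta_pos in simp)
  hence "\<bar>\<Sum>j<n. cos (2 * pi * \<theta> * real j + (pi * \<theta> + real k * pi / 2))\<bar> / (2 * sin (pi * \<theta>)) \<le> 1 / sin (pi * \<theta>) / (2 * sin (pi * \<theta>))"
    using sin_pi_theta_pos by (intro divide_right_mono) auto
  moreover have "(\<Sum>j<n. phase_prim (real j)) = - ((\<Sum>j<n. cos (2 * pi * \<theta> * real j + (pi * \<theta> + real k * pi / 2))) / (2 * sin (pi * \<theta>)))"
    unfolding phase_prim_def by (simp add: sum_divide_distrib sum_negf)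
  ultimately show ?thesis using sin_pi_theta_pos by (simp add: power2_eq_square)
qed

text \<open>
  Summation by parts.  The last term is present for \<open>k = 0\<close> only; it becomes the cotangent.
\<close>
lemma weighted_phase_sum:
  "(\<Sum>j = 1..N. real j ^ k * phase_sin j) = real N ^ k * phase_prim (real N)
      - (\<Sum>j<N. ((real j + 1) ^ k - real j ^ k) * phase_prim (real j)) - 0 ^ k * phase_prim 0"
proof (induction N)
  case (Suc N)
  have "(\<Sum>j = 1..Suc N. real j ^ k * phase_sin j) = (\<Sum>j = 1..N. real j ^ k * phase_sin j) + real (Suc N) ^ k * phase_sin (Suc N)" by simp
  also have "\<dots> = real (Suc N) ^ k * phase_prim (real (Suc N)) - (\<Sum>j<Suc N. ((real j + 1) ^ k - real j ^ k) * phase_prim (real j)) - 0 ^ k * phase_prim 0"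
    unfolding Suc.IH phase_sin_eq by (simp add: algebra_simps)
  finally show ?case .
qed simp

lemma hyperbola_sum_eq: "hyperbola_sum w = w ^ k * (\<Sum>j = 1..nat \<lfloor>x / w\<rfloor>. real j ^ k * phase_sin j)"
  unfolding hyperbola_sum_def by (simp add: power_mult_distrib sum_distrib_left mult_ac)

text \<open>
  The bound is uniform in the number \<open>N\<close> of terms, so that it also dominates the truncations of
  \<open>hyperbola_sum\<close>.
\<close>
lemma phase_sum_bound:
  assumes "0 < w" "w \<le> x" "real N * w \<le> x"
  shows "\<bar>w ^ k * (\<Sum>j = 1..N. real j ^ k * phase_sin j)\<bar> \<le> 2 * (1 / sin (pi * \<theta>)) * (2 * x) ^ k"
proof -
  have s: "\<bar>\<Sum>j<n. phase_sin (Suc j)\<bar> \<le> 1 / sin (pi * \<theta>)" for n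
  proof -
    have "(\<Sum>j<n. phase_sin (Suc j)) = phase_prim (real n) - phase_prim (real 0)"
      unfolding phase_sin_eq by (rule sum_lessThan_telescope)
    also have "\<bar>\<dots>\<bar> \<le> 1 / (2 * sin (pi * \<theta>)) + 1 / (2 * sin (pi * \<theta>))"
      by (intro order_trans[OF abs_triangle_ineq4] add_mono phase_prim_bound)
    finally show ?thesis by simp
  qed
  have "\<bar>\<Sum>j<N. real (Suc j) ^ k * phase_sin (Suc j)\<bar> \<le> 2 * (1 / sin (pi * \<theta>)) * real (Suc N) ^ k"
    by (rule Abel_bound[where a = "\<lambda>j. real (Suc j) ^ k"]) (use s in \<open>auto intro: power_mono\<close>)
  hence "w ^ k * \<bar>\<Sum>j<N. real (Suc j) ^ k * phase_sin (Suc j)\<bar> \<le> w ^ k * (2 * (1 / sin (pi * \<theta>)) * real (Suc N) ^ k)"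
    using assms by (intro mult_left_mono) auto
  also have "\<dots> = 2 * (1 / sin (pi * \<theta>)) * (w * real (Suc N)) ^ k" by (simp add: power_mult_distrib)
  also have "\<dots> \<le> 2 * (1 / sin (pi * \<theta>)) * (2 * x) ^ k"
    using assms sin_pi_theta_pos by (intro mult_left_mono power_mono) (auto simp: algebra_simps)
  finally show ?thesis using assms by (simp add: abs_mult sum.atLeast1_atMost_eq)
qed

lemma floor_mult_bounds:
  assumes "0 < w" shows "real (nat \<lfloor>x / w\<rfloor>) * w \<le> x" "x - w < real (nat \<lfloor>x / w\<rfloor>) * w"
proof -
  have "0 \<le> x / w" using x assms by simp
  hence "real (nat \<lfloor>x / w\<rfloor>) \<le> x / w" "x / w < real (nat \<lfloor>x / w\<rfloor>) + 1" by linarith+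
  thus "real (nat \<lfloor>x / w\<rfloor>) * w \<le> x" "x - w < real (nat \<lfloor>x / w\<rfloor>) * w"
    using assms by (simp_all add: field_simps)
qed

lemma hyperbola_sum_bound:
  assumes "0 \<le> w" "w \<le> x" shows "\<bar>hyperbola_sum w\<bar> \<le> 2 * (1 / sin (pi * \<theta>)) * (2 * x) ^ k"
proof (cases "w = 0")
  case True thus ?thesis using x sin_pi_theta_pos by (simp add: hyperbola_sum_def)
next
  case False
  thus ?thesis unfolding hyperbola_sum_eq using assms floor_mult_bounds(1)[of w] by (intro phase_sum_bound) auto
qed

text \<open>
  Put \<open>N = \<lfloor>x/w\<rfloor>\<close>.  In \<open>weighted_phase_sum\<close>, multiplied by \<open>w\<^sup>k\<close>, the leading term
  \<open>(wN)\<^sup>k b(N)\<close> has \<open>wN\<close> within \<open>w\<close> of \<open>x\<close>.  The remaining sum has increasing weights of size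
  \<open>N\<^bsup>k-1\<^esup>\<close>, so by \<open>Abel_bound\<close> and the boundedness of the sums of \<open>b\<close> it is
  \<open>O(w\<^sup>k N\<^bsup>k-1\<^esup>) = O(w)\<close>.
\<close>
lemma hyperbola_sum_near_0:
  obtains L where "0 \<le> L" "\<And>w. 0 < w \<Longrightarrow> w \<le> x \<Longrightarrow> \<bar>hyperbola_sum w - (x ^ k * phase_prim (real_of_int \<lfloor>x / w\<rfloor>) - 0 ^ k * phase_prim 0)\<bar> \<le> L * w"
proof -
  define B where "B = 1 / (2 * (sin (pi * \<theta>))\<^sup>2)"
  define A where "A = 1 / (2 * sin (pi * \<theta>))"
  have AB: "0 \<le> A" "0 \<le> B" using sin_pi_theta_pos by (auto simp: A_def B_def)
  have "\<bar>hyperbola_sum w - (x ^ k * phase_prim (real_of_int \<lfloor>x / w\<rfloor>) - 0 ^ k * phase_prim 0)\<bar>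
      \<le> (real k * x ^ (k - 1) * A + 2 * B * (real k * (2 * x) ^ (k - 1))) * w" if w: "0 < w" "w \<le> x" for w
  proof -
    define N where "N = nat \<lfloor>x / w\<rfloor>"
    have fl: "real_of_int \<lfloor>x / w\<rfloor> = real N" using x w unfolding N_def by simp
    have N: "real N * w \<le> x" "x - w < real N * w" using floor_mult_bounds[OF w(1)] unfolding N_def by auto
    let ?R = "\<Sum>j<N. ((real j + 1) ^ k - real j ^ k) * phase_prim (real j)"
    have R: "\<bar>?R\<bar> \<le> 2 * B * ((real N + 1) ^ k - real N ^ k)"
    proof (rule Abel_bound[where a = "\<lambda>j. (real j + 1) ^ k - real j ^ k"])
      show "(real j + 1) ^ k - real j ^ k \<le> (real (Suc j) + 1) ^ k - real (Suc j) ^ k" for j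
        unfolding Suc_power_diff by (intro sum_mono mult_mono power_mono) auto
      show "0 \<le> (real 0 + 1) ^ k - real 0 ^ k" unfolding Suc_power_diff by (intro sum_nonneg) auto
      show "\<bar>\<Sum>j<n. phase_prim (real j)\<bar> \<le> B" for n unfolding B_def by (rule phase_prim_sum_bound)
    qed
    have p: "w ^ k * ((real N + 1) ^ k - real N ^ k) \<le> real k * (2 * x) ^ (k - 1) * w"
    proof -
      have "w ^ k * ((real N + 1) ^ k - real N ^ k) = (real N * w + w) ^ k - (real N * w) ^ k"
      proof -
        have "w * (real N + 1) = real N * w + w" "w * real N = real N * w" by (simp_all add: algebra_simps)
        thus ?thesis unfolding right_diff_distrib power_mult_distrib[symmetric] by (simp only:)
      qed
      also have "\<dots> \<le> real k * (2 * x) ^ (k - 1) * (real N * w + w - real N * w)"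
      proof (rule power_diff_bound)
        show "real N * w + w \<le> 2 * x" using N w by linarith
      qed (use w in simp_all)
      finally show ?thesis by simp
    qed
    have w0: "w ^ k * 0 ^ k = (0::real) ^ k" by (cases k) auto
    have hs: "hyperbola_sum w = (w * real N) ^ k * phase_prim (real N) - w ^ k * ?R - 0 ^ k * phase_prim 0"
      unfolding hyperbola_sum_eq N_def[symmetric] weighted_phase_sum power_mult_distrib
      by (simp only: right_diff_distrib mult.assoc[symmetric] w0)
    have alg: "h - (X * b - z) = - ((X - W) * b) - R" if "h = W * b - R - z" for h X b z W R :: real
      unfolding that by (simp add: algebra_simps)
    have gen: "\<bar>- a - b\<bar> \<le> \<bar>a\<bar> + \<bar>b\<bar>" for a b :: real by linarith
    have "hyperbola_sum w - (x ^ k * phase_prim (real_of_int \<lfloor>x / w\<rfloor>) - 0 ^ k * phase_prim 0) = - ((x ^ k - (w * real N) ^ k) * phase_prim (real N)) - w ^ k * ?R"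
      unfolding fl by (rule alg[OF hs])
    also have "\<bar>\<dots>\<bar> \<le> \<bar>(x ^ k - (w * real N) ^ k) * phase_prim (real N)\<bar> + \<bar>w ^ k * ?R\<bar>" by (rule gen)
    also have "\<dots> \<le> (real k * x ^ (k - 1) * w) * A + 2 * B * (real k * (2 * x) ^ (k - 1) * w)"
    proof (rule add_mono)
      have le: "w * real N \<le> x" using N by (simp add: mult.commute)
      have "x ^ k - (w * real N) ^ k \<le> real k * x ^ (k - 1) * (x - w * real N)"
        using w le by (intro power_diff_bound) auto
      also have "\<dots> \<le> real k * x ^ (k - 1) * w" using N x by (intro mult_left_mono) (auto simp: mult.commute)
      finally have f: "x ^ k - (w * real N) ^ k \<le> real k * x ^ (k - 1) * w" .
      have "(w * real N) ^ k \<le> x ^ k" by (rule power_mono[OF le]) (use w in simp)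
      hence "\<bar>x ^ k - (w * real N) ^ k\<bar> = x ^ k - (w * real N) ^ k" by (simp only: abs_of_nonneg diff_ge_0_iff_ge)
      with f have "\<bar>x ^ k - (w * real N) ^ k\<bar> \<le> real k * x ^ (k - 1) * w" by (simp only:)
      thus "\<bar>(x ^ k - (w * real N) ^ k) * phase_prim (real N)\<bar> \<le> (real k * x ^ (k - 1) * w) * A"
        unfolding abs_mult A_def using phase_prim_bound[of "real N"] x w by (intro mult_mono) auto
      have "\<bar>w ^ k * ?R\<bar> \<le> w ^ k * (2 * B * ((real N + 1) ^ k - real N ^ k))"
        unfolding abs_mult using R w by (intro mult_mono) auto
      also have "\<dots> = 2 * B * (w ^ k * ((real N + 1) ^ k - real N ^ k))" by (rule mult.left_commute)
      also have "\<dots> \<le> 2 * B * (real k * (2 * x) ^ (k - 1) * w)" using p AB by (intro mult_left_mono) auto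
      finally show "\<bar>w ^ k * ?R\<bar> \<le> 2 * B * (real k * (2 * x) ^ (k - 1) * w)" .
    qed
    also have "\<dots> = (real k * x ^ (k - 1) * A + 2 * B * (real k * (2 * x) ^ (k - 1))) * w" by (simp add: algebra_simps)
    finally show ?thesis .
  qed
  thus ?thesis using that[of "real k * x ^ (k - 1) * A + 2 * B * (real k * (2 * x) ^ (k - 1))"] AB x by simp
qed

text \<open>
  Away from 0 only finitely many \<open>j\<close> occur, each cut off at the jump \<open>x/j\<close>.
\<close>
lemma hyperbola_sum_split:
  assumes J: "1 \<le> J" and w: "x / real J < w"
  shows "hyperbola_sum w = (\<Sum>j = 1..<J. if w \<le> x / real j then (real j * w) ^ k * phase_sin j else 0)"
proof -
  have w0: "0 < w" using x J w by (meson divide_pos_pos of_nat_0_less_iff less_trans less_le_trans zero_less_one)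
  have "{1..nat \<lfloor>x / w\<rfloor>} = {j \<in> {1..<J}. w \<le> x / real j}"
  proof (intro subset_antisym subsetI)
    fix j assume j: "j \<in> {1..nat \<lfloor>x / w\<rfloor>}"
    have "real j \<le> x / w"
    proof -
      have "real j \<le> real (nat \<lfloor>x / w\<rfloor>)" using j by simp
      also have "\<dots> \<le> x / w" using x w0 by simp
      finally show ?thesis .
    qed
    hence jw: "real j * w \<le> x" using w0 by (simp add: field_simps)
    hence 1: "w \<le> x / real j" using j by (simp add: field_simps)
    have "x < w * real J" using w J by (simp add: field_simps)
    with jw have "w * real j < w * real J" by (simp add: mult.commute)
    hence "j < J" using w0 by simp
    thus "j \<in> {j \<in> {1..<J}. w \<le> x / real j}" using 1 j by simp
  next
    fix j assume "j \<in> {j \<in> {1..<J}. w \<le> x / real j}"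
    hence j: "1 \<le> j" "w \<le> x / real j" by auto
    hence "real j \<le> x / w" using w0 by (simp add: field_simps)
    hence "int j \<le> \<lfloor>x / w\<rfloor>" by (simp add: le_floor_iff)
    thus "j \<in> {1..nat \<lfloor>x / w\<rfloor>}" using j by simp
  qed
  thus ?thesis unfolding hyperbola_sum_def by (simp only: sum.inter_filter[OF finite_atLeastLessThan])
qed

lemma hyperbola_sum_measurable: "hyperbola_sum \<in> borel_measurable borel"
proof -
  have "(\<lambda>w. \<Sum>j = 1..N. (real j * w) ^ k * phase_sin j) \<in> borel_measurable borel" for N by measurable
  moreover have "(\<lambda>w. nat \<lfloor>x / w\<rfloor>) \<in> measurable borel (count_space UNIV)" by measurable
  ultimately have "(\<lambda>w. (\<lambda>N w. \<Sum>j = 1..N. (real j * w) ^ k * phase_sin j) (nat \<lfloor>x / w\<rfloor>) w) \<in> borel_measurable borel"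
    by (rule measurable_compose_countable)
  thus ?thesis unfolding hyperbola_sum_def[abs_def] .
qed

lemma phase_prim_floor_measurable: "(\<lambda>w. phase_prim (real_of_int \<lfloor>x / w\<rfloor>)) \<in> borel_measurable borel"
  unfolding phase_prim_def by measurable

text \<open>
  Replacing \<open>sin(\<pi>w)\<close> by \<open>\<pi>w\<close> costs a bounded function; the rest is
  \<open>floor_oscillation_tendsto_0\<close>, applicable because \<open>\<theta>\<close> is not an integer.
\<close>
lemma phase_prim_dirichlet_tendsto_0:
  fixes J :: nat
  assumes J: "1 \<le> J" "x / real J \<le> 1 / 2"
  shows "(\<lambda>M. integral {0..x / real J} (\<lambda>w. phase_prim (real_of_int \<lfloor>x / w\<rfloor>) * (sin (2*pi*real M * w) / sin (pi * w)))) \<longlonglongrightarrow> 0"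
proof -
  let ?b = "\<lambda>w. phase_prim (real_of_int \<lfloor>x / w\<rfloor>)"
  let ?h = "x / real J"
  define g where "g w = ?b w * (1 / sin (pi * w) - 1 / (pi * w))" for w
  define A where "A = 1 / (2 * sin (pi * \<theta>))"
  have A0: "0 \<le> A" using sin_pi_theta_pos by (simp add: A_def)
  have bm: "?b \<in> borel_measurable (lebesgue_on {0..?h})" by (rule borel_measurable_imp_lebesgue_on[OF phase_prim_floor_measurable])
  have gm: "g \<in> borel_measurable (lebesgue_on {0..?h})"
  proof -
    have "(\<lambda>w. 1 / sin (pi * w) - 1 / (pi * w)) \<in> borel_measurable (lebesgue_on {0..?h})"
      by (rule borel_measurable_imp_lebesgue_on) measurable
    thus ?thesis unfolding g_def using bm by simp
  qed
  have gb: "\<bar>g w\<bar> \<le> A" if w: "w \<in> {0..?h}" for w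
  proof (cases "w = 0")
    case True thus ?thesis using A0 by (simp add: g_def)
  next
    case False
    moreover have "w \<le> 1 / 2" by (rule order_trans[OF _ J(2)]) (use w in simp)
    ultimately have "\<bar>1 / sin (pi * w) - 1 / (pi * w)\<bar> \<le> 1" using w by (intro inverse_sin_minus_inverse) auto
    hence "\<bar>g w\<bar> \<le> A * 1" unfolding g_def abs_mult using phase_prim_bound A0 unfolding A_def by (intro mult_mono) auto
    thus ?thesis by simp
  qed
  have sm: "(\<lambda>w. sin (2*pi*real M * w) / w) \<in> borel_measurable (lebesgue_on {0..?h})" for M
    by (rule borel_measurable_imp_lebesgue_on) measurable
  have c1: "cis (2 * pi * \<theta>) \<noteq> 1"
  proof
    assume "cis (2 * pi * \<theta>) = 1"
    hence "cos (2 * pi * \<theta>) = 1" by (metis cis.sel(1) one_complex.sel(1))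
    hence "cos (2 * (pi * \<theta>)) = 1" by (simp only: mult.assoc)
    thus False using sin_pi_theta_pos unfolding cos_double_sin by simp
  qed
  have 1: "(\<lambda>M. integral {0..?h} (\<lambda>w. g w * sin (2*pi*real M * w + 0))) \<longlonglongrightarrow> 0"
    by (rule Riemann_Lebesgue_bounded[OF gm gb])
  let ?q = "\<lambda>M w. cos (2 * pi * \<theta> * real_of_int \<lfloor>x / w\<rfloor> + (pi * \<theta> + real k * pi / 2)) * (sin (2*pi*real M * w) / w)"
  have 2: "(\<lambda>M. integral {0..?h} (?q M)) \<longlonglongrightarrow> 0" by (rule floor_oscillation_tendsto_0[OF c1 x J(1)])
  have "(\<lambda>M. integral {0..?h} (\<lambda>w. g w * sin (2*pi*real M * w + 0)) + (- A / pi) * integral {0..?h} (?q M)) \<longlonglongrightarrow> 0 + (- A / pi) * 0"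
    by (intro tendsto_intros 1 2)
  moreover have "integral {0..?h} (\<lambda>w. ?b w * (sin (2*pi*real M * w) / sin (pi * w))) =
     integral {0..?h} (\<lambda>w. g w * sin (2*pi*real M * w + 0)) + (- A / pi) * integral {0..?h} (?q M)" for M
  proof -
    have i1: "(\<lambda>w. g w * sin (2*pi*real M * w + 0)) integrable_on {0..?h}"
    proof (rule bounded_measurable_integrable[where B = A])
      show "(\<lambda>w. g w * sin (2*pi*real M * w + 0)) \<in> borel_measurable (lebesgue_on {0..?h})"
        by (rule borel_measurable_times[OF gm], rule borel_measurable_imp_lebesgue_on) measurable
      fix w assume w: "w \<in> {0..?h}"
      show "norm (g w * sin (2*pi*real M * w + 0)) \<le> A"
        using gb[OF w] mult_left_le[of "\<bar>sin (2*pi*real M * w + 0)\<bar>" "\<bar>g w\<bar>"] by (simp add: abs_mult)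
    qed
    have i2: "?q M integrable_on {0..?h}"
    proof (rule bounded_measurable_integrable[where B = "2*pi*real M"])
      show "?q M \<in> borel_measurable (lebesgue_on {0..?h})"
        by (rule borel_measurable_times[OF _ sm], rule borel_measurable_imp_lebesgue_on) measurable
      fix w assume w: "w \<in> {0..?h}"
      show "norm (?q M w) \<le> 2*pi*real M"
      proof (cases "w = 0")
        case False
        have "norm (?q M w) = \<bar>cos (2 * pi * \<theta> * real_of_int \<lfloor>x / w\<rfloor> + (pi * \<theta> + real k * pi / 2))\<bar> * (\<bar>sin (2*pi*real M * w)\<bar> / \<bar>w\<bar>)"
          by (simp only: real_norm_def abs_mult abs_divide)
        also have "\<dots> \<le> 1 * (\<bar>2*pi*real M * w\<bar> / \<bar>w\<bar>)"
          by (intro mult_mono divide_right_mono abs_sin_x_le_abs_x) auto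
        finally show ?thesis using False w by simp
      qed simp
    qed
    have "?b w * (sin (2*pi*real M * w) / sin (pi * w)) = g w * sin (2*pi*real M * w + 0) + (- A / pi) * ?q M w" for w
    proof -
      have b: "?b w = - A * cos (2 * pi * \<theta> * real_of_int \<lfloor>x / w\<rfloor> + (pi * \<theta> + real k * pi / 2))"
        unfolding phase_prim_def A_def by simp
      have alg: "b * (s / S) = b * (1 / S - 1 / (pi * w)) * s + (- A / pi) * (c * (s / w))" if "b = - A * c" for b s S c :: real
        unfolding that by (simp add: algebra_simps)
      show ?thesis unfolding g_def add_0_right by (rule alg[OF b])
    qed
    hence "integral {0..?h} (\<lambda>w. ?b w * (sin (2*pi*real M * w) / sin (pi * w))) = integral {0..?h} (\<lambda>w. g w * sin (2*pi*real M * w + 0) + (- A / pi) * ?q M w)"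
      by (simp only:)
    also have "\<dots> = integral {0..?h} (\<lambda>w. g w * sin (2*pi*real M * w + 0)) + integral {0..?h} (\<lambda>w. (- A / pi) * ?q M w)"
      by (rule integral_add[OF i1 integrable_on_mult_right[OF i2]])
    also have "integral {0..?h} (\<lambda>w. (- A / pi) * ?q M w) = (- A / pi) * integral {0..?h} (?q M)" by (rule integral_mult_right)
    finally show ?thesis .
  qed
  ultimately show ?thesis by simp
qed

lemma hyperbola_sum_integrable:
  assumes "continuous_on {0..x} c" "0 \<le> p" "q \<le> x"
  shows "(\<lambda>w. hyperbola_sum w * c w) integrable_on {p..q}"
proof -
  have c: "continuous_on {p..q} c" using assms by (intro continuous_on_subset[OF assms(1)]) auto
  obtain B where B: "\<forall>w\<in>{p..q}. \<bar>c w\<bar> \<le> B"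
    using compact_imp_bounded[OF compact_continuous_image[OF c]] by (auto simp: bounded_iff)
  show ?thesis
  proof (rule bounded_measurable_integrable[where B = "2 * (1 / sin (pi * \<theta>)) * (2 * x) ^ k * B"])
    have "c \<in> borel_measurable (lebesgue_on {p..q})" using c by (intro continuous_imp_measurable_on_sets_lebesgue) auto
    thus "(\<lambda>w. hyperbola_sum w * c w) \<in> borel_measurable (lebesgue_on {p..q})"
      by (intro borel_measurable_times borel_measurable_imp_lebesgue_on[OF hyperbola_sum_measurable])
    fix w assume w: "w \<in> {p..q}"
    show "norm (hyperbola_sum w * c w) \<le> 2 * (1 / sin (pi * \<theta>)) * (2 * x) ^ k * B"
      unfolding real_norm_def abs_mult using w assms B x sin_pi_theta_pos by (intro mult_mono hyperbola_sum_bound) auto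
  qed
qed

text \<open>
  Once the oscillating part is removed, the integrand has the limit \<open>-0\<^sup>k b(0) c(0)\<close> at 0 with a
  Lipschitz bound there, and the kernel takes half of this value.
\<close>
lemma hyperbola_sum_dirichlet_near_0:
  fixes J :: nat and c :: "real \<Rightarrow> real"
  assumes J: "1 \<le> J" "x / real J \<le> 1 / 2" and c: "L-lipschitz_on {0..x} c"
  shows "(\<lambda>M. integral {0..x / real J} (\<lambda>w. hyperbola_sum w * (c w * dirichlet_kernel M w))) \<longlonglongrightarrow> - (0 ^ k * phase_prim 0) * c 0 / 2"
proof -
  let ?h = "x / real J"
  have h: "0 < ?h" "?h \<le> x" using x J by (auto simp: field_simps mult_le_cancel_left1)
  let ?b = "\<lambda>w. phase_prim (real_of_int \<lfloor>x / w\<rfloor>)"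
  define A where "A = 1 / (2 * sin (pi * \<theta>))"
  have A0: "0 \<le> A" using sin_pi_theta_pos by (simp add: A_def)
  have L0: "0 \<le> L" using c by (rule lipschitz_on_nonneg)
  have cc: "continuous_on {0..x} c" using c by (rule lipschitz_on_continuous_on)
  obtain K where K: "0 \<le> K" "\<And>w. 0 < w \<Longrightarrow> w \<le> x \<Longrightarrow> \<bar>hyperbola_sum w - (x ^ k * ?b w - 0 ^ k * phase_prim 0)\<bar> \<le> K * w"
    by (rule hyperbola_sum_near_0) blast
  obtain B where "\<forall>w\<in>{0..x}. \<bar>c w\<bar> \<le> B"
    using compact_imp_bounded[OF compact_continuous_image[OF cc]] by (auto simp: bounded_iff)
  hence B: "\<bar>c w\<bar> \<le> B" if "w \<in> {0..x}" for w using that by blast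
  \<comment> \<open>Only the value \<open>c 0\<close> is kept in the subtracted part, so that the oscillation result, which has
    no factor \<open>c\<close>, applies to it.\<close>
  define p where "p w = hyperbola_sum w * c w - x ^ k * c 0 * ?b w" for w
  have bm: "?b \<in> borel_measurable (lebesgue_on S)" for S by (rule borel_measurable_imp_lebesgue_on[OF phase_prim_floor_measurable])
  have hm: "hyperbola_sum \<in> borel_measurable (lebesgue_on S)" for S by (rule borel_measurable_imp_lebesgue_on[OF hyperbola_sum_measurable])
  have cm: "c \<in> borel_measurable (lebesgue_on {0..?h})"
    by (rule continuous_imp_measurable_on_sets_lebesgue[OF continuous_on_subset[OF cc]]) (use h in auto)
  have pm: "p \<in> borel_measurable (lebesgue_on {0..?h})" unfolding p_def using bm hm cm by simp
  have pl: "\<bar>p w - - (0 ^ k * phase_prim 0) * c 0\<bar> \<le> (K * B + (x ^ k * A + A) * L) * w" if w: "w \<in> {0<..?h}" for w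
  proof -
    have w': "0 < w" "w \<le> x" "w \<in> {0..x}" using w h by auto
    have "p w - - (0 ^ k * phase_prim 0) * c 0 = (hyperbola_sum w - (x ^ k * ?b w - 0 ^ k * phase_prim 0)) * c w + (x ^ k * ?b w - 0 ^ k * phase_prim 0) * (c w - c 0)"
      unfolding p_def by (simp add: algebra_simps)
    also have "\<bar>\<dots>\<bar> \<le> (K * w) * B + (x ^ k * A + A) * (L * w)"
    proof (rule order_trans[OF abs_triangle_ineq add_mono])
      show "\<bar>(hyperbola_sum w - (x ^ k * ?b w - 0 ^ k * phase_prim 0)) * c w\<bar> \<le> (K * w) * B"
        unfolding abs_mult using w' K B by (intro mult_mono) auto
      have "\<bar>x ^ k * ?b w - 0 ^ k * phase_prim 0\<bar> \<le> \<bar>x ^ k * ?b w\<bar> + \<bar>0 ^ k * phase_prim 0\<bar>" by (rule abs_triangle_ineq4)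
      also have "\<dots> \<le> x ^ k * A + 1 * A"
        unfolding abs_mult using phase_prim_bound x A0 unfolding A_def by (intro add_mono mult_mono) (auto simp: power_0_left)
      finally have 1: "\<bar>x ^ k * ?b w - 0 ^ k * phase_prim 0\<bar> \<le> x ^ k * A + A" by simp
      have 2: "\<bar>c w - c 0\<bar> \<le> L * w" using lipschitz_onD[OF c w'(3), of 0] x w' by (simp add: dist_real_def)
      show "\<bar>(x ^ k * ?b w - 0 ^ k * phase_prim 0) * (c w - c 0)\<bar> \<le> (x ^ k * A + A) * (L * w)"
        unfolding abs_mult using 1 2 A0 x by (intro mult_mono) auto
    qed
    finally show ?thesis by (simp add: algebra_simps)
  qed
  have 1: "(\<lambda>M. integral {0..?h} (\<lambda>w. p w * (sin (2*pi*real M * w) / sin (pi * w)))) \<longlonglongrightarrow> (- (0 ^ k * phase_prim 0) * c 0) / 2"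
    by (rule Dirichlet_quotient_tendsto[OF pm h(1) J(2) pl])
  have 2: "(\<lambda>M. integral {0..?h} (\<lambda>w. ?b w * (sin (2*pi*real M * w) / sin (pi * w)))) \<longlonglongrightarrow> 0"
    by (rule phase_prim_dirichlet_tendsto_0[OF J])
  have "(\<lambda>M. integral {0..?h} (\<lambda>w. p w * (sin (2*pi*real M * w) / sin (pi * w))) + (x ^ k * c 0) * integral {0..?h} (\<lambda>w. ?b w * (sin (2*pi*real M * w) / sin (pi * w))))
     \<longlonglongrightarrow> (- (0 ^ k * phase_prim 0) * c 0) / 2 + (x ^ k * c 0) * 0"
    by (intro tendsto_add tendsto_mult tendsto_const 1 2)
  moreover have "integral {0..?h} (\<lambda>w. hyperbola_sum w * (c w * dirichlet_kernel M w)) =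
     integral {0..?h} (\<lambda>w. p w * (sin (2*pi*real M * w) / sin (pi * w))) + (x ^ k * c 0) * integral {0..?h} (\<lambda>w. ?b w * (sin (2*pi*real M * w) / sin (pi * w)))" for M
  proof -
    have D: "dirichlet_kernel M w = sin (2*pi*real M * w) / sin (pi * w)" if "w \<in> {0..?h} - {0}" for w
    proof -
      have "w \<le> 1 / 2" by (rule order_trans[OF _ J(2)]) (use that in simp)
      hence "sin (pi * w) \<noteq> 0" using sin_gt_zero[of "pi * w"] that by auto
      thus ?thesis using sin_times_dirichlet_kernel[of w M] by (simp add: field_simps)
    qed
    have dc: "continuous_on {0..?h} (dirichlet_kernel M)" by (intro continuous_intros)
    have bi: "(\<lambda>w. ?b w * dirichlet_kernel M w) integrable_on {0..?h}"
    proof -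
      obtain Q where Q: "\<forall>w\<in>{0..?h}. \<bar>dirichlet_kernel M w\<bar> \<le> Q"
        using compact_imp_bounded[OF compact_continuous_image[OF dc]] by (auto simp: bounded_iff)
      show ?thesis
      proof (rule bounded_measurable_integrable[where B = "A * Q"])
        show "(\<lambda>w. ?b w * dirichlet_kernel M w) \<in> borel_measurable (lebesgue_on {0..?h})"
          by (intro borel_measurable_times bm continuous_imp_measurable_on_sets_lebesgue[OF dc]) auto
        fix w assume "w \<in> {0..?h}"
        thus "norm (?b w * dirichlet_kernel M w) \<le> A * Q"
          unfolding real_norm_def abs_mult using Q phase_prim_bound A0 unfolding A_def by (intro mult_mono) auto
      qed
    qed
    have hi: "(\<lambda>w. hyperbola_sum w * (c w * dirichlet_kernel M w)) integrable_on {0..?h}"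
      by (rule hyperbola_sum_integrable) (use h in \<open>auto intro!: continuous_on_mult cc continuous_dirichlet_kernel\<close>)
    have a: "integral {0..?h} (\<lambda>w. ?b w * (sin (2*pi*real M * w) / sin (pi * w))) = integral {0..?h} (\<lambda>w. ?b w * dirichlet_kernel M w)"
      by (rule integral_spike[of "{0}"]) (use D in auto)
    have b: "integral {0..?h} (\<lambda>w. p w * (sin (2*pi*real M * w) / sin (pi * w))) = integral {0..?h} (\<lambda>w. hyperbola_sum w * (c w * dirichlet_kernel M w) - (x ^ k * c 0) * (?b w * dirichlet_kernel M w))"
    proof (rule integral_spike[of "{0}"])
      fix w assume "w \<in> {0..?h} - {0}"
      show "hyperbola_sum w * (c w * dirichlet_kernel M w) - (x ^ k * c 0) * (?b w * dirichlet_kernel M w) = p w * (sin (2*pi*real M * w) / sin (pi * w))"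
        unfolding D[OF \<open>w \<in> {0..?h} - {0}\<close>, symmetric] p_def by (simp add: algebra_simps)
    qed simp
    have "\<dots> = integral {0..?h} (\<lambda>w. hyperbola_sum w * (c w * dirichlet_kernel M w)) - (x ^ k * c 0) * integral {0..?h} (\<lambda>w. ?b w * dirichlet_kernel M w)"
      by (simp only: Henstock_Kurzweil_Integration.integral_diff[OF hi integrable_on_mult_right[OF bi]] integral_mult_right)
    thus ?thesis unfolding a b by simp
  qed
  ultimately show ?thesis by simp
qed

lemma lipschitz_if_continuous_derivative:
  fixes p p' :: "real \<Rightarrow> real"
  assumes D: "\<And>w. (p has_real_derivative p' w) (at w)" and c: "continuous_on {a..b} p'"
  obtains L where "L-lipschitz_on {a..b} p"
proof -
  obtain B where B: "\<forall>w\<in>{a..b}. \<bar>p' w\<bar> \<le> B"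
    using compact_imp_bounded[OF compact_continuous_image[OF c]] by (auto simp: bounded_iff)
  have "\<bar>B\<bar>-lipschitz_on {a..b} p"
  proof (rule lipschitz_onI)
    fix u v assume uv: "u \<in> {a..b}" "v \<in> {a..b}"
    have "norm (p u - p v) \<le> \<bar>B\<bar> * norm (u - v)"
    proof (rule field_differentiable_bound[of "{a..b}" p p'])
      show "(p has_field_derivative p' z) (at z within {a..b})" if "z \<in> {a..b}" for z
        by (rule has_field_derivative_at_within[OF D])
      show "norm (p' z) \<le> \<bar>B\<bar>" if "z \<in> {a..b}" for z
        using B that by (auto intro: order_trans[OF _ abs_ge_self])
    qed (use uv in auto)
    thus "dist (p u) (p v) \<le> \<bar>B\<bar> * dist u v" by (simp add: dist_norm)
  qed simp
  thus ?thesis by (rule that)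
qed

lemma integral_truncated:
  fixes F :: "real \<Rightarrow> real"
  assumes "p \<le> q" "1 \<le> j" "x \<le> q" "p \<le> x / real j"
  shows "integral {p..q} (\<lambda>w. if w \<le> x / real j then F w else 0) = integral {p..x / real j} F"
proof -
  have "x / real j \<le> x / 1" using assms x by (intro divide_left_mono) auto
  hence e: "{..x / real j} \<inter> {p..q} = {p..x / real j}" using assms by auto
  have "integral {p..q} (\<lambda>w. if w \<in> {..x / real j} then F w else 0) = integral ({..x / real j} \<inter> {p..q}) F"
    by (rule Henstock_Kurzweil_Integration.integral_restrict_Int)
  thus ?thesis unfolding e by simp
qed

lemma integrable_truncated:
  fixes F :: "real \<Rightarrow> real"
  assumes "p \<le> q" "1 \<le> j" "x \<le> q" "p \<le> x / real j" and F: "continuous_on {p..q} F"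
  shows "(\<lambda>w. if w \<le> x / real j then F w else 0) integrable_on {p..q}"
proof -
  have "x / real j \<le> x / 1" using assms x by (intro divide_left_mono) auto
  hence e: "{..x / real j} \<inter> {p..q} = {p..x / real j}" using assms by auto
  have "F integrable_on {p..x / real j}"
    by (intro integrable_continuous_real continuous_on_subset[OF F]) (use e in auto)
  hence "(\<lambda>w. if w \<in> {..x / real j} then F w else 0) integrable_on {p..q}"
    unfolding integrable_restrict_Int e .
  thus ?thesis by simp
qed

text \<open>
  The interval is cut at a point \<open>h \<le> 1/2\<close>.  Left of \<open>h\<close> only the integer 0 matters.  Right of \<open>h\<close>,
  \<open>hyperbola_sum\<close> is a finite sum of smooth functions truncated at \<open>x/j\<close>, and each
  collects its values at the integers \<open>l \<le> x/j\<close>, with weight \<open>1/2\<close> exactly when \<open>jl = x\<close>.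
\<close>
lemma hyperbola_sum_dirichlet_tendsto:
  fixes c c' :: "real \<Rightarrow> real"
  assumes D: "\<And>w. (c has_real_derivative c' w) (at w)" and c': "continuous_on UNIV c'"
  shows "(\<lambda>M. integral {0..x} (\<lambda>w. hyperbola_sum w * (c w * dirichlet_kernel M w))) \<longlonglongrightarrow>
      primed_sum x (\<lambda>l j. (-1) ^ l * ((real j * real l) ^ k * phase_sin j * c (real l))) - 0 ^ k * phase_prim 0 * c 0 / 2"
proof -
  have cc: "continuous_on S c" for S using D by (meson DERIV_isCont continuous_at_imp_continuous_on)
  \<comment> \<open>Large enough for \<open>h = x/J \<le> 1/2\<close> and for \<open>{1..<J}\<close> to contain every \<open>j \<le> x\<close>.\<close>
  define J where "J = nat \<lceil>2 * x\<rceil> + 2"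
  have J1: "1 \<le> J" by (simp add: J_def)
  have J2: "2 * x < real J" unfolding J_def by linarith
  have Jx: "x / real J \<le> 1 / 2" using J1 J2 by (simp add: field_simps)
  define h where "h = x / real J"
  have h: "0 < h" "h \<le> 1 / 2" using Jx x J1 by (auto simp: h_def)
  have hj: "h \<le> x / real j" if "1 \<le> j" "j \<le> J" for j
    unfolding h_def using that x by (intro divide_left_mono) auto
  have hx: "h \<le> x" using hj[of 1] J1 by simp
  let ?F = "\<lambda>j w. (real j * w) ^ k * phase_sin j * c w"
  obtain L where L: "L-lipschitz_on {0..x} c"
    by (rule lipschitz_if_continuous_derivative[OF D continuous_on_subset[OF c' subset_UNIV]])
  have near: "(\<lambda>M. integral {0..h} (\<lambda>w. hyperbola_sum w * (c w * dirichlet_kernel M w))) \<longlonglongrightarrow> - (0 ^ k * phase_prim 0) * c 0 / 2"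
    unfolding h_def by (rule hyperbola_sum_dirichlet_near_0[OF J1 Jx L])
  have piece: "(\<lambda>M. integral {h..x / real j} (\<lambda>w. ?F j w * dirichlet_kernel M w)) \<longlonglongrightarrow>
      (\<Sum>l = 1..nat \<lfloor>x / real j\<rfloor>. (if real l = x / real j then 1/2 else 1) * ((-1) ^ l * ?F j (real l)))" if j: "j \<in> {1..<J}" for j
  proof -
    define F' where "F' w = (real k * (real j * w) ^ (k - Suc 0) * real j * phase_sin j) * c w + c' w * ((real j * w) ^ k * phase_sin j)" for w
    have "((\<lambda>w. (real j * w) ^ k) has_real_derivative real k * (real j * w) ^ (k - Suc 0) * real j) (at w)" for w
      by (rule derivative_eq_intros refl | simp)+
    hence "(?F j has_real_derivative F' w) (at w)" for w
      unfolding F'_def by (intro DERIV_mult D DERIV_cmult_right)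
    moreover have "continuous_on {0..x} F'"
      unfolding F'_def by (intro continuous_intros cc continuous_on_subset[OF c' subset_UNIV])
    ultimately obtain L where L: "L-lipschitz_on {0..x} (?F j)"
      by (rule lipschitz_if_continuous_derivative)
    have "x / real j \<le> x / 1" using j x by (intro divide_left_mono) auto
    thus ?thesis using j h hj[of j] by (intro dirichlet_kernel_integral_tendsto[OF L]) auto
  qed
  have far: "integral {h..x} (\<lambda>w. hyperbola_sum w * (c w * dirichlet_kernel M w)) = (\<Sum>j = 1..<J. integral {h..x / real j} (\<lambda>w. ?F j w * dirichlet_kernel M w))" for M
  proof -
    let ?G = "\<lambda>j w. if w \<le> x / real j then ?F j w * dirichlet_kernel M w else 0"
    have i: "?G j integrable_on {h..x}" if "j \<in> {1..<J}" for j
      using that hx hj[of j] by (intro integrable_truncated continuous_intros cc) auto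
    have "integral {h..x} (\<lambda>w. hyperbola_sum w * (c w * dirichlet_kernel M w)) = integral {h..x} (\<lambda>w. \<Sum>j = 1..<J. ?G j w)"
    proof (rule integral_spike[of "{h}"])
      fix w assume "w \<in> {h..x} - {h}"
      hence "x / real J < w" by (auto simp: h_def)
      note hs = hyperbola_sum_split[OF J1 this]
      show "(\<Sum>j = 1..<J. ?G j w) = hyperbola_sum w * (c w * dirichlet_kernel M w)"
        unfolding hs sum_distrib_right by (intro sum.cong) auto
    qed simp
    also have "\<dots> = (\<Sum>j = 1..<J. integral {h..x} (?G j))" by (rule integral_sum) (use i in auto)
    also have "\<dots> = (\<Sum>j = 1..<J. integral {h..x / real j} (\<lambda>w. ?F j w * dirichlet_kernel M w))"
      using hx hj by (intro sum.cong integral_truncated) auto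
    finally show ?thesis .
  qed
  have "(\<lambda>M. integral {0..h} (\<lambda>w. hyperbola_sum w * (c w * dirichlet_kernel M w)) + (\<Sum>j = 1..<J. integral {h..x / real j} (\<lambda>w. ?F j w * dirichlet_kernel M w)))
     \<longlonglongrightarrow> - (0 ^ k * phase_prim 0) * c 0 / 2 + (\<Sum>j = 1..<J. \<Sum>l = 1..nat \<lfloor>x / real j\<rfloor>. (if real l = x / real j then 1/2 else 1) * ((-1) ^ l * ?F j (real l)))"
    by (intro tendsto_add near tendsto_sum piece)
  moreover have "integral {0..h} (\<lambda>w. hyperbola_sum w * (c w * dirichlet_kernel M w)) + (\<Sum>j = 1..<J. integral {h..x / real j} (\<lambda>w. ?F j w * dirichlet_kernel M w))
      = integral {0..x} (\<lambda>w. hyperbola_sum w * (c w * dirichlet_kernel M w))" for M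
    unfolding far[symmetric]
  proof (rule Henstock_Kurzweil_Integration.integral_combine)
    show "(\<lambda>w. hyperbola_sum w * (c w * dirichlet_kernel M w)) integrable_on {0..x}"
      by (rule hyperbola_sum_integrable) (auto intro!: continuous_intros cc)
  qed (use h hx in auto)
  moreover have "(\<Sum>j = 1..<J. \<Sum>l = 1..nat \<lfloor>x / real j\<rfloor>. (if real l = x / real j then 1/2 else 1) * ((-1) ^ l * ?F j (real l)))
      = primed_sum x (\<lambda>l j. (-1) ^ l * ((real j * real l) ^ k * phase_sin j * c (real l)))"
  proof -
    have "(\<Sum>j = 1..<J. \<Sum>l = 1..nat \<lfloor>x / real j\<rfloor>. (if real l = x / real j then 1/2 else 1) * ((-1) ^ l * ?F j (real l)))
      = (\<Sum>(j, l) \<in> Sigma {1..<J} (\<lambda>j. {1..nat \<lfloor>x / real j\<rfloor>}). (if real l = x / real j then 1/2 else 1) * ((-1) ^ l * ?F j (real l)))"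
      by (rule sum.Sigma) auto
    also have "\<dots> = (\<Sum>(l, j) \<in> {(l, j). 1 \<le> l \<and> 1 \<le> j \<and> real (l * j) \<le> x}. (if real (l * j) = x then 1/2 else 1) * ((-1) ^ l * ?F j (real l)))"
    proof (rule sum.reindex_bij_witness[where i = prod.swap and j = prod.swap])
      fix a assume "a \<in> Sigma {1..<J} (\<lambda>j. {1..nat \<lfloor>x / real j\<rfloor>})"
      then obtain j l where a: "a = (j, l)" "1 \<le> j" "j < J" "1 \<le> l" "l \<le> nat \<lfloor>x / real j\<rfloor>" by auto
      have "real l \<le> real (nat \<lfloor>x / real j\<rfloor>)" using a by simp
      also have "\<dots> \<le> x / real j" using x by simp
      finally have "real l * real j \<le> x" using a by (simp add: field_simps)
      thus "prod.swap a \<in> {(l, j). 1 \<le> l \<and> 1 \<le> j \<and> real (l * j) \<le> x}" using a by simp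
      show "(case prod.swap a of (l, j) \<Rightarrow> (if real (l * j) = x then 1/2 else 1) * ((-1) ^ l * ?F j (real l)))
         = (case a of (j, l) \<Rightarrow> (if real l = x / real j then 1/2 else 1) * ((-1) ^ l * ?F j (real l)))"
      proof -
        have "(real (l * j) = x) = (real l = x / real j)" using a by (simp add: field_simps)
        thus ?thesis unfolding a(1) by simp
      qed
    next
      fix b assume "b \<in> {(l, j). 1 \<le> l \<and> 1 \<le> j \<and> real (l * j) \<le> x}"
      then obtain l j where b: "b = (l, j)" "1 \<le> l" "1 \<le> j" "real (l * j) \<le> x" by auto
      have "real l \<le> x / real j" using b by (simp add: field_simps)
      hence 1: "l \<le> nat \<lfloor>x / real j\<rfloor>" by (simp add: le_nat_floor)
      have "1 * real j \<le> real l * real j" using b by (intro mult_right_mono) auto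
      also have "\<dots> \<le> x" using b(4) by simp
      finally have "real j \<le> x" by simp
      hence "real j < real J" using J2 x by linarith
      thus "prod.swap b \<in> Sigma {1..<J} (\<lambda>j. {1..nat \<lfloor>x / real j\<rfloor>})" using b 1 by simp
    qed auto
    finally show ?thesis unfolding primed_sum_def .
  qed
  ultimately show ?thesis by simp
qed

lemma truncated_sum_eq:
  assumes "0 < w"
  shows "(\<Sum>j = 1..J. if w \<le> x / real j then (real j * w) ^ k * phase_sin j else 0)
     = w ^ k * (\<Sum>j = 1..min J (nat \<lfloor>x / w\<rfloor>). real j ^ k * phase_sin j)"
proof -
  have "{j \<in> {1..J}. w \<le> x / real j} = {1..min J (nat \<lfloor>x / w\<rfloor>)}"
  proof (intro subset_antisym subsetI)
    fix j assume "j \<in> {j \<in> {1..J}. w \<le> x / real j}"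
    hence j: "1 \<le> j" "j \<le> J" "w \<le> x / real j" by auto
    hence "real j \<le> x / w" using assms by (simp add: field_simps)
    hence "j \<le> nat \<lfloor>x / w\<rfloor>" by (simp add: le_nat_floor)
    thus "j \<in> {1..min J (nat \<lfloor>x / w\<rfloor>)}" using j by simp
  next
    fix j assume j: "j \<in> {1..min J (nat \<lfloor>x / w\<rfloor>)}"
    have "real j \<le> real (nat \<lfloor>x / w\<rfloor>)" using j by simp
    also have "\<dots> \<le> x / w" using x assms by simp
    finally have "w \<le> x / real j" using assms j by (simp add: field_simps)
    thus "j \<in> {j \<in> {1..J}. w \<le> x / real j}" using j by simp
  qed
  hence "(\<Sum>j = 1..J. if w \<le> x / real j then (real j * w) ^ k * phase_sin j else 0)
      = (\<Sum>j = 1..min J (nat \<lfloor>x / w\<rfloor>). (real j * w) ^ k * phase_sin j)"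
    by (simp only: sum.inter_filter[OF finite_atLeastAtMost, symmetric])
  thus ?thesis by (simp add: power_mult_distrib sum_distrib_left mult_ac)
qed

text \<open>
  Summation over \<open>j\<close> and integration are interchanged by bounded convergence.  The individual
  terms are of size \<open>1/j\<close>; the uniform bound on partial sums comes from the oscillation of
  \<open>phase_sin\<close>.
\<close>
lemma hyperbola_sum_integral_series:
  fixes G :: "real \<Rightarrow> real"
  assumes G: "continuous_on {0..x} G"
  shows "(\<lambda>J. \<Sum>j = 1..J. integral {0..x / real j} (\<lambda>w. (real j * w) ^ k * phase_sin j * G w)) \<longlonglongrightarrow> integral {0..x} (\<lambda>w. hyperbola_sum w * G w)"
proof -
  let ?T = "\<lambda>J w. \<Sum>j = 1..J. if w \<le> x / real j then (real j * w) ^ k * phase_sin j * G w else 0"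
  \<comment> \<open>At \<open>w = 0\<close> nothing is truncated, and \<open>?T J 0\<close> need not converge when \<open>k = 0\<close>.\<close>
  let ?f = "\<lambda>J w. if w = 0 then 0 else ?T J w"
  obtain B where B: "\<forall>w\<in>{0..x}. \<bar>G w\<bar> \<le> B"
    using compact_imp_bounded[OF compact_continuous_image[OF G]] by (auto simp: bounded_iff)
  have i: "(\<lambda>w. if w \<le> x / real j then (real j * w) ^ k * phase_sin j * G w else 0) integrable_on {0..x}" if "1 \<le> j" for j
    using that x by (intro integrable_truncated continuous_intros G) auto
  have Ti: "?T J integrable_on {0..x}" for J by (intro integrable_sum i) auto
  have Tf: "integral {0..x} (?f J) = (\<Sum>j = 1..J. integral {0..x / real j} (\<lambda>w. (real j * w) ^ k * phase_sin j * G w))" for J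
  proof -
    have "integral {0..x} (?f J) = integral {0..x} (?T J)" by (rule integral_spike[of "{0}"]) auto
    also have "\<dots> = (\<Sum>j = 1..J. integral {0..x} (\<lambda>w. if w \<le> x / real j then (real j * w) ^ k * phase_sin j * G w else 0))"
      by (rule integral_sum) (use i in auto)
    also have "\<dots> = (\<Sum>j = 1..J. integral {0..x / real j} (\<lambda>w. (real j * w) ^ k * phase_sin j * G w))"
      using x by (intro sum.cong integral_truncated) auto
    finally show ?thesis .
  qed
  have Tw: "?T J w = w ^ k * (\<Sum>j = 1..min J (nat \<lfloor>x / w\<rfloor>). real j ^ k * phase_sin j) * G w" if "0 < w" for J w
    unfolding truncated_sum_eq[OF that, symmetric] sum_distrib_right by (intro sum.cong) auto
  have "(\<lambda>J. integral {0..x} (?f J)) \<longlonglongrightarrow> integral {0..x} (\<lambda>w. hyperbola_sum w * G w)"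
  proof (rule dominated_convergence(2)[where h = "\<lambda>_. 2 * (1 / sin (pi * \<theta>)) * (2 * x) ^ k * B"])
    show "?f J integrable_on {0..x}" for J
      by (rule integrable_spike[OF Ti[of J], of "{0}"]) auto
    fix w assume w: "w \<in> {0..x}"
    show "norm (?f J w) \<le> 2 * (1 / sin (pi * \<theta>)) * (2 * x) ^ k * B" for J
    proof (cases "w = 0")
      case True
      have "\<bar>G 0\<bar> \<le> B" using B x by simp
      hence "0 \<le> B" by (rule order_trans[OF abs_ge_zero])
      thus ?thesis using True x sin_pi_theta_pos by simp
    next
      case False
      hence w0: "0 < w" using w by simp
      have n: "real (min J (nat \<lfloor>x / w\<rfloor>)) * w \<le> x"
      proof -
        have "real (min J (nat \<lfloor>x / w\<rfloor>)) * w \<le> real (nat \<lfloor>x / w\<rfloor>) * w" using w0 by (intro mult_right_mono) auto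
        thus ?thesis using floor_mult_bounds(1)[OF w0] by linarith
      qed
      have "norm (?f J w) = \<bar>w ^ k * (\<Sum>j = 1..min J (nat \<lfloor>x / w\<rfloor>). real j ^ k * phase_sin j)\<bar> * \<bar>G w\<bar>"
        using False by (simp only: if_False Tw[OF w0] real_norm_def abs_mult)
      also have "\<dots> \<le> 2 * (1 / sin (pi * \<theta>)) * (2 * x) ^ k * B"
        using w w0 n B x sin_pi_theta_pos by (intro mult_mono phase_sum_bound) auto
      finally show ?thesis .
    qed
    show "(\<lambda>J. ?f J w) \<longlonglongrightarrow> hyperbola_sum w * G w"
    proof (cases "w = 0")
      case True thus ?thesis by (simp add: hyperbola_sum_def)
    next
      case False
      hence w0: "0 < w" using w by simp
      have "\<forall>\<^sub>F J in sequentially. ?f J w = hyperbola_sum w * G w"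
        using eventually_ge_at_top[of "nat \<lfloor>x / w\<rfloor>"]
      proof eventually_elim
        case (elim J)
        hence "min J (nat \<lfloor>x / w\<rfloor>) = nat \<lfloor>x / w\<rfloor>" by simp
        thus ?case using False by (simp only: if_False Tw[OF w0] hyperbola_sum_eq)
      qed
      thus ?thesis by (rule tendsto_eventually)
    qed
  qed auto
  thus ?thesis unfolding Tf .
qed

end

section \<open>Summation of the Bessel series\<close>

text \<open>
  Poisson summation for one of the four families of terms.  In the cosine transform the parameters
  \<open>\<kappa> = 4\<pi>\<^sup>2aj\<close> and \<open>w = x/j\<close>, of which only the product is prescribed, are chosen so
  that the frequency \<open>\<kappa>/(2\<pi>j) = 2\<pi>a\<close> is independent of \<open>j\<close>.
\<close>
lemma one_sided_bessel_series:
  fixes a x \<theta> :: real and k :: nat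
  assumes a: "0 < a" and x: "0 < x" and \<theta>: "0 < \<theta>" "\<theta> < 1"
  defines "Y \<equiv> \<lambda>j. integral {0..x / real j} (\<lambda>w. (real j * w) ^ k * sin (2 * pi * real j * \<theta> + 2 * pi * a * w)) / (pi * x ^ Suc k)"
  assumes Z: "(\<lambda>N. integral {0..real N} (\<lambda>b. clifford_moment k ((4 * pi\<^sup>2 * x * a) * b))) \<longlonglongrightarrow> Z"
  shows "\<exists>S. (\<lambda>j. Y (Suc j)) sums S \<and> (\<lambda>n. clifford_moment k (4 * pi\<^sup>2 * x * a * (real n + \<theta>))) sums (Z + S)"
proof -
  define c where "c = 4 * pi\<^sup>2 * x * a"
  have c0: "0 < c" using a x by (simp add: c_def)
  obtain K where K: "\<And>b. 0 \<le> b \<Longrightarrow> \<bar>c * clifford_moment1 (Suc k) (c * b)\<bar> \<le> K * (1 + b) powr (-5/4)"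
    using clifford_moment1_decay_scaled[OF c0] by metis
  have D: "((\<lambda>b. clifford_moment k (c * b)) has_real_derivative - (c * clifford_moment1 (Suc k) (c * b))) (at b)" for b
    by (rule DERIV_cong[OF DERIV_chain2[OF DERIV_clifford_moment DERIV_cmult_Id]]) simp
  define d where "d j = integral {0..x / real j} (\<lambda>w. w ^ k * sin (2*pi*real j * \<theta> + (4 * pi\<^sup>2 * a * real j) * w / (2*pi*real j))) / (2*pi*real j * (x / real j) ^ Suc k)" for j
  have lim: "(\<lambda>N. integral {0..real N} (\<lambda>b. clifford_moment k (c * b) * cos (2*pi*real j * (b - \<theta>)))) \<longlonglongrightarrow> d j" if j: "1 \<le> j" for j
  proof -
    have e: "4 * pi\<^sup>2 * a * real j * (x / real j) * b = c * b" for b using j by (simp add: c_def)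
    have "0 < 4 * pi\<^sup>2 * a * real j" "0 < x / real j" using a x j by auto
    from clifford_moment_cos_transform[OF this j, of k \<theta>] show ?thesis unfolding e d_def .
  qed
  have dY: "2 * d j = Y j" if j: "1 \<le> j" for j
  proof -
    have arg: "(4 * pi\<^sup>2 * a * real j) * w / (2*pi*real j) = 2 * pi * a * w" for w
      using j by (simp add: power2_eq_square)
    have "Y j = integral {0..x / real j} (\<lambda>w. real j ^ k * (w ^ k * sin (2 * pi * real j * \<theta> + 2 * pi * a * w))) / (pi * x ^ Suc k)"
      unfolding Y_def power_mult_distrib by (simp only: mult.assoc)
    also have "\<dots> = real j ^ k * integral {0..x / real j} (\<lambda>w. w ^ k * sin (2 * pi * real j * \<theta> + 2 * pi * a * w)) / (pi * x ^ Suc k)"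
      by (simp only: integral_mult_right)
    also have "\<dots> = 2 * d j" unfolding d_def arg using j x by (simp add: power_divide field_simps)
    finally show ?thesis by simp
  qed
  have f': "\<bar>- (c * clifford_moment1 (Suc k) (c * b))\<bar> \<le> K * (1 + b) powr (-5/4)" if "0 \<le> b" for b
    using K[OF that] by simp
  from Poisson_summation_half_line[OF D f' Z[folded c_def] lim \<theta>]
  obtain S where S: "(\<lambda>j. 2 * d (Suc j)) sums S" "(\<lambda>n. clifford_moment k (c * (real n + \<theta>))) sums (Z + S)" by blast
  have "(\<lambda>j. Y (Suc j)) sums S" using S(1) dY[of "Suc _"] by simp
  with S(2) show ?thesis unfolding c_def by blast
qed

text \<open>
  The sum is \<open>2 sin A cos P\<close> for even \<open>k\<close> and \<open>2 cos A sin P\<close> for odd \<open>k\<close>; the shifts by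
  \<open>k\<pi>/2\<close> cover both cases.
\<close>
lemma sin_add_plus_sin_diff_alternating:
  fixes A P :: real
  shows "sin (A + P) + (-1) ^ k * sin (A - P) = 2 * (-1) ^ k * sin (A + real k * pi / 2) * cos (P + real k * pi / 2)"
proof -
  have "sin (A + P) + (-1) ^ k * sin (A - P) = (-1) ^ k * (sin ((A + real k * pi / 2) + (P + real k * pi / 2)) + sin ((A + real k * pi / 2) - (P + real k * pi / 2)))"
  proof -
    have h: "(A + real k * pi / 2) + (P + real k * pi / 2) = (A + P) + real k * pi" "(A + real k * pi / 2) - (P + real k * pi / 2) = A - P"
      by (simp_all add: field_simps)
    have s: "sin (y + real k * pi) = (-1) ^ k * sin y" for y by (simp add: sin_add)
    have ee: "(-1) ^ k * ((-1) ^ k * y) = y" for y :: real by (simp flip: mult.assoc power_mult_distrib)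
    show ?thesis unfolding h s distrib_left ee ..
  qed
  moreover have gen: "sin (X + Y) + sin (X - Y) = 2 * sin X * cos Y" for X Y :: real by (simp add: sin_add sin_diff)
  ultimately show ?thesis unfolding gen by (simp only: mult_ac)
qed

text \<open>
  Reflecting \<open>\<theta>\<close> to \<open>1 - \<theta>\<close> reverses the sign of the \<open>\<theta>\<close>-phase, so that the terms combine in
  pairs and a factor depending only on \<open>\<theta>\<close> splits off.  The phases \<open>2\<pi>aw\<close> and \<open>-2\<pi>a'w\<close> have half-sum \<open>2\<pi>(\<sigma> - 1/2)w\<close> and half-difference
  \<open>(2m+1)\<pi>w\<close>, which separates \<open>\<sigma>\<close> from \<open>m\<close>.
\<close>
lemma bracket_integrand_eq:
  fixes \<sigma> \<theta> w :: real and j m k :: nat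
  defines "a \<equiv> real m + \<sigma>" and "a' \<equiv> real m + 1 - \<sigma>"
  shows "sin (2*pi*real j * \<theta> + 2*pi*a * w) + (-1) ^ k * sin (2*pi*real j * \<theta> + 2*pi*a' * w)
     - (-1) ^ k * sin (2*pi*real j * (1 - \<theta>) + 2*pi*a * w) - sin (2*pi*real j * (1 - \<theta>) + 2*pi*a' * w)
   = 4 * (-1) ^ k * sin (2*pi*real j * \<theta> + real k * pi / 2) * cos (2*pi*(\<sigma> - 1/2) * w + real k * pi / 2) * cos ((2 * real m + 1) * pi * w)"
proof -
  let ?A = "2*pi*real j * \<theta>" and ?P = "2*pi*a * w" and ?Q = "2*pi*a' * w"
  let ?s = "sin (?A + real k * pi / 2)"
  have r: "sin (2*pi*real j * (1 - \<theta>) + y) = - sin (?A - y)" for y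
  proof -
    have e: "2*pi*real j * (1 - \<theta>) + y = - (?A - y) + 2*pi*real j" by (simp add: algebra_simps)
    have p: "sin (z + 2*pi*real j) = sin z" for z using sin.plus_of_nat[of z j] by (simp add: mult_ac)
    show ?thesis unfolding e p by (rule sin_minus)
  qed
  have ee: "(-1) ^ k * ((-1) ^ k * y) = y" for y :: real by (simp flip: mult.assoc power_mult_distrib)
  have 1: "sin (?A + ?P) + (-1) ^ k * sin (?A - ?P) = 2 * (-1) ^ k * ?s * cos (?P + real k * pi / 2)" by (rule sin_add_plus_sin_diff_alternating)
  have 2: "sin (?A + (- ?Q)) + (-1) ^ k * sin (?A - (- ?Q)) = 2 * (-1) ^ k * ?s * cos (- ?Q + real k * pi / 2)" by (rule sin_add_plus_sin_diff_alternating)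
  have 3: "cos (?P + real k * pi / 2) + cos (- ?Q + real k * pi / 2) = 2 * cos (2*pi*(\<sigma> - 1/2) * w + real k * pi / 2) * cos ((2 * real m + 1) * pi * w)"
  proof -
    have e: "((?P + real k * pi / 2) + (- ?Q + real k * pi / 2)) / 2 = 2*pi*(\<sigma> - 1/2) * w + real k * pi / 2"
      "((?P + real k * pi / 2) - (- ?Q + real k * pi / 2)) / 2 = (2 * real m + 1) * pi * w"
      unfolding a_def a'_def by (simp_all add: field_simps)
    show ?thesis unfolding cos_plus_cos e ..
  qed
  have "sin (2*pi*real j * \<theta> + ?P) + (-1) ^ k * sin (2*pi*real j * \<theta> + ?Q)
     - (-1) ^ k * sin (2*pi*real j * (1 - \<theta>) + ?P) - sin (2*pi*real j * (1 - \<theta>) + ?Q)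
     = (sin (?A + ?P) + (-1) ^ k * sin (?A - ?P)) + (sin (?A + (- ?Q)) + (-1) ^ k * sin (?A - (- ?Q)))"
    unfolding r by simp
  also have "\<dots> = 2 * (-1) ^ k * ?s * (cos (?P + real k * pi / 2) + cos (- ?Q + real k * pi / 2))"
    unfolding 1 2 by (simp only: distrib_left)
  also have "\<dots> = 4 * (-1) ^ k * ?s * cos (2*pi*(\<sigma> - 1/2) * w + real k * pi / 2) * cos ((2 * real m + 1) * pi * w)"
    unfolding 3 by simp
  finally show ?thesis .
qed

text \<open>
  The four Poisson formulas are added.  Their zero modes disappear: for \<open>k \<ge> 1\<close> they are 0, and for
  \<open>k = 0\<close> they cancel between \<open>\<theta>\<close> and \<open>1 - \<theta>\<close>, as they depend only on the first variable.
\<close>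
lemma bessel_bracket_series:
  fixes \<sigma> \<theta> x :: real and k m :: nat
  assumes \<sigma>: "0 < \<sigma>" "\<sigma> < 1" and \<theta>: "0 < \<theta>" "\<theta> < 1" and x: "0 < x"
  defines "g \<equiv> \<lambda>u v. clifford_moment k (4 * pi\<^sup>2 * x * u * v)"
  shows "\<exists>S. (\<lambda>n. g (real m + \<sigma>) (real n + \<theta>) + (-1) ^ k * g (real m + 1 - \<sigma>) (real n + \<theta>)
      - (-1) ^ k * g (real m + \<sigma>) (real n + 1 - \<theta>) - g (real m + 1 - \<sigma>) (real n + 1 - \<theta>)) sums S \<and>
     (\<lambda>j. 4 * (-1) ^ k / (pi * x ^ Suc k) * integral {0..x / real (Suc j)} (\<lambda>w. (real (Suc j) * w) ^ k * phase_sin \<theta> k (Suc j) *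
         (cos (2*pi*(\<sigma> - 1/2) * w + real k * pi / 2) * cos ((2 * real m + 1) * pi * w)))) sums S"
proof -
  let ?a = "real m + \<sigma>" and ?a' = "real m + 1 - \<sigma>"
  have a: "0 < ?a" "0 < ?a'" using \<sigma> by auto
  have \<theta>': "0 < 1 - \<theta>" "1 - \<theta> < 1" using \<theta> by auto
  have c: "0 < 4 * pi\<^sup>2 * x * ?a" "0 < 4 * pi\<^sup>2 * x * ?a'" using a x by auto
  define I where "I a t j = integral {0..x / real j} (\<lambda>w. (real j * w) ^ k * sin (2 * pi * real j * t + 2 * pi * a * w)) / (pi * x ^ Suc k)" for a t j
  obtain Z where Z: "(\<lambda>N. integral {0..real N} (\<lambda>b. clifford_moment k ((4 * pi\<^sup>2 * x * ?a) * b))) \<longlonglongrightarrow> Z" "1 \<le> k \<longrightarrow> Z = 0"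
    using integral_clifford_moment_tendsto[OF c(1)] by blast
  obtain Z' where Z': "(\<lambda>N. integral {0..real N} (\<lambda>b. clifford_moment k ((4 * pi\<^sup>2 * x * ?a') * b))) \<longlonglongrightarrow> Z'" "1 \<le> k \<longrightarrow> Z' = 0"
    using integral_clifford_moment_tendsto[OF c(2)] by blast
  obtain S1 where S1: "(\<lambda>j. I ?a \<theta> (Suc j)) sums S1" "(\<lambda>n. g ?a (real n + \<theta>)) sums (Z + S1)"
    using one_sided_bessel_series[OF a(1) x \<theta> Z(1)] unfolding I_def g_def by blast
  obtain S2 where S2: "(\<lambda>j. I ?a' \<theta> (Suc j)) sums S2" "(\<lambda>n. g ?a' (real n + \<theta>)) sums (Z' + S2)"
    using one_sided_bessel_series[OF a(2) x \<theta> Z'(1)] unfolding I_def g_def by blast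
  have e: "real n + (1 - \<theta>) = real n + 1 - \<theta>" for n by simp
  obtain S3 where S3: "(\<lambda>j. I ?a (1 - \<theta>) (Suc j)) sums S3" "(\<lambda>n. g ?a (real n + 1 - \<theta>)) sums (Z + S3)"
    using one_sided_bessel_series[OF a(1) x \<theta>' Z(1)] unfolding I_def g_def e by blast
  obtain S4 where S4: "(\<lambda>j. I ?a' (1 - \<theta>) (Suc j)) sums S4" "(\<lambda>n. g ?a' (real n + 1 - \<theta>)) sums (Z' + S4)"
    using one_sided_bessel_series[OF a(2) x \<theta>' Z'(1)] unfolding I_def g_def e by blast
  let ?S = "S1 + (-1) ^ k * S2 - (-1) ^ k * S3 - S4"
  have "(\<lambda>n. g ?a (real n + \<theta>) + (-1) ^ k * g ?a' (real n + \<theta>) - (-1) ^ k * g ?a (real n + 1 - \<theta>) - g ?a' (real n + 1 - \<theta>)) sums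
      ((Z + S1) + (-1) ^ k * (Z' + S2) - (-1) ^ k * (Z + S3) - (Z' + S4))"
    by (intro sums_diff sums_add sums_mult S1 S2 S3 S4)
  moreover have "(Z + S1) + (-1) ^ k * (Z' + S2) - (-1) ^ k * (Z + S3) - (Z' + S4) = ?S"
    using Z(2) Z'(2) by (cases k) (simp_all add: algebra_simps)
  moreover have "(\<lambda>j. I ?a \<theta> (Suc j) + (-1) ^ k * I ?a' \<theta> (Suc j) - (-1) ^ k * I ?a (1 - \<theta>) (Suc j) - I ?a' (1 - \<theta>) (Suc j)) sums ?S"
    by (intro sums_diff sums_add sums_mult S1 S2 S3 S4)
  moreover have "I ?a \<theta> j + (-1) ^ k * I ?a' \<theta> j - (-1) ^ k * I ?a (1 - \<theta>) j - I ?a' (1 - \<theta>) j =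
      4 * (-1) ^ k / (pi * x ^ Suc k) * integral {0..x / real j} (\<lambda>w. (real j * w) ^ k * phase_sin \<theta> k j *
         (cos (2*pi*(\<sigma> - 1/2) * w + real k * pi / 2) * cos ((2 * real m + 1) * pi * w)))" for j
  proof -
    let ?i = "\<lambda>a t w. (real j * w) ^ k * sin (2 * pi * real j * t + 2 * pi * a * w)"
    let ?r = "\<lambda>w. (real j * w) ^ k * phase_sin \<theta> k j * (cos (2*pi*(\<sigma> - 1/2) * w + real k * pi / 2) * cos ((2 * real m + 1) * pi * w))"
    have h: "((?i a t) has_integral integral {0..x / real j} (?i a t)) {0..x / real j}" for a t
      by (intro integrable_integral integrable_continuous_real continuous_intros)
    have "((\<lambda>w. ?i ?a \<theta> w + (-1) ^ k * ?i ?a' \<theta> w - (-1) ^ k * ?i ?a (1 - \<theta>) w - ?i ?a' (1 - \<theta>) w) has_integral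
      (integral {0..x / real j} (?i ?a \<theta>) + (-1) ^ k * integral {0..x / real j} (?i ?a' \<theta>)
        - (-1) ^ k * integral {0..x / real j} (?i ?a (1 - \<theta>)) - integral {0..x / real j} (?i ?a' (1 - \<theta>)))) {0..x / real j}"
      by (intro has_integral_diff has_integral_add has_integral_mult_right h)
    moreover have "?i ?a \<theta> w + (-1) ^ k * ?i ?a' \<theta> w - (-1) ^ k * ?i ?a (1 - \<theta>) w - ?i ?a' (1 - \<theta>) w = 4 * (-1) ^ k * ?r w" for w
    proof -
      have alg: "q * s1 + e * (q * s2) - e * (q * s3) - q * s4 = q * (s1 + e * s2 - e * s3 - s4)" for q s1 s2 s3 s4 e :: real
        by (simp add: algebra_simps)
      show ?thesis unfolding alg bracket_integrand_eq phase_sin_def[OF \<theta> x] by (simp add: mult_ac)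
    qed
    ultimately have "((\<lambda>w. 4 * (-1) ^ k * ?r w) has_integral
      (integral {0..x / real j} (?i ?a \<theta>) + (-1) ^ k * integral {0..x / real j} (?i ?a' \<theta>)
        - (-1) ^ k * integral {0..x / real j} (?i ?a (1 - \<theta>)) - integral {0..x / real j} (?i ?a' (1 - \<theta>)))) {0..x / real j}"
      by (simp only:)
    from integral_unique[OF this]
    have r: "4 * (-1) ^ k * integral {0..x / real j} ?r = integral {0..x / real j} (?i ?a \<theta>) + (-1) ^ k * integral {0..x / real j} (?i ?a' \<theta>)
        - (-1) ^ k * integral {0..x / real j} (?i ?a (1 - \<theta>)) - integral {0..x / real j} (?i ?a' (1 - \<theta>))"
      by (simp only: integral_mult_right)
    have alg: "p / d + e * (q / d) - e * (s / d) - t / d = (p + e * q - e * s - t) / d" for p q s t e d :: real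
      by (simp add: add_divide_distrib diff_divide_distrib)
    show ?thesis unfolding I_def alg r[symmetric] by simp
  qed
  ultimately show ?thesis by (intro exI[of _ ?S]) simp
qed

text \<open>
  Finitely many convergent series over \<open>j\<close> may be added, so the sum over \<open>m\<close> is taken inside, where
  it gives the kernel.  The sum over \<open>j\<close> is then performed under the integral.
\<close>
lemma partial_sum_eq_dirichlet_integral:
  fixes \<sigma> \<theta> x :: real and k M :: nat
  assumes \<theta>: "0 < \<theta>" "\<theta> < 1" and x: "0 < x"
    and S: "\<And>m. (\<lambda>j. 4 * (-1) ^ k / (pi * x ^ Suc k) * integral {0..x / real (Suc j)} (\<lambda>w. (real (Suc j) * w) ^ k * phase_sin \<theta> k (Suc j) *
         (cos (2*pi*(\<sigma> - 1/2) * w + real k * pi / 2) * cos ((2 * real m + 1) * pi * w)))) sums S m"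
  shows "(\<Sum>m<M. S m) = 2 * (-1) ^ k / (pi * x ^ Suc k) *
     integral {0..x} (\<lambda>w. hyperbola_sum \<theta> x k w * (cos (2*pi*(\<sigma> - 1/2) * w + real k * pi / 2) * dirichlet_kernel M w))"
proof -
  let ?C = "\<lambda>w. cos (2*pi*(\<sigma> - 1/2) * w + real k * pi / 2)"
  let ?c = "2 * (-1) ^ k / (pi * x ^ Suc k)"
  let ?F = "\<lambda>j w. (real j * w) ^ k * phase_sin \<theta> k j * (?C w * dirichlet_kernel M w)"
  have "(\<lambda>j. \<Sum>m<M. 4 * (-1) ^ k / (pi * x ^ Suc k) * integral {0..x / real (Suc j)} (\<lambda>w. (real (Suc j) * w) ^ k * phase_sin \<theta> k (Suc j) *
         (?C w * cos ((2 * real m + 1) * pi * w)))) sums (\<Sum>m<M. S m)"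
    by (intro sums_sum S)
  moreover have "(\<Sum>m<M. 4 * (-1) ^ k / (pi * x ^ Suc k) * integral {0..x / real j} (\<lambda>w. (real j * w) ^ k * phase_sin \<theta> k j *
         (?C w * cos ((2 * real m + 1) * pi * w)))) = ?c * integral {0..x / real j} (?F j)" for j
  proof -
    let ?f = "\<lambda>m w. (real j * w) ^ k * phase_sin \<theta> k j * (?C w * cos ((2 * real m + 1) * pi * w))"
    have i: "((\<lambda>w. 2 * (\<Sum>m<M. ?f m w)) has_integral 2 * (\<Sum>m<M. integral {0..x / real j} (?f m))) {0..x / real j}"
      by (intro has_integral_mult_right has_integral_sum integrable_integral integrable_continuous_real continuous_intros) auto
    have "2 * (\<Sum>m<M. ?f m w) = ?F j w" for w
      unfolding dirichlet_kernel_def sum_distrib_left by (simp only: mult_ac)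
    with i have I: "(?F j has_integral 2 * (\<Sum>m<M. integral {0..x / real j} (?f m))) {0..x / real j}" by (simp only:)
    show ?thesis unfolding integral_unique[OF I] sum_distrib_left[symmetric] by simp
  qed
  ultimately have "(\<lambda>j. ?c * integral {0..x / real (Suc j)} (?F (Suc j))) sums (\<Sum>m<M. S m)" by (simp only:)
  hence "(\<lambda>J. ?c * (\<Sum>j = 1..J. integral {0..x / real j} (?F j))) \<longlonglongrightarrow> (\<Sum>m<M. S m)"
    unfolding sums_def by (simp only: sum_distrib_left[symmetric] sum.atLeast1_atMost_eq One_nat_def)
  moreover have "(\<lambda>J. ?c * (\<Sum>j = 1..J. integral {0..x / real j} (?F j))) \<longlonglongrightarrow> ?c * integral {0..x} (\<lambda>w. hyperbola_sum \<theta> x k w * (?C w * dirichlet_kernel M w))"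
    by (intro tendsto_mult tendsto_const hyperbola_sum_integral_series[OF \<theta> x] continuous_intros)
  ultimately show ?thesis by (rule LIMSEQ_unique)
qed

text \<open>
  It remains to compare constants.  The sign \<open>(-1)\<^sup>l\<close> from the antiperiodic kernel turns the
  phase \<open>2\<pi>(\<sigma> - 1/2)l\<close> into \<open>2\<pi>\<sigma>l\<close>, and both sides reduce to the same finite sum.
\<close>
theorem theorem2p1:
  fixes \<sigma> \<theta> x :: real and k :: nat
  assumes "0 < \<sigma>" and "\<sigma> < 1" and "0 < \<theta>" and "\<theta> < 1" and "0 < x"
  shows "(\<forall>m. summable (\<lambda>n. mixed_deriv k (bessel_bracket x m n) \<sigma> \<theta>))
       \<and> summable (\<lambda>m. \<Sum>n. mixed_deriv k (bessel_bracket x m n) \<sigma> \<theta>)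
       \<and> mixed_deriv k
           (\<lambda>s t. primed_sum x (\<lambda>m n. cos (2 * pi * real m * s) * sin (2 * pi * real n * t))
                  + cot (pi * t) / 4) \<sigma> \<theta>
         = sqrt x / 4 * (\<Sum>m. \<Sum>n. mixed_deriv k (bessel_bracket x m n) \<sigma> \<theta>)"
proof -
  define q where "q = 2 * pi * sqrt x * (- (4 * pi\<^sup>2 * x)) ^ k"
  define r where "r = 2 * (-1) ^ k / (pi * x ^ Suc k)"
  let ?D = "\<lambda>m n. mixed_deriv k (bessel_bracket x m n) \<sigma> \<theta>"
  let ?C = "\<lambda>w. cos (2*pi*(\<sigma> - 1/2) * w + real k * pi / 2)"
  note D = mixed_deriv_bessel_bracket[OF assms, of k, folded q_def]
  have ex: "\<forall>m. \<exists>S. (\<lambda>n. ?D m n) sums (q * S) \<and>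
     (\<lambda>j. 4 * (-1) ^ k / (pi * x ^ Suc k) * integral {0..x / real (Suc j)} (\<lambda>w. (real (Suc j) * w) ^ k * phase_sin \<theta> k (Suc j) *
         (?C w * cos ((2 * real m + 1) * pi * w)))) sums S"
  proof
    fix m
    from bessel_bracket_series[OF assms, where m = m and k = k] obtain S where S:
      "(\<lambda>n. clifford_moment k (4 * pi\<^sup>2 * x * (real m + \<sigma>) * (real n + \<theta>)) + (-1) ^ k * clifford_moment k (4 * pi\<^sup>2 * x * (real m + 1 - \<sigma>) * (real n + \<theta>))
      - (-1) ^ k * clifford_moment k (4 * pi\<^sup>2 * x * (real m + \<sigma>) * (real n + 1 - \<theta>)) - clifford_moment k (4 * pi\<^sup>2 * x * (real m + 1 - \<sigma>) * (real n + 1 - \<theta>))) sums S"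
      "(\<lambda>j. 4 * (-1) ^ k / (pi * x ^ Suc k) * integral {0..x / real (Suc j)} (\<lambda>w. (real (Suc j) * w) ^ k * phase_sin \<theta> k (Suc j) *
         (?C w * cos ((2 * real m + 1) * pi * w)))) sums S" by blast
    show "\<exists>S. (\<lambda>n. ?D m n) sums (q * S) \<and>
     (\<lambda>j. 4 * (-1) ^ k / (pi * x ^ Suc k) * integral {0..x / real (Suc j)} (\<lambda>w. (real (Suc j) * w) ^ k * phase_sin \<theta> k (Suc j) *
         (?C w * cos ((2 * real m + 1) * pi * w)))) sums S"
      unfolding D by (intro exI[of _ S] conjI sums_mult S)
  qed
  from choice[OF ex] obtain S where S0: "\<forall>m. (\<lambda>n. ?D m n) sums (q * S m) \<and>
     (\<lambda>j. 4 * (-1) ^ k / (pi * x ^ Suc k) * integral {0..x / real (Suc j)} (\<lambda>w. (real (Suc j) * w) ^ k * phase_sin \<theta> k (Suc j) *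
         (?C w * cos ((2 * real m + 1) * pi * w)))) sums S m" by (rule exE)
  note S = S0[rule_format, THEN conjunct1] S0[rule_format, THEN conjunct2]
  define P where "P = primed_sum x (\<lambda>l j. (-1) ^ l * ((real j * real l) ^ k * phase_sin \<theta> k j * ?C (real l)))"
  have Cd: "(?C has_real_derivative - sin (2*pi*(\<sigma> - 1/2) * w + real k * pi / 2) * (2*pi*(\<sigma> - 1/2))) (at w)" for w
    by (auto intro!: derivative_eq_intros)
  have "(\<lambda>M. integral {0..x} (\<lambda>w. hyperbola_sum \<theta> x k w * (?C w * dirichlet_kernel M w))) \<longlonglongrightarrow> P - 0 ^ k * phase_prim \<theta> k 0 * ?C 0 / 2"
    unfolding P_def by (rule hyperbola_sum_dirichlet_tendsto[OF assms(3-5) Cd]) (intro continuous_intros)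
  hence lim: "(\<lambda>M. q * (r * integral {0..x} (\<lambda>w. hyperbola_sum \<theta> x k w * (?C w * dirichlet_kernel M w)))) \<longlonglongrightarrow> q * (r * (P - 0 ^ k * phase_prim \<theta> k 0 * ?C 0 / 2))"
    by (intro tendsto_mult tendsto_const)
  have "(\<lambda>m. q * S m) sums (q * (r * (P - 0 ^ k * phase_prim \<theta> k 0 * ?C 0 / 2)))"
    unfolding sums_def sum_distrib_left[symmetric] partial_sum_eq_dirichlet_integral[OF assms(3-5) S(2), folded r_def] by (rule lim)
  moreover have inner: "(\<Sum>n. ?D m n) = q * S m" for m using S(1) by (simp add: sums_iff)
  ultimately have outer: "(\<lambda>m. \<Sum>n. ?D m n) sums (q * (r * (P - 0 ^ k * phase_prim \<theta> k 0 * ?C 0 / 2)))" by simp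
  have const: "sqrt x / 4 * (q * r) = (4 * pi\<^sup>2) ^ k"
  proof -
    have "sqrt x / 4 * (q * r) = (sqrt x * sqrt x) * ((- (4 * pi\<^sup>2 * x)) ^ k * (-1) ^ k) / (x * x ^ k)"
      unfolding q_def r_def by simp
    also have "(- (4 * pi\<^sup>2 * x)) ^ k * (-1) ^ k = (4 * pi\<^sup>2) ^ k * x ^ k"
      unfolding power_mult_distrib[symmetric] by simp
    also have "(sqrt x * sqrt x) * ((4 * pi\<^sup>2) ^ k * x ^ k) / (x * x ^ k) = (4 * pi\<^sup>2) ^ k" using assms(5) by simp
    finally show ?thesis .
  qed
  have zero: "(4 * pi\<^sup>2) ^ k * (- (0 ^ k * phase_prim \<theta> k 0 * ?C 0 / 2)) = (if k = 0 then cot (pi * \<theta>) / 4 else 0)"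
    by (cases k) (simp_all add: phase_prim_def[OF assms(3-5)] cot_def)
  have main: "(4 * pi\<^sup>2) ^ k * P = primed_sum x (\<lambda>m n. ((2 * pi * real m) ^ k * cos (2 * pi * real m * \<sigma> + real k * pi / 2)) * ((2 * pi * real n) ^ k * sin (2 * pi * real n * \<theta> + real k * pi / 2)))"
  proof -
    \<comment> \<open>The sign of the kernel cancels the shift of \<open>\<sigma>\<close> by \<open>1/2\<close>.\<close>
    have C: "(-1) ^ l * ?C (real l) = cos (2 * pi * real l * \<sigma> + real k * pi / 2)" for l
    proof -
      have e: "2*pi*(\<sigma> - 1/2) * real l + real k * pi / 2 = (2 * pi * real l * \<sigma> + real k * pi / 2) - real l * pi" by (simp add: algebra_simps)
      have c: "cos (y - real l * pi) = (-1) ^ l * cos y" for y by (simp add: cos_diff)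
      have ee: "(-1) ^ l * ((-1) ^ l * y) = y" for y :: real by (simp flip: mult.assoc power_mult_distrib)
      show ?thesis unfolding e c ee ..
    qed
    have summand: "(4 * pi\<^sup>2) ^ k * (w * ((-1) ^ l * ((real j * real l) ^ k * phase_sin \<theta> k j * ?C (real l)))) =
       w * (((2 * pi * real l) ^ k * cos (2 * pi * real l * \<sigma> + real k * pi / 2)) * ((2 * pi * real j) ^ k * sin (2 * pi * real j * \<theta> + real k * pi / 2)))" for l j w
    proof -
      have p: "(4 * pi\<^sup>2) ^ k * (real j * real l) ^ k = (2 * pi * real l) ^ k * (2 * pi * real j) ^ k"
        unfolding power_mult_distrib[symmetric]
        by (rule arg_cong[where f = "\<lambda>z. z ^ k"]) (simp add: power2_eq_square)
      have "(4 * pi\<^sup>2) ^ k * (w * ((-1) ^ l * ((real j * real l) ^ k * phase_sin \<theta> k j * ?C (real l))))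
        = w * ((4 * pi\<^sup>2) ^ k * (real j * real l) ^ k) * phase_sin \<theta> k j * ((-1) ^ l * ?C (real l))" by (simp only: mult_ac)
      thus ?thesis unfolding p C phase_sin_def[OF assms(3-5)] by (simp only: mult_ac)
    qed
    show ?thesis unfolding P_def primed_sum_def sum_distrib_left split_def
      by (rule sum.cong[OF refl], rule summand)
  qed
  have "sqrt x / 4 * (q * (r * (P - 0 ^ k * phase_prim \<theta> k 0 * ?C 0 / 2))) = (4 * pi\<^sup>2) ^ k * P + (4 * pi\<^sup>2) ^ k * (- (0 ^ k * phase_prim \<theta> k 0 * ?C 0 / 2))"
  proof -
    have alg: "a * (b * (c * (p - z))) = a * (b * c) * p + a * (b * c) * (- z)" for a b c p z :: real
      by (simp add: algebra_simps)
    show ?thesis unfolding const[symmetric] by (rule alg)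
  qed
  hence "sqrt x / 4 * (\<Sum>m. \<Sum>n. ?D m n) = mixed_deriv k (\<lambda>s t. primed_sum x (\<lambda>m n. cos (2 * pi * real m * s) * sin (2 * pi * real n * t)) + cot (pi * t) / 4) \<sigma> \<theta>"
    unfolding mixed_deriv_primed_sum[OF assms(1-4)] main zero sums_unique[OF outer, symmetric] .
  thus ?thesis using S(1) outer by (auto simp: sums_iff)
qed

end
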